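(* Let $X$ be a compact complex manifold and $X_t$ a small deformation of $X$ whose complex structure is represented by a Beltrami differential $\phi\in A^{0,1}(X,T_X^{1,0})$. If $X$ satisfies the $\partial\bar\partial_\phi$-lemma, then $X$ is formal.
   Context: $A^{p,q}(X)$ denotes the smooth complex-valued $(p,q)$-forms on $X$. For $\phi\in A^{0,1}(X,T_X^{1,0})$, $i_\phi$ is the contraction: if locally $\phi=\sum_i\phi^i\otimes\partial/\partial z^i$ with $\phi^i$ $(0,1)$-forms, then $i_\phi\sigma=\sum_i\phi^i\wedge(\tfrac{\partial}{\partial z^i}\lrcorner\,\sigma)$. That $\phi$ represents the complex structure of $X_t$ (a complex manifold with the same underlying smooth manifold as $X$) means: $\phi$ is integrable, $\bar\partial\phi=\frac12[\phi,\phi]$, and a local function $f$ is holomorphic on $X_t$ iff $\bar\partial f-i_\phi\partial f=0$; $\phi$ is small. Put $\mathcal{L}^{1,0}_\phi:=i_\phi\partial-\partial i_\phi$, $\bar\partial_\phi:=\bar\partial-\mathcal{L}^{1,0}_\phi$, $d_\phi:=\partial+\bar\partial_\phi=e^{-i_\phi}de^{i_\phi}$. $X$ satisfies the $\partial\bar\partial_\phi$-lemma if $\ker\partial\cap\ker\bar\partial_\phi\cap\operatorname{Im}d_\phi=\operatorname{Im}\partial\bar\partial_\phi$ in $A^\bullet(X)=\bigoplus_{p,q}A^{p,q}(X)$. A smooth manifold $X$ is formal if its de Rham complex $(A^\bullet(X),d)$ (complex coefficients) is formal as a differential graded algebra, i.e. it is connected by a sequence (zigzag) of quasi-isomorphisms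 of differential graded algebras to its cohomology algebra $(H^\bullet_{dR}(X),0)$ with zero differential. *)

theory Defs
  imports "HOL-Analysis.Analysis" "HOL-Algebra.QuotRing" "HOL-Algebra.Module"
begin

section \<open>Differential graded algebras over the complex numbers, and formality\<close>

definition complex_ring :: "complex ring" where
  "complex_ring = \<lparr>carrier = UNIV, monoid.mult = (*), monoid.one = 1, ring.zero = 0, ring.add = (+)\<rparr>"

record 'b dga = "(complex, 'b) module" +
  grade :: "nat \<Rightarrow> 'b set"
  diff :: "'b \<Rightarrow> 'b"

text \<open>Associative and unital, \<open>\<nat>\<close>-graded, differential of degree \<open>+1\<close>.  The library locale
  \<open>algebra\<close> is not usable here, because it requires the multiplication to be commutative.\<close>

locale dg_algebra = module complex_ring A + ring A for A :: "'b dga" (structure) +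
  assumes smult_mult_left:
      "\<lbrakk>x \<in> carrier A; y \<in> carrier A\<rbrakk> \<Longrightarrow> (c \<odot> x) \<otimes> y = c \<odot> (x \<otimes> y)"
    and smult_mult_right:
      "\<lbrakk>x \<in> carrier A; y \<in> carrier A\<rbrakk> \<Longrightarrow> x \<otimes> (c \<odot> y) = c \<odot> (x \<otimes> y)"
    and grade_submodule: "submodule (grade A k) complex_ring A"
    and grade_decomposition:
      "x \<in> carrier A \<Longrightarrow>
        \<exists>!f. (\<forall>k. f k \<in> grade A k) \<and> finite {k. f k \<noteq> \<zero>} \<and> x = (\<Oplus>k\<in>{k. f k \<noteq> \<zero>}. f k)"
    and grade_one: "\<one> \<in> grade A 0"
    and grade_mult: "\<lbrakk>x \<in> grade A k; y \<in> grade A l\<rbrakk> \<Longrightarrow> x \<otimes> y \<in> grade A (k + l)"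
    and diff_add: "\<lbrakk>x \<in> carrier A; y \<in> carrier A\<rbrakk> \<Longrightarrow> diff A (x \<oplus> y) = diff A x \<oplus> diff A y"
    and diff_smult: "x \<in> carrier A \<Longrightarrow> diff A (c \<odot> x) = c \<odot> diff A x"
    and diff_grade: "x \<in> grade A k \<Longrightarrow> diff A x \<in> grade A (Suc k)"
    and diff_diff: "x \<in> carrier A \<Longrightarrow> diff A (diff A x) = \<zero>"
    and diff_mult:
      "\<lbrakk>x \<in> grade A k; y \<in> carrier A\<rbrakk> \<Longrightarrow>
        diff A (x \<otimes> y) = (diff A x \<otimes> y) \<oplus> ((- 1) ^ k \<odot> (x \<otimes> diff A y))"

definition dga_hom :: "'b dga \<Rightarrow> 'c dga \<Rightarrow> ('b \<Rightarrow> 'c) set" where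
  "dga_hom A B = {f \<in> ring_hom A B.
     (\<forall>c. \<forall>x\<in>carrier A. f (c \<odot>\<^bsub>A\<^esub> x) = c \<odot>\<^bsub>B\<^esub> f x) \<and>
     (\<forall>k. f ` grade A k \<subseteq> grade B k) \<and>
     (\<forall>x\<in>carrier A. f (diff A x) = diff B (f x))}"

definition cocycles :: "'b dga \<Rightarrow> 'b set" where
  "cocycles A = {x \<in> carrier A. diff A x = \<zero>\<^bsub>A\<^esub>}"

definition coboundaries :: "'b dga \<Rightarrow> 'b set" where
  "coboundaries A = diff A ` carrier A"

definition cocycle_ring :: "'b dga \<Rightarrow> 'b dga" where
  "cocycle_ring A = A\<lparr>carrier := cocycles A\<rparr>"

definition cohomology :: "'b dga \<Rightarrow> 'b set dga" where
  "cohomology A =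
     (let Z = cocycle_ring A; B = coboundaries A; H = Z Quot B in
      \<lparr>carrier = carrier H, monoid.mult = monoid.mult H, monoid.one = monoid.one H,
       ring.zero = ring.zero H, ring.add = ring.add H,
       module.smult = (\<lambda>c S. \<Union>x\<in>S. B +>\<^bsub>Z\<^esub> (c \<odot>\<^bsub>A\<^esub> x)),
       grade = (\<lambda>k. {B +>\<^bsub>Z\<^esub> x | x. x \<in> cocycles A \<inter> grade A k}),
       diff = (\<lambda>_. B)\<rparr>)"

definition cohomology_map :: "'b dga \<Rightarrow> 'c dga \<Rightarrow> ('b \<Rightarrow> 'c) \<Rightarrow> 'b set \<Rightarrow> 'c set" where
  "cohomology_map A B f S = (\<Union>x\<in>S. coboundaries B +>\<^bsub>cocycle_ring B\<^esub> f x)"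

definition quasi_iso :: "'b dga \<Rightarrow> 'c dga \<Rightarrow> ('b \<Rightarrow> 'c) \<Rightarrow> bool" where
  "quasi_iso A B f \<longleftrightarrow> dg_algebra A \<and> dg_algebra B \<and> f \<in> dga_hom A B \<and>
     bij_betw (cohomology_map A B f) (carrier (cohomology A)) (carrier (cohomology B))"

text \<open>The intermediate algebras of the zigzag live on subsets of the type \<^typ>\<open>'b set\<close>, the type that
  carries the cohomology algebra; HOL cannot quantify over all types inside a definition.  This
  is no restriction: starting from \<open>A\<close>, a zigzag of arbitrary algebras can be replaced by one whose
  members have cardinality at most that of \<open>A\<close> (or by a zigzag of zero algebras if \<open>A\<close> is acyclic).
  The first step is stated separately because \<open>A\<close> lives on \<^typ>\<open>'b\<close>.\<close>

definition formal :: "'b dga \<Rightarrow> bool" where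
  "formal A \<longleftrightarrow> (\<exists>C :: 'b set dga.
     ((\<exists>f. quasi_iso A C f) \<or> (\<exists>f. quasi_iso C A f)) \<and>
     equivclp (\<lambda>D E. \<exists>f. quasi_iso D E f) C (cohomology A))"


section \<open>Calculus in \<open>\<complex>\<^sup>n\<close>\<close>

abbreviation D :: "('v::real_normed_vector \<Rightarrow> 'w::real_normed_vector) \<Rightarrow> 'v \<Rightarrow> 'v \<Rightarrow> 'w" where
  "D f z \<equiv> frechet_derivative f (at z)"

text \<open>Meaningful for open sets.\<close>

primrec C_diff_on :: "nat \<Rightarrow> 'v::real_normed_vector set \<Rightarrow> ('v \<Rightarrow> 'w::real_normed_vector) \<Rightarrow> bool" where
  "C_diff_on 0 S f \<longleftrightarrow> continuous_on S f"
| "C_diff_on (Suc k) S f \<longleftrightarrow>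
     (\<forall>z\<in>S. f differentiable (at z)) \<and> (\<forall>v. C_diff_on k S (\<lambda>z. D f z v))"

definition smooth_on :: "'v::real_normed_vector set \<Rightarrow> ('v \<Rightarrow> 'w::real_normed_vector) \<Rightarrow> bool" where
  "smooth_on S f \<longleftrightarrow> (\<forall>k. C_diff_on k S f)"

text \<open>Wirtinger derivatives \<open>\<partial>/\<partial>z\<^sup>i = (\<partial>/\<partial>x\<^sup>i - \<i> \<partial>/\<partial>y\<^sup>i)/2\<close> and
  \<open>\<partial>/\<partial>zbar\<^sup>i = (\<partial>/\<partial>x\<^sup>i + \<i> \<partial>/\<partial>y\<^sup>i)/2\<close>.\<close>

definition wirt :: "'n::finite \<Rightarrow> (complex^'n \<Rightarrow> complex) \<Rightarrow> complex^'n \<Rightarrow> complex" where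
  "wirt i f z = (D f z (axis i 1) - \<i> * D f z (axis i \<i>)) / 2"

definition wirt_bar :: "'n::finite \<Rightarrow> (complex^'n \<Rightarrow> complex) \<Rightarrow> complex^'n \<Rightarrow> complex" where
  "wirt_bar i f z = (D f z (axis i 1) + \<i> * D f z (axis i \<i>)) / 2"

definition holo_on :: "(complex^'n::finite) set \<Rightarrow> (complex^'n \<Rightarrow> complex) \<Rightarrow> bool" where
  "holo_on S f \<longleftrightarrow> smooth_on S f \<and> (\<forall>z\<in>S. \<forall>i. wirt_bar i f z = 0)"


section \<open>Complex manifolds\<close>

text \<open>A chart is a domain together with a coordinate map.  Atlases need not be maximal.\<close>

type_synonym ('a, 'n) chart = "'a set \<times> ('a \<Rightarrow> complex^'n)"

definition chart_image :: "('a, 'n) chart \<Rightarrow> (complex^'n) set" where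
  "chart_image c = snd c ` fst c"

definition chart_inv :: "('a, 'n) chart \<Rightarrow> complex^'n \<Rightarrow> 'a" where
  "chart_inv c = inv_into (fst c) (snd c)"

definition overlap :: "('a, 'n) chart \<Rightarrow> ('a, 'n) chart \<Rightarrow> (complex^'n) set" where
  "overlap c c' = snd c ` (fst c \<inter> fst c')"

definition transition :: "('a, 'n) chart \<Rightarrow> ('a, 'n) chart \<Rightarrow> complex^'n \<Rightarrow> complex^'n" where
  "transition c c' = snd c' \<circ> chart_inv c"

definition is_chart :: "'a topology \<Rightarrow> ('a, 'n::finite) chart \<Rightarrow> bool" where
  "is_chart X c \<longleftrightarrow> openin X (fst c) \<and> open (chart_image c) \<and>
     homeomorphic_map (subtopology X (fst c)) (top_of_set (chart_image c)) (snd c)"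

definition complex_manifold :: "'a topology \<Rightarrow> ('a, 'n::finite) chart set \<Rightarrow> bool" where
  "complex_manifold X \<A> \<longleftrightarrow> Hausdorff_space X \<and> second_countable X \<and>
     (\<forall>c\<in>\<A>. is_chart X c) \<and> (\<Union>c\<in>\<A>. fst c) = topspace X \<and>
     (\<forall>c\<in>\<A>. \<forall>c'\<in>\<A>. \<forall>j. holo_on (overlap c c') (\<lambda>z. transition c c' z $ j))"

definition same_smooth_structure :: "('a, 'n::finite) chart set \<Rightarrow> ('a, 'n) chart set \<Rightarrow> bool" where
  "same_smooth_structure \<A> \<B> \<longleftrightarrow>
     (\<forall>c\<in>\<A>. \<forall>b\<in>\<B>. smooth_on (overlap c b) (transition c b) \<and> smooth_on (overlap b c) (transition b c))"

definition smooth_fun :: "('a, 'n::finite) chart set \<Rightarrow> 'a set \<Rightarrow> ('a \<Rightarrow> complex) \<Rightarrow> bool" where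
  "smooth_fun \<A> W f \<longleftrightarrow> (\<forall>c\<in>\<A>. smooth_on (snd c ` (W \<inter> fst c)) (f \<circ> chart_inv c))"

definition holo_fun :: "('a, 'n::finite) chart set \<Rightarrow> 'a set \<Rightarrow> ('a \<Rightarrow> complex) \<Rightarrow> bool" where
  "holo_fun \<A> W f \<longleftrightarrow> (\<forall>c\<in>\<A>. holo_on (snd c ` (W \<inter> fst c)) (f \<circ> chart_inv c))"


section \<open>Alternating forms at a point\<close>

text \<open>An element of the complexified exterior algebra is a function on lists of tangent vectors whose
  restriction to lists of length \<open>k\<close> is its component of degree \<open>k\<close>, an \<open>\<real>\<close>-multilinear
  alternating \<open>\<complex>\<close>-valued form.  Tangent vectors are real ones, a vector \<open>v\<close> of \<open>\<complex>\<^sup>n\<close> standing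
  for the real derivation along \<open>v\<close>.\<close>

type_synonym 'n cform = "(complex^'n) list \<Rightarrow> complex"

definition alternating :: "'n::finite cform \<Rightarrow> bool" where
  "alternating \<alpha> \<longleftrightarrow> (\<forall>us ws. linear (\<lambda>v. \<alpha> (us @ v # ws))) \<and> (\<forall>us. \<not> distinct us \<longrightarrow> \<alpha> us = 0)"

text \<open>Wedge product as signed sum over shuffles, expanded along the first argument: \<open>v\<close> is passed
  either to the left factor, or to the right factor after moving past the remaining arguments
  of the left one.  Normalised so that \<open>(\<alpha> \<and> \<beta>)(u, v) = \<alpha>(u) \<beta>(v) - \<alpha>(v) \<beta>(u)\<close> in degree \<open>1\<close>.\<close>

primrec wedge :: "'n cform \<Rightarrow> 'n cform \<Rightarrow> 'n cform" where
  "wedge \<alpha> \<beta> [] = \<alpha> [] * \<beta> []"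
| "wedge \<alpha> \<beta> (v # us) =
     wedge (\<lambda>ws. \<alpha> (v # ws)) \<beta> us + wedge (\<lambda>ws. (- 1) ^ length ws * \<alpha> ws) (\<lambda>ws. \<beta> (v # ws)) us"

definition covector :: "(complex^'n \<Rightarrow> complex) \<Rightarrow> 'n cform" where
  "covector l us = (case us of [v] \<Rightarrow> l v | _ \<Rightarrow> 0)"

lemma wedge_covector: "wedge (covector l) (covector m) [u, v] = l u * m v - l v * m u"
  by (simp add: covector_def)

definition dz :: "'n::finite \<Rightarrow> 'n cform" where
  "dz i = covector (\<lambda>v. v $ i)"

definition dz_bar :: "'n::finite \<Rightarrow> 'n cform" where
  "dz_bar i = covector (\<lambda>v. cnj (v $ i))"

text \<open>Contraction with \<open>\<partial>/\<partial>z\<^sup>i\<close>, using the complex linear extension of the form.\<close>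

definition contract_dz :: "'n::finite \<Rightarrow> 'n cform \<Rightarrow> 'n cform" where
  "contract_dz i \<alpha> us = (\<alpha> (axis i 1 # us) - \<i> * \<alpha> (axis i \<i> # us)) / 2"

text \<open>A matrix \<open>M\<close> encodes the element \<open>\<Sum>i j. M$i$j dzbar\<^sup>j \<otimes> \<partial>/\<partial>z\<^sup>i\<close> of
  \<open>\<Lambda>\<^sup>0\<^sup>,\<^sup>1 \<otimes> T\<^sup>1\<^sup>,\<^sup>0\<close>: \<open>row_form i M\<close> is the coefficient of \<open>\<partial>/\<partial>z\<^sup>i\<close>,
  and \<open>bel M\<close> is the corresponding conjugate-linear map.\<close>

definition row_form :: "'n::finite \<Rightarrow> complex^'n^'n \<Rightarrow> 'n cform" where
  "row_form i M us = (\<Sum>j\<in>UNIV. M $ i $ j * dz_bar j us)"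

definition bel :: "complex^'n::finite^'n \<Rightarrow> complex^'n \<Rightarrow> complex^'n" where
  "bel M v = M *v (\<chi> j. cnj (v $ j))"

definition contract_matrix :: "complex^'n::finite^'n \<Rightarrow> 'n cform \<Rightarrow> 'n cform" where
  "contract_matrix M \<alpha> us = (\<Sum>i\<in>UNIV. wedge (row_form i M) (contract_dz i \<alpha>) us)"


section \<open>Forms in local coordinates\<close>

type_synonym 'n lform = "complex^'n \<Rightarrow> 'n cform"

definition lform_wirt :: "'n::finite \<Rightarrow> 'n lform \<Rightarrow> 'n lform" where
  "lform_wirt i \<omega> z us = wirt i (\<lambda>y. \<omega> y us) z"

definition lform_wirt_bar :: "'n::finite \<Rightarrow> 'n lform \<Rightarrow> 'n lform" where
  "lform_wirt_bar i \<omega> z us = wirt_bar i (\<lambda>y. \<omega> y us) z"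

definition del_local :: "'n::finite lform \<Rightarrow> 'n lform" where
  "del_local \<omega> z us = (\<Sum>i\<in>UNIV. wedge (dz i) (lform_wirt i \<omega> z) us)"

definition delbar_local :: "'n::finite lform \<Rightarrow> 'n lform" where
  "delbar_local \<omega> z us = (\<Sum>i\<in>UNIV. wedge (dz_bar i) (lform_wirt_bar i \<omega> z) us)"

definition ext_deriv_local :: "'n::finite lform \<Rightarrow> 'n lform" where
  "ext_deriv_local \<omega> z us =
     (\<Sum>k<length us. (- 1) ^ k * D (\<lambda>y. \<omega> y (take k us @ drop (Suc k) us)) z (us ! k))"

definition fun_lform :: "(complex^'n \<Rightarrow> complex) \<Rightarrow> 'n lform" where
  "fun_lform f z us = (if us = [] then f z else 0)"


section \<open>Global forms and the de Rham algebra\<close>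

text \<open>A differential form is a family of local forms, one for each chart, compatible under pullback
  along the transition maps, and \<open>0\<close> where it carries no information, so that equality of forms is
  equality of functions.\<close>

type_synonym ('a, 'n) form = "('a, 'n) chart \<Rightarrow> 'n lform"

definition is_form :: "('a, 'n::finite) chart set \<Rightarrow> ('a, 'n) form \<Rightarrow> bool" where
  "is_form \<A> \<omega> \<longleftrightarrow>
     (\<forall>c\<in>\<A>. \<forall>z\<in>chart_image c. alternating (\<omega> c z)) \<and>
     (\<forall>c\<in>\<A>. \<forall>us. smooth_on (chart_image c) (\<lambda>z. \<omega> c z us)) \<and>
     (\<forall>c\<in>\<A>. \<forall>c'\<in>\<A>. \<forall>z\<in>overlap c c'. \<forall>us.
        \<omega> c z us = \<omega> c' (transition c c' z) (map (D (transition c c') z) us)) \<and>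
     (\<forall>c z us. c \<notin> \<A> \<or> z \<notin> chart_image c \<longrightarrow> \<omega> c z us = 0)"

definition on_charts ::
    "('a, 'n::finite) chart set \<Rightarrow> (('a, 'n) chart \<Rightarrow> 'n lform) \<Rightarrow> ('a, 'n) form" where
  "on_charts \<A> T c z us = (if c \<in> \<A> \<and> z \<in> chart_image c then T c z us else 0)"

definition ext_deriv :: "('a, 'n::finite) chart set \<Rightarrow> ('a, 'n) form \<Rightarrow> ('a, 'n) form" where
  "ext_deriv \<A> \<omega> = on_charts \<A> (\<lambda>c. ext_deriv_local (\<omega> c))"

definition del :: "('a, 'n::finite) chart set \<Rightarrow> ('a, 'n) form \<Rightarrow> ('a, 'n) form" where
  "del \<A> \<omega> = on_charts \<A> (\<lambda>c. del_local (\<omega> c))"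

definition delbar :: "('a, 'n::finite) chart set \<Rightarrow> ('a, 'n) form \<Rightarrow> ('a, 'n) form" where
  "delbar \<A> \<omega> = on_charts \<A> (\<lambda>c. delbar_local (\<omega> c))"

text \<open>The elements of the carrier are all forms, of mixed degree; by alternation only the degrees up
  to the real dimension occur, so this is the direct sum of the homogeneous parts.\<close>

definition de_rham :: "('a, 'n::finite) chart set \<Rightarrow> ('a, 'n) form dga" where
  "de_rham \<A> =
     \<lparr>carrier = {\<omega>. is_form \<A> \<omega>},
      monoid.mult = (\<lambda>\<omega> \<eta>. on_charts \<A> (\<lambda>c z. wedge (\<omega> c z) (\<eta> c z))),
      monoid.one = on_charts \<A> (\<lambda>c. fun_lform (\<lambda>_. 1)),
      ring.zero = (\<lambda>c z us. 0),
      ring.add = (\<lambda>\<omega> \<eta> c z us. \<omega> c z us + \<eta> c z us),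
      module.smult = (\<lambda>r \<omega> c z us. r * \<omega> c z us),
      grade = (\<lambda>k. {\<omega>. is_form \<A> \<omega> \<and> (\<forall>c z us. \<omega> c z us \<noteq> 0 \<longrightarrow> length us = k)}),
      diff = ext_deriv \<A>\<rparr>"


section \<open>Beltrami differentials\<close>

text \<open>An element \<open>\<phi>\<close> of \<open>A\<^sup>0\<^sup>,\<^sup>1(X, T\<^sup>1\<^sup>,\<^sup>0)\<close>, given by its coefficient matrices in the charts.\<close>

type_synonym ('a, 'n) beltrami = "('a, 'n) chart \<Rightarrow> complex^'n \<Rightarrow> complex^'n^'n"

definition is_beltrami :: "('a, 'n::finite) chart set \<Rightarrow> ('a, 'n) beltrami \<Rightarrow> bool" where
  "is_beltrami \<A> \<phi> \<longleftrightarrow>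
     (\<forall>c\<in>\<A>. smooth_on (chart_image c) (\<phi> c)) \<and>
     (\<forall>c\<in>\<A>. \<forall>c'\<in>\<A>. \<forall>z\<in>overlap c c'. \<forall>v.
        D (transition c c') z (bel (\<phi> c z) v)
          = bel (\<phi> c' (transition c c' z)) (D (transition c c') z v))"

text \<open>The coefficient of \<open>\<partial>/\<partial>z\<^sup>j\<close> in \<open>[\<phi>, \<psi>]\<close>, for \<open>\<phi>\<close>, \<open>\<psi>\<close> of degree \<open>1\<close>:
  \<open>[\<phi>, \<psi>] = \<Sum>i j. (\<phi>\<^sup>i \<and> \<partial>\<^sub>i \<psi>\<^sup>j + \<psi>\<^sup>i \<and> \<partial>\<^sub>i \<phi>\<^sup>j) \<otimes> \<partial>/\<partial>z\<^sup>j\<close>.\<close>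

definition bracket_local ::
    "(complex^'n::finite \<Rightarrow> complex^'n^'n) \<Rightarrow> (complex^'n \<Rightarrow> complex^'n^'n) \<Rightarrow> 'n \<Rightarrow> 'n lform" where
  "bracket_local \<phi> \<psi> j z us =
     (\<Sum>i\<in>UNIV. wedge (row_form i (\<phi> z)) (lform_wirt i (\<lambda>y. row_form j (\<psi> y)) z) us
             + wedge (row_form i (\<psi> z)) (lform_wirt i (\<lambda>y. row_form j (\<phi> y)) z) us)"

definition integrable_beltrami :: "('a, 'n::finite) chart set \<Rightarrow> ('a, 'n) beltrami \<Rightarrow> bool" where
  "integrable_beltrami \<A> \<phi> \<longleftrightarrow>
     (\<forall>c\<in>\<A>. \<forall>z\<in>chart_image c. \<forall>j us.
        delbar_local (\<lambda>y. row_form j (\<phi> c y)) z us = 1 / 2 * bracket_local (\<phi> c) (\<phi> c) j z us)"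

text \<open>A hermitian metric is given by its coefficient matrices in the charts.\<close>

definition herm :: "complex^'n::finite^'n \<Rightarrow> complex^'n \<Rightarrow> complex" where
  "herm H v = (\<Sum>i\<in>UNIV. \<Sum>j\<in>UNIV. H $ i $ j * v $ i * cnj (v $ j))"

definition hermitian_metric ::
    "('a, 'n::finite) chart set \<Rightarrow> (('a, 'n) chart \<Rightarrow> complex^'n \<Rightarrow> complex^'n^'n) \<Rightarrow> bool" where
  "hermitian_metric \<A> h \<longleftrightarrow>
     (\<forall>c\<in>\<A>. smooth_on (chart_image c) (h c)) \<and>
     (\<forall>c\<in>\<A>. \<forall>z\<in>chart_image c.
        (\<forall>i j. h c z $ i $ j = cnj (h c z $ j $ i)) \<and> (\<forall>v. v \<noteq> 0 \<longrightarrow> Re (herm (h c z) v) > 0)) \<and>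
     (\<forall>c\<in>\<A>. \<forall>c'\<in>\<A>. \<forall>z\<in>overlap c c'. \<forall>v.
        herm (h c z) v = herm (h c' (transition c c' z)) (D (transition c c') z v))"

text \<open>Smallness: pointwise operator norm of \<open>\<phi> : T\<^sup>0\<^sup>,\<^sup>1 \<rightarrow> T\<^sup>1\<^sup>,\<^sup>0\<close> less than \<open>1\<close> for some
  hermitian metric, the usual threshold below which \<open>\<phi>\<close> defines an almost complex structure.
  Every \<open>\<phi>\<close> sufficiently close to \<open>0\<close> on a compact manifold satisfies it, so that nothing is lost by
  not asking for a smaller bound.\<close>

definition small_beltrami :: "('a, 'n::finite) chart set \<Rightarrow> ('a, 'n) beltrami \<Rightarrow> bool" where
  "small_beltrami \<A> \<phi> \<longleftrightarrow>
     (\<exists>h. hermitian_metric \<A> h \<and>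
       (\<forall>c\<in>\<A>. \<forall>z\<in>chart_image c. \<forall>v. v \<noteq> 0 \<longrightarrow>
          Re (herm (h c z) (bel (\<phi> c z) v)) < Re (herm (h c z) v)))"

text \<open>\<open>\<phi>\<close>, a Beltrami differential on the complex manifold with atlas \<open>\<A>\<close>, represents the complex
  structure with atlas \<open>\<B>\<close>.\<close>

definition represents_structure ::
    "'a topology \<Rightarrow> ('a, 'n::finite) chart set \<Rightarrow> ('a, 'n) beltrami \<Rightarrow> ('a, 'n) chart set \<Rightarrow> bool" where
  "represents_structure X \<A> \<phi> \<B> \<longleftrightarrow>
     integrable_beltrami \<A> \<phi> \<and> small_beltrami \<A> \<phi> \<and>
     (\<forall>W f. openin X W \<and> smooth_fun \<A> W f \<longrightarrow>
       (holo_fun \<B> W f \<longleftrightarrow>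
         (\<forall>c\<in>\<A>. \<forall>z\<in>snd c ` (W \<inter> fst c). \<forall>us.
            delbar_local (fun_lform (f \<circ> chart_inv c)) z us
              - contract_matrix (\<phi> c z) (del_local (fun_lform (f \<circ> chart_inv c)) z) us = 0)))"

definition contract_beltrami ::
    "('a, 'n::finite) chart set \<Rightarrow> ('a, 'n) beltrami \<Rightarrow> ('a, 'n) form \<Rightarrow> ('a, 'n) form" where
  "contract_beltrami \<A> \<phi> \<omega> = on_charts \<A> (\<lambda>c z. contract_matrix (\<phi> c z) (\<omega> c z))"

definition lie_beltrami ::
    "('a, 'n::finite) chart set \<Rightarrow> ('a, 'n) beltrami \<Rightarrow> ('a, 'n) form \<Rightarrow> ('a, 'n) form" where
  "lie_beltrami \<A> \<phi> \<omega> = (\<lambda>c z us.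
     contract_beltrami \<A> \<phi> (del \<A> \<omega>) c z us - del \<A> (contract_beltrami \<A> \<phi> \<omega>) c z us)"

definition delbar_beltrami ::
    "('a, 'n::finite) chart set \<Rightarrow> ('a, 'n) beltrami \<Rightarrow> ('a, 'n) form \<Rightarrow> ('a, 'n) form" where
  "delbar_beltrami \<A> \<phi> \<omega> = (\<lambda>c z us. delbar \<A> \<omega> c z us - lie_beltrami \<A> \<phi> \<omega> c z us)"

definition d_beltrami ::
    "('a, 'n::finite) chart set \<Rightarrow> ('a, 'n) beltrami \<Rightarrow> ('a, 'n) form \<Rightarrow> ('a, 'n) form" where
  "d_beltrami \<A> \<phi> \<omega> = (\<lambda>c z us. del \<A> \<omega> c z us + delbar_beltrami \<A> \<phi> \<omega> c z us)"

definition del_delbar_lemma :: "('a, 'n::finite) chart set \<Rightarrow> ('a, 'n) beltrami \<Rightarrow> bool" where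
  "del_delbar_lemma \<A> \<phi> \<longleftrightarrow>
     {\<omega>. is_form \<A> \<omega> \<and> del \<A> \<omega> = (\<lambda>c z us. 0)} \<inter>
     {\<omega>. is_form \<A> \<omega> \<and> delbar_beltrami \<A> \<phi> \<omega> = (\<lambda>c z us. 0)} \<inter>
     d_beltrami \<A> \<phi> ` {\<omega>. is_form \<A> \<omega>}
       = (\<lambda>\<omega>. del \<A> (delbar_beltrami \<A> \<phi> \<omega>)) ` {\<omega>. is_form \<A> \<omega>}"

end

theory Submission
  imports Defs
begin

text \<open>The hypothesis controls only the image of d_\<phi>, while the argument also needs its
  analogue for \<partial>-exact and for \<partial>bar_\<phi>-exact forms: the former moves a cocycle
  into ker P and shows that the correction P w is unique up to coboundaries, the latter produces w.
  Both come from types: \<partial> and \<partial>bar_\<phi> have types (1,0) and (0,1), and the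
  hypothesis may be applied to the rotated form as well as to the form itself. With Q = d - P, the
  relations P P = 0, d d = 0 and P d = - d P give Q Q = 0 and P d = P Q, so every exactness
  statement can be phrased through P d. The exponential is a substitution in the arguments, not a
  power series. Its multiplicativity, inverse and derivative are inductions on the argument list,
  resting on one fact: \<phi> takes values in (1,0)-vectors and kills them, so contraction with
  \<phi> v commutes with the contraction operator and with its exponential.\<close>

text \<open>The exponential \<open>e\<^sup>i\<^sup>\<phi>\<close> of the contraction with \<open>\<phi>\<close> is an automorphism of the algebra of forms,
  and integrability of \<open>\<phi>\<close> gives \<open>d e\<^sup>i\<^sup>\<phi> = e\<^sup>i\<^sup>\<phi> d\<^sub>\<phi>\<close>.  Hence \<open>P = e\<^sup>i\<^sup>\<phi> \<partial> e\<^sup>-\<^sup>i\<^sup>\<phi>\<close> is a derivation of square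
  zero which anticommutes with \<open>d\<close>, and the \<open>\<partial>\<partial>bar\<^sub>\<phi>\<close>-lemma becomes a statement on the pair
  \<open>P\<close>, \<open>d - P\<close>.  As in the argument of Deligne, Griffiths, Morgan and Sullivan, both maps of the
  zigzag \<open>A \<leftarrow> (ker P, d) \<rightarrow> (H(A), 0)\<close> are then quasi-isomorphisms, where the second one
  sends \<open>x\<close> to the class of \<open>x + P w\<close> for any \<open>w\<close> which makes this form closed.\<close>

section \<open>Differential graded algebras\<close>

lemma complex_ring_simps [simp]:
  "carrier complex_ring = UNIV" "x \<otimes>\<^bsub>complex_ring\<^esub> y = x * y" "\<one>\<^bsub>complex_ring\<^esub> = 1"
  "\<zero>\<^bsub>complex_ring\<^esub> = 0" "x \<oplus>\<^bsub>complex_ring\<^esub> y = x + y"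
  by (simp_all add: complex_ring_def)

lemma cring_complex_ring: "cring complex_ring"
  by (intro cringI abelian_groupI comm_monoidI)
    (auto simp: algebra_simps, metis add.right_inverse add.commute)

lemma uminus_complex_ring [simp]: "\<ominus>\<^bsub>complex_ring\<^esub> x = - x"
proof -
  interpret cring complex_ring by (rule cring_complex_ring)
  show ?thesis by (rule minus_equality) auto
qed

section \<open>Homogeneous components\<close>

context dg_algebra
begin

lemma grade_carrier: "x \<in> grade A k \<Longrightarrow> x \<in> carrier A"
  using submoduleE(1)[OF grade_submodule] by blast

lemma grade_zero: "\<zero> \<in> grade A k"
  using submodule.axioms(1)[OF grade_submodule[of k]] subgroup.one_closed by fastforce

lemma grade_add: "x \<in> grade A k \<Longrightarrow> y \<in> grade A k \<Longrightarrow> x \<oplus> y \<in> grade A k"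
  by (rule submoduleE(5)[OF grade_submodule])

lemma grade_smult: "x \<in> grade A k \<Longrightarrow> c \<odot> x \<in> grade A k"
  by (rule submoduleE(4)[OF grade_submodule]) simp_all


lemma minus_smult: "x \<in> carrier A \<Longrightarrow> \<ominus> x = (- 1) \<odot> x"
  using smult_l_minus[of 1 x] smult_one[of x] by simp

lemma smult_zero: "x \<in> carrier A \<Longrightarrow> 0 \<odot> x = \<zero>"
  using smult_l_null[of x] by simp

lemma smult_carrier: "x \<in> carrier A \<Longrightarrow> c \<odot> x \<in> carrier A"
  by simp

lemmas smult_distrib_left = smult_l_distr[simplified]
lemmas smult_distrib_right = smult_r_distr[simplified]
lemmas smult_assoc = smult_assoc1[simplified]
lemmas smult_1 = smult_one[simplified]

text \<open>\<open>grade_decomposition\<close> characterises the family of all components at once,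
  so the description picks the family and only then evaluates it at j.\<close>

definition comp :: "nat \<Rightarrow> 'b \<Rightarrow> 'b" where
  "comp j x = (THE f. (\<forall>k. f k \<in> grade A k) \<and> finite {k. f k \<noteq> \<zero>} \<and> x = (\<Oplus>k\<in>{k. f k \<noteq> \<zero>}. f k)) j"

lemma
  assumes "x \<in> carrier A"
  shows comp_grade: "comp k x \<in> grade A k"
    and finite_comp: "finite {k. comp k x \<noteq> \<zero>}"
    and comp_sum: "x = (\<Oplus>k\<in>{k. comp k x \<noteq> \<zero>}. comp k x)"
proof -
  define f where "f k = comp k x" for k
  have "(\<forall>k. f k \<in> grade A k) \<and> finite {k. f k \<noteq> \<zero>} \<and> x = (\<Oplus>k\<in>{k. f k \<noteq> \<zero>}. f k)"
    unfolding f_def comp_def by (rule theI'[OF grade_decomposition[OF assms]])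
  then show "comp k x \<in> grade A k" "finite {k. comp k x \<noteq> \<zero>}"
    "x = (\<Oplus>k\<in>{k. comp k x \<noteq> \<zero>}. comp k x)"
    unfolding f_def by auto
qed

lemma comp_closed: "x \<in> carrier A \<Longrightarrow> comp k x \<in> carrier A"
  using comp_grade grade_carrier by blast

text \<open>The axiom sums over exactly the support. Allowing any finite S that contains it serves
  \<open>comp_add\<close>, where the supports of x and y differ from that of their sum.\<close>

lemma comp_unique:
  assumes "x \<in> carrier A" "\<And>k. f k \<in> grade A k" "finite S" "\<And>k. k \<notin> S \<Longrightarrow> f k = \<zero>"
    and "x = (\<Oplus>k\<in>S. f k)"
  shows "comp k x = f k"
proof -
  have fin: "finite {k. f k \<noteq> \<zero>}"
    using assms(3,4) by (metis (mono_tags, lifting) finite_subset mem_Collect_eq subsetI)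
  have f: "f \<in> S \<rightarrow> carrier A"
    using assms(2) grade_carrier by blast
  have "(\<Oplus>k\<in>{k. f k \<noteq> \<zero>}. f k) = (\<Oplus>k\<in>S. f k)"
    by (rule M.add.finprod_mono_neutral_cong_left[OF assms(3)]) (use assms(4) f in auto)
  then have "(\<forall>k. f k \<in> grade A k) \<and> finite {k. f k \<noteq> \<zero>} \<and> x = (\<Oplus>k\<in>{k. f k \<noteq> \<zero>}. f k)"
    using fin assms(2,5) by simp
  then show ?thesis
    unfolding comp_def by (subst the1_equality[OF grade_decomposition[OF assms(1)]]) auto
qed

lemma comp_sum':
  assumes "x \<in> carrier A" "finite S" "\<And>k. k \<notin> S \<Longrightarrow> comp k x = \<zero>"
  shows "x = (\<Oplus>k\<in>S. comp k x)"
proof -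
  have "(\<Oplus>k\<in>{k. comp k x \<noteq> \<zero>}. comp k x) = (\<Oplus>k\<in>S. comp k x)"
    by (rule M.add.finprod_mono_neutral_cong_left[OF assms(2)])
      (use assms(1,3) comp_closed in auto)
  then show ?thesis using comp_sum[OF assms(1)] by simp
qed

text \<open>Q is demanded only for the components of this x. \<open>kernel_mult_derivation\<close>
  depends on that: its Q holds for the components of an element of the kernel, not for all
  homogeneous elements.\<close>

lemma comp_induct:
  assumes x: "x \<in> carrier A" and comp: "\<And>k. Q (comp k x)" and zero: "Q \<zero>"
    and add: "\<And>y z. y \<in> carrier A \<Longrightarrow> z \<in> carrier A \<Longrightarrow> Q y \<Longrightarrow> Q z \<Longrightarrow> Q (y \<oplus> z)"
  shows "Q x"
proof -
  have "Q (\<Oplus>k\<in>S. comp k x)" if "finite S" for S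
    using that
  proof (induction S rule: finite_induct)
    case empty
    then show ?case using zero by simp
  next
    case (insert k S)
    have c: "(\<lambda>k. comp k x) \<in> S \<rightarrow> carrier A" "comp k x \<in> carrier A"
      using comp_closed[OF x] by auto
    then show ?case
      using insert comp add by (simp add: finsum_closed)
  qed
  then show ?thesis
    using finite_comp[OF x] comp_sum[OF x] by metis
qed

lemma graded_induct [consumes 1, case_names grade add]:
  assumes x: "x \<in> carrier A" and grade: "\<And>k y. y \<in> grade A k \<Longrightarrow> Q y"
    and add: "\<And>y z. y \<in> carrier A \<Longrightarrow> z \<in> carrier A \<Longrightarrow> Q y \<Longrightarrow> Q z \<Longrightarrow> Q (y \<oplus> z)"
  shows "Q x"
  by (rule comp_induct[OF x]) (use grade comp_grade[OF x] grade_zero add in blast)+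

lemma diff_closed: "x \<in> carrier A \<Longrightarrow> diff A x \<in> carrier A"
  by (induction x rule: graded_induct) (auto simp: diff_add intro: grade_carrier diff_grade)

lemma comp_add:
  assumes "x \<in> carrier A" "y \<in> carrier A"
  shows "comp k (x \<oplus> y) = comp k x \<oplus> comp k y"
proof (rule comp_unique[where S = "{k. comp k x \<noteq> \<zero>} \<union> {k. comp k y \<noteq> \<zero>}"])
  let ?S = "{k. comp k x \<noteq> \<zero>} \<union> {k. comp k y \<noteq> \<zero>}"
  show fin: "finite ?S" using finite_comp assms by blast
  have "x = (\<Oplus>k\<in>?S. comp k x)" "y = (\<Oplus>k\<in>?S. comp k y)"
    by (rule comp_sum'; use assms fin in auto)+
  then show "x \<oplus> y = (\<Oplus>k\<in>?S. comp k x \<oplus> comp k y)"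
    using assms comp_closed by (simp add: M.finsum_addf Pi_def)
qed (use assms comp_grade grade_add in auto)

lemma comp_of_grade:
  assumes "x \<in> grade A k"
  shows "comp l x = (if l = k then x else \<zero>)"
proof (rule comp_unique[where S = "{k}"])
  show "x = (\<Oplus>l\<in>{k}. if l = k then x else \<zero>)"
    using grade_carrier[OF assms] by simp
qed (use assms grade_carrier grade_zero in auto)

lemma comp_zero: "comp k \<zero> = \<zero>"
  using comp_of_grade[OF grade_zero, of k 0] by simp

text \<open>Both equations are clear on homogeneous elements and additive in x, so graded induction
  applies. The shift of the index leaves nothing in degree 0 of the image.\<close>

lemma comp_map:
  assumes x: "x \<in> carrier A"
    and add: "\<And>y z. y \<in> carrier A \<Longrightarrow> z \<in> carrier A \<Longrightarrow> F (y \<oplus> z) = F y \<oplus> F z"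
    and grade: "\<And>k y. y \<in> grade A k \<Longrightarrow> F y \<in> grade A (Suc k)"
  shows "comp 0 (F x) = \<zero>" "comp (Suc k) (F x) = F (comp k x)"
proof -
  have "F \<zero> \<oplus> F \<zero> = F \<zero>" "F \<zero> \<in> carrier A"
    using add[of \<zero> \<zero>] grade[OF grade_zero] grade_carrier by auto
  then have F0: "F \<zero> = \<zero>"
    by (metis M.add.r_cancel_one')
  have "F x \<in> carrier A \<and> comp 0 (F x) = \<zero> \<and> (\<forall>k. comp (Suc k) (F x) = F (comp k x))"
    using x
  proof (induction x rule: graded_induct)
    case (grade k y)
    then show ?case
      using assms(3)[OF grade] comp_of_grade[OF grade] comp_of_grade[OF assms(3)[OF grade]] F0
        grade_carrier by auto
  next
    case (add y z)
    then show ?case by (simp add: assms(2) comp_add comp_closed)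
  qed
  then show "comp 0 (F x) = \<zero>" "comp (Suc k) (F x) = F (comp k x)"
    by auto
qed

end

text \<open>Unique decomposition is traded for additive projections p k: applying p l to a finite
  sum of homogeneous terms returns its term of degree l, which proves uniqueness, and the p k x
  themselves give existence.\<close>

lemma dg_algebraI:
  fixes A :: "'b dga" (structure)
  assumes ag: "abelian_group A"
    and mult_closed: "\<And>x y. x \<in> carrier A \<Longrightarrow> y \<in> carrier A \<Longrightarrow> x \<otimes> y \<in> carrier A"
    and assoc: "\<And>x y z. x \<in> carrier A \<Longrightarrow> y \<in> carrier A \<Longrightarrow> z \<in> carrier A \<Longrightarrow> x \<otimes> y \<otimes> z = x \<otimes> (y \<otimes> z)"
    and l_one: "\<And>x. x \<in> carrier A \<Longrightarrow> \<one> \<otimes> x = x"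
    and r_one: "\<And>x. x \<in> carrier A \<Longrightarrow> x \<otimes> \<one> = x"
    and l_distr: "\<And>x y z. x \<in> carrier A \<Longrightarrow> y \<in> carrier A \<Longrightarrow> z \<in> carrier A \<Longrightarrow>
      (x \<oplus> y) \<otimes> z = x \<otimes> z \<oplus> y \<otimes> z"
    and r_distr: "\<And>x y z. x \<in> carrier A \<Longrightarrow> y \<in> carrier A \<Longrightarrow> z \<in> carrier A \<Longrightarrow>
      z \<otimes> (x \<oplus> y) = z \<otimes> x \<oplus> z \<otimes> y"
    and smult_closed: "\<And>c x. x \<in> carrier A \<Longrightarrow> c \<odot> x \<in> carrier A"
    and smult_l_distr: "\<And>a b x. x \<in> carrier A \<Longrightarrow> (a + b) \<odot> x = a \<odot> x \<oplus> b \<odot> x"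
    and smult_r_distr: "\<And>a x y. x \<in> carrier A \<Longrightarrow> y \<in> carrier A \<Longrightarrow> a \<odot> (x \<oplus> y) = a \<odot> x \<oplus> a \<odot> y"
    and smult_assoc: "\<And>a b x. x \<in> carrier A \<Longrightarrow> (a * b) \<odot> x = a \<odot> (b \<odot> x)"
    and smult_one: "\<And>x. x \<in> carrier A \<Longrightarrow> 1 \<odot> x = x"
    and smult_mult_left: "\<And>c x y. x \<in> carrier A \<Longrightarrow> y \<in> carrier A \<Longrightarrow> (c \<odot> x) \<otimes> y = c \<odot> (x \<otimes> y)"
    and smult_mult_right: "\<And>c x y. x \<in> carrier A \<Longrightarrow> y \<in> carrier A \<Longrightarrow> x \<otimes> (c \<odot> y) = c \<odot> (x \<otimes> y)"
    and grade_carrier: "\<And>k x. x \<in> grade A k \<Longrightarrow> x \<in> carrier A"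
    and grade_add: "\<And>k x y. x \<in> grade A k \<Longrightarrow> y \<in> grade A k \<Longrightarrow> x \<oplus> y \<in> grade A k"
    and grade_smult: "\<And>k c x. x \<in> grade A k \<Longrightarrow> c \<odot> x \<in> grade A k"
    and p_grade: "\<And>k x. x \<in> carrier A \<Longrightarrow> p k x \<in> grade A k"
    and p_add: "\<And>k x y. x \<in> carrier A \<Longrightarrow> y \<in> carrier A \<Longrightarrow> p k (x \<oplus> y) = p k x \<oplus> p k y"
    and p_same: "\<And>k x. x \<in> grade A k \<Longrightarrow> p k x = x"
    and p_other: "\<And>k l x. x \<in> grade A k \<Longrightarrow> k \<noteq> l \<Longrightarrow> p l x = \<zero>"
    and p_sum: "\<And>x. x \<in> carrier A \<Longrightarrow> \<exists>S. finite S \<and> (\<forall>k. k \<notin> S \<longrightarrow> p k x = \<zero>) \<and> x = (\<Oplus>k\<in>S. p k x)"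
    and grade_one: "\<one> \<in> grade A 0"
    and grade_mult: "\<And>k l x y. x \<in> grade A k \<Longrightarrow> y \<in> grade A l \<Longrightarrow> x \<otimes> y \<in> grade A (k + l)"
    and diff_add: "\<And>x y. x \<in> carrier A \<Longrightarrow> y \<in> carrier A \<Longrightarrow> diff A (x \<oplus> y) = diff A x \<oplus> diff A y"
    and diff_smult: "\<And>c x. x \<in> carrier A \<Longrightarrow> diff A (c \<odot> x) = c \<odot> diff A x"
    and diff_grade: "\<And>k x. x \<in> grade A k \<Longrightarrow> diff A x \<in> grade A (Suc k)"
    and diff_diff: "\<And>x. x \<in> carrier A \<Longrightarrow> diff A (diff A x) = \<zero>"
    and diff_mult: "\<And>k x y. x \<in> grade A k \<Longrightarrow> y \<in> carrier A \<Longrightarrow>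
        diff A (x \<otimes> y) = (diff A x \<otimes> y) \<oplus> ((- 1) ^ k \<odot> (x \<otimes> diff A y))"
  shows "dg_algebra A"
proof -
  interpret abelian_group A by (rule ag)
  have mod: "module complex_ring A"
    by (intro moduleI cring_complex_ring ag) (simp_all add: assms)
  interpret M: module complex_ring A by (rule mod)
  have ring: "ring A"
    by (intro ringI monoidI ag) (auto simp: assms grade_carrier[OF grade_one])
  have neg: "\<ominus> x \<in> grade A k" if "x \<in> grade A k" for x k
    using M.smult_l_minus[of 1 x] grade_smult[OF that, of "-1"] that
    by (simp add: grade_carrier smult_one)
  \<comment> \<open>Sums and scalar multiples produce zero only in an inhabited degree;
    \<open>p_grade\<close> at zero supplies an element.\<close>
  have zero: "\<zero> \<in> grade A k" for k
  proof -
    have "\<exists>x. x \<in> grade A k" using p_grade zero_closed by blast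
    then show ?thesis using grade_add neg grade_carrier r_neg by metis
  qed
  have ex1: "\<exists>!f. (\<forall>k. f k \<in> grade A k) \<and> finite {k. f k \<noteq> \<zero>} \<and> x = (\<Oplus>k\<in>{k. f k \<noteq> \<zero>}. f k)"
    if x: "x \<in> carrier A" for x
  proof (rule ex_ex1I)
    obtain S where S: "finite S" "\<And>k. k \<notin> S \<Longrightarrow> p k x = \<zero>" "x = (\<Oplus>k\<in>S. p k x)"
      using p_sum[OF x] by blast
    have "{k. p k x \<noteq> \<zero>} \<subseteq> S" using S(2) by blast
    moreover have "(\<Oplus>k\<in>{k. p k x \<noteq> \<zero>}. p k x) = (\<Oplus>k\<in>S. p k x)"
      by (rule add.finprod_mono_neutral_cong_left[OF S(1)])
        (use S(2) p_grade[OF x] grade_carrier in auto)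
    ultimately show "\<exists>f. (\<forall>k. f k \<in> grade A k) \<and> finite {k. f k \<noteq> \<zero>} \<and> x = (\<Oplus>k\<in>{k. f k \<noteq> \<zero>}. f k)"
      using S p_grade[OF x] finite_subset by (intro exI[of _ "\<lambda>k. p k x"]) auto
  next
    fix f g
    have *: "f l = p l x" if f: "(\<forall>k. f k \<in> grade A k) \<and> finite {k. f k \<noteq> \<zero>} \<and> x = (\<Oplus>k\<in>{k. f k \<noteq> \<zero>}. f k)" for f l
    proof -
      have fc: "f k \<in> carrier A" for k using f grade_carrier by blast
      have "p l (\<Oplus>k\<in>T. f k) = (if l \<in> T then f l else \<zero>)" if "finite T" for T
        using that
      proof (induction T rule: finite_induct)
        case empty
        then show ?case
          using p_other[OF zero[of "Suc l"]] by simp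
      next
        case (insert k T)
        have "f \<in> T \<rightarrow> carrier A" using fc by blast
        then have "p l (\<Oplus>k\<in>insert k T. f k) = p l (f k) \<oplus> (if l \<in> T then f l else \<zero>)"
          using insert fc by (simp add: p_add finsum_closed)
        moreover have "p l (f k) = (if k = l then f k else \<zero>)"
          using f p_same[of "f k" k] p_other[of "f k" k l] by auto
        ultimately show ?case
          using insert(2) fc by auto
      qed
      then show ?thesis using f by (metis (mono_tags, lifting) mem_Collect_eq)
    qed
    assume "(\<forall>k. f k \<in> grade A k) \<and> finite {k. f k \<noteq> \<zero>} \<and> x = (\<Oplus>k\<in>{k. f k \<noteq> \<zero>}. f k)"
      "(\<forall>k. g k \<in> grade A k) \<and> finite {k. g k \<noteq> \<zero>} \<and> x = (\<Oplus>k\<in>{k. g k \<noteq> \<zero>}. g k)"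
    from *[OF this(1)] *[OF this(2)] show "f = g" by (intro ext) metis
  qed
  show ?thesis
  proof (intro dg_algebra.intro mod ring dg_algebra_axioms.intro)
    show "submodule (grade A k) complex_ring A" for k
      by (rule M.submoduleI) (auto simp: zero neg grade_add grade_smult intro: grade_carrier)
  qed (use assms ex1 in auto)
qed

section \<open>Subalgebras and homomorphic images\<close>

definition dg_restrict :: "'b dga \<Rightarrow> 'b set \<Rightarrow> 'b dga" where
  "dg_restrict A S = A\<lparr>carrier := S, grade := (\<lambda>k. grade A k \<inter> S)\<rparr>"

lemma dg_restrict_simps [simp]:
  "carrier (dg_restrict A S) = S" "x \<otimes>\<^bsub>dg_restrict A S\<^esub> y = x \<otimes>\<^bsub>A\<^esub> y"
  "\<one>\<^bsub>dg_restrict A S\<^esub> = \<one>\<^bsub>A\<^esub>" "\<zero>\<^bsub>dg_restrict A S\<^esub> = \<zero>\<^bsub>A\<^esub>"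
  "x \<oplus>\<^bsub>dg_restrict A S\<^esub> y = x \<oplus>\<^bsub>A\<^esub> y" "c \<odot>\<^bsub>dg_restrict A S\<^esub> x = c \<odot>\<^bsub>A\<^esub> x"
  "grade (dg_restrict A S) k = grade A k \<inter> S" "diff (dg_restrict A S) = diff A"
  by (simp_all add: dg_restrict_def)

text \<open>Closure under components makes S a graded subspace, so the projections of A restrict to
  it.\<close>

lemma (in dg_algebra) dg_algebra_restrict:
  assumes S: "S \<subseteq> carrier A" "\<one> \<in> S"
    and add: "\<And>x y. x \<in> S \<Longrightarrow> y \<in> S \<Longrightarrow> x \<oplus> y \<in> S"
    and smult: "\<And>c x. x \<in> S \<Longrightarrow> c \<odot> x \<in> S"
    and mult: "\<And>x y. x \<in> S \<Longrightarrow> y \<in> S \<Longrightarrow> x \<otimes> y \<in> S"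
    and diff: "\<And>x. x \<in> S \<Longrightarrow> diff A x \<in> S"
    and comp: "\<And>k x. x \<in> S \<Longrightarrow> comp k x \<in> S"
  shows "dg_algebra (dg_restrict A S)"
proof -
  have c: "x \<in> carrier A" if "x \<in> S" for x using S(1) that by blast
  have zero: "\<zero> \<in> S" using smult[OF S(2), of 0] smult_zero[of \<one>] by simp
  have ag: "abelian_group (dg_restrict A S)"
  proof (rule abelian_groupI)
    show "\<exists>y\<in>carrier (dg_restrict A S). y \<oplus>\<^bsub>dg_restrict A S\<^esub> x = \<zero>\<^bsub>dg_restrict A S\<^esub>"
      if "x \<in> carrier (dg_restrict A S)" for x
      using that minus_smult[of x] M.l_neg[of x] smult[of x "-1"] c by auto
  qed (auto simp: add zero c M.a_ac)
  interpret S: abelian_group "dg_restrict A S" by (rule ag)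
  have sum: "finsum (dg_restrict A S) f T = finsum A f T" if "finite T" "\<And>k. k \<in> T \<Longrightarrow> f k \<in> S" for f and T :: "nat set"
    using that
  proof (induction T rule: finite_induct)
    case (insert k T)
    then have "f \<in> T \<rightarrow> S" "f \<in> T \<rightarrow> carrier A" "f k \<in> S" "f k \<in> carrier A"
      using c by auto
    then show ?case
      using insert by (simp add: S.finsum_insert M.finsum_insert)
  qed (simp add: S.finsum_empty)
  show ?thesis
  proof (rule dg_algebraI[OF ag, where p = comp])
    fix x assume "x \<in> carrier (dg_restrict A S)"
    then have x: "x \<in> S" by simp
    have "finite {k. comp k x \<noteq> \<zero>}" "x = (\<Oplus>k\<in>{k. comp k x \<noteq> \<zero>}. comp k x)"
      using finite_comp comp_sum c x by blast+
    then show "\<exists>S'. finite S' \<and> (\<forall>k. k \<notin> S' \<longrightarrow> comp k x = \<zero>\<^bsub>dg_restrict A S\<^esub>) \<and>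
        x = (\<Oplus>\<^bsub>dg_restrict A S\<^esub>k\<in>S'. comp k x)"
      using comp[OF x] by (intro exI[of _ "{k. comp k x \<noteq> \<zero>}"]) (simp add: sum)
  qed (use assms c in \<open>auto simp: m_assoc l_distr r_distr smult_distrib_left smult_distrib_right
      smult_assoc smult_1 smult_mult_left smult_mult_right grade_add grade_smult
      comp_grade comp_add comp_of_grade grade_one grade_mult diff_add diff_smult diff_grade diff_diff diff_mult\<close>)
qed

text \<open>This is a quotient by a homogeneous ideal, presented by its projection h. Hypothesis
  \<open>ker\<close> says that components descend through h.\<close>

lemma (in dg_algebra) dg_algebra_image:
  fixes B :: "'c dga" and h :: "'b \<Rightarrow> 'c"
  assumes car: "carrier B = h ` carrier A"
    and add: "\<And>x y. x \<in> carrier A \<Longrightarrow> y \<in> carrier A \<Longrightarrow> h (x \<oplus> y) = h x \<oplus>\<^bsub>B\<^esub> h y"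
    and mult: "\<And>x y. x \<in> carrier A \<Longrightarrow> y \<in> carrier A \<Longrightarrow> h (x \<otimes> y) = h x \<otimes>\<^bsub>B\<^esub> h y"
    and smult: "\<And>c x. x \<in> carrier A \<Longrightarrow> h (c \<odot> x) = c \<odot>\<^bsub>B\<^esub> h x"
    and one: "h \<one> = \<one>\<^bsub>B\<^esub>" and zero: "h \<zero> = \<zero>\<^bsub>B\<^esub>"
    and grade: "\<And>k. grade B k = h ` grade A k"
    and diff: "\<And>x. x \<in> carrier A \<Longrightarrow> h (diff A x) = diff B (h x)"
    and ker: "\<And>k x y. x \<in> carrier A \<Longrightarrow> y \<in> carrier A \<Longrightarrow> h x = h y \<Longrightarrow> h (comp k x) = h (comp k y)"
  shows "dg_algebra B"
proof -
  note hs = add[symmetric] mult[symmetric] smult[symmetric] one[symmetric] zero[symmetric] diff[symmetric]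
  have ag: "abelian_group B"
  proof (rule abelian_groupI)
    show "\<exists>y\<in>carrier B. y \<oplus>\<^bsub>B\<^esub> x = \<zero>\<^bsub>B\<^esub>" if "x \<in> carrier B" for x
    proof -
      from that obtain x' where x': "x = h x'" "x' \<in> carrier A" using car by blast
      then show ?thesis using M.l_neg[of x'] by (auto simp: car hs intro!: bexI[of _ "\<ominus> x'"])
    qed
  qed (auto simp: car hs M.a_ac)
  interpret B: abelian_group B by (rule ag)
  have sum: "finsum B (\<lambda>k. h (f k)) T = h (finsum A f T)" if "finite T" "f \<in> T \<rightarrow> carrier A" for f and T :: "nat set"
    using that
  proof (induction T rule: finite_induct)
    case (insert k T)
    then have "f \<in> T \<rightarrow> carrier A" "f k \<in> carrier A" by auto
    then show ?case
      using insert by (subst B.finsum_insert) (auto simp: hs car)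
  qed (simp add: B.finsum_empty zero)
  \<comment> \<open>The projection of B acts on an arbitrary preimage; \<open>ker\<close> makes the
    result independent of the choice.\<close>
  define p where "p k y = h (comp k (SOME x. x \<in> carrier A \<and> h x = y))" for k y
  have p: "p k (h x) = h (comp k x)" if "x \<in> carrier A" for k x
    unfolding p_def
    by (rule ker) (use someI[of "\<lambda>z. z \<in> carrier A \<and> h z = h x", OF conjI[OF that refl]] that in auto)
  show ?thesis
  proof (rule dg_algebraI[OF ag, where p = p])
    fix x assume "x \<in> carrier B"
    then obtain x' where x': "x = h x'" "x' \<in> carrier A" using car by blast
    have fin: "finite {k. comp k x' \<noteq> \<zero>}" "x' = (\<Oplus>k\<in>{k. comp k x' \<noteq> \<zero>}. comp k x')"
      using finite_comp comp_sum x' by blast+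
    show "\<exists>S. finite S \<and> (\<forall>k. k \<notin> S \<longrightarrow> p k x = \<zero>\<^bsub>B\<^esub>) \<and> x = (\<Oplus>\<^bsub>B\<^esub>k\<in>S. p k x)"
    proof (intro exI conjI)
      have "x = h (\<Oplus>k\<in>{k. comp k x' \<noteq> \<zero>}. comp k x')" using fin(2) x'(1) by simp
      also have "\<dots> = (\<Oplus>\<^bsub>B\<^esub>k\<in>{k. comp k x' \<noteq> \<zero>}. p k x)"
        using fin x' comp_closed by (subst sum[symmetric]) (auto simp: p)
      finally show "x = (\<Oplus>\<^bsub>B\<^esub>k\<in>{k. comp k x' \<noteq> \<zero>}. p k x)" .
    qed (use fin x' p zero in auto)
  next
    show "diff B (diff B x) = \<zero>\<^bsub>B\<^esub>" if "x \<in> carrier B" for x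
      using that by (auto simp: car hs diff_diff diff_closed)
  next
    fix k x y assume "x \<in> grade B k" "y \<in> carrier B"
    then show "diff B (x \<otimes>\<^bsub>B\<^esub> y) = diff B x \<otimes>\<^bsub>B\<^esub> y \<oplus>\<^bsub>B\<^esub> (- 1) ^ k \<odot>\<^bsub>B\<^esub> (x \<otimes>\<^bsub>B\<^esub> diff B y)"
      by (auto simp: car grade grade_carrier hs diff_closed diff_mult)
  qed (auto simp: car grade grade_carrier hs p m_assoc l_distr r_distr smult_distrib_left smult_distrib_right
      smult_assoc smult_1 smult_mult_left smult_mult_right intro!: imageI
      comp_grade grade_add grade_smult grade_one grade_mult diff_grade
      simp: comp_add comp_closed comp_of_grade diff_add diff_smult diff_closed)
qed

section \<open>Cocycles, derivations and the cohomology algebra\<close>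

abbreviation cohomology_class :: "'b dga \<Rightarrow> 'b \<Rightarrow> 'b set" where
  "cohomology_class A x \<equiv> coboundaries A +>\<^bsub>cocycle_ring A\<^esub> x"

context dg_algebra
begin

text \<open>Each algebra has its own definite description of components, and the cohomology algebra
  is built from that of the cocycle subalgebra.\<close>

lemma restrict_comp:
  assumes "dg_algebra (dg_restrict A S)" "S \<subseteq> carrier A" "x \<in> S"
  shows "dg_algebra.comp (dg_restrict A S) k x = comp k x"
proof -
  interpret S: dg_algebra "dg_restrict A S" by (rule assms(1))
  have "x \<in> carrier (dg_restrict A S)" using assms(3) by simp
  then show ?thesis
  proof (induction x rule: S.graded_induct)
    case (grade l y)
    then show ?case using S.comp_of_grade[OF grade] comp_of_grade[of y l] by simp
  next
    case (add y z)
    then have "y \<in> S" "z \<in> S" by auto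
    moreover have "y \<in> carrier A" "z \<in> carrier A" using calculation assms(2) by auto
    ultimately show ?case using add S.comp_add[of y z k] comp_add[of y z k] by simp
  qed
qed

lemma smult_minus_one_add: "x \<in> carrier A \<Longrightarrow> (- 1) \<odot> x \<oplus> x = \<zero>"
  using M.l_neg[of x] minus_smult[of x] by simp

lemma diff_zero: "diff A \<zero> = \<zero>"
  using diff_smult[of \<zero> 0] smult_zero[of \<zero>] diff_closed[of \<zero>] by (simp add: smult_zero)

lemma diff_minus: "x \<in> carrier A \<Longrightarrow> diff A (\<ominus> x) = \<ominus> diff A x"
  by (simp add: minus_smult diff_smult diff_closed)

lemma cocycle_carrier: "x \<in> cocycles A \<Longrightarrow> x \<in> carrier A"
  by (simp add: cocycles_def)

lemma coboundary_cocycle: "x \<in> coboundaries A \<Longrightarrow> x \<in> cocycles A"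
  by (auto simp: cocycles_def coboundaries_def diff_closed diff_diff)

text \<open>Graded derivations of degree one, with no condition on the square: the differential and
  the operator P of \<open>formalI\<close> share the lemmas that follow.\<close>

definition derivation :: "('b \<Rightarrow> 'b) \<Rightarrow> bool" where
  "derivation F \<longleftrightarrow>
     (\<forall>x\<in>carrier A. \<forall>y\<in>carrier A. F (x \<oplus> y) = F x \<oplus> F y) \<and>
     (\<forall>c. \<forall>x\<in>carrier A. F (c \<odot> x) = c \<odot> F x) \<and>
     (\<forall>k. \<forall>x\<in>grade A k. F x \<in> grade A (Suc k)) \<and>
     (\<forall>k. \<forall>x\<in>grade A k. \<forall>y\<in>carrier A. F (x \<otimes> y) = (F x \<otimes> y) \<oplus> ((- 1) ^ k \<odot> (x \<otimes> F y)))"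

lemma derivation_diff: "derivation (diff A)"
  by (simp add: derivation_def diff_add diff_smult diff_grade diff_mult)

context
  fixes F :: "'b \<Rightarrow> 'b"
  assumes F: "derivation F"
begin

lemma derivation_add: "x \<in> carrier A \<Longrightarrow> y \<in> carrier A \<Longrightarrow> F (x \<oplus> y) = F x \<oplus> F y"
  and derivation_smult: "x \<in> carrier A \<Longrightarrow> F (c \<odot> x) = c \<odot> F x"
  and derivation_grade: "x \<in> grade A k \<Longrightarrow> F x \<in> grade A (Suc k)"
  and derivation_mult: "x \<in> grade A k \<Longrightarrow> y \<in> carrier A \<Longrightarrow>
    F (x \<otimes> y) = (F x \<otimes> y) \<oplus> ((- 1) ^ k \<odot> (x \<otimes> F y))"
  using F by (simp_all add: derivation_def)

lemma derivation_closed: "x \<in> carrier A \<Longrightarrow> F x \<in> carrier A"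
  by (induction x rule: graded_induct) (auto simp: derivation_add intro: grade_carrier derivation_grade)

lemma derivation_zero: "F \<zero> = \<zero>"
  using derivation_smult[of \<zero> 0] derivation_closed[of \<zero>] by (simp add: smult_zero)

lemma derivation_one: "F \<one> = \<zero>"
proof -
  have "F \<one> \<in> carrier A" by (simp add: derivation_closed)
  moreover have "F \<one> = F \<one> \<oplus> F \<one>"
    using derivation_mult[OF grade_one one_closed] \<open>F \<one> \<in> carrier A\<close> by (simp add: smult_1)
  ultimately show ?thesis by (metis M.add.l_cancel_one')
qed

lemma derivation_comp:
  assumes "x \<in> carrier A"
  shows "comp 0 (F x) = \<zero>" "comp (Suc k) (F x) = F (comp k x)"
  using comp_map[OF assms derivation_add derivation_grade] by auto

lemma comp_derivation_image:
  assumes "x \<in> carrier A"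
  shows "\<exists>y\<in>carrier A. comp k (F x) = F y"
  using derivation_comp[OF assms] derivation_zero comp_closed[OF assms] M.zero_closed
  by (cases k) metis+

lemma derivation_kernel_comp: "x \<in> carrier A \<Longrightarrow> F x = \<zero> \<Longrightarrow> F (comp k x) = \<zero>"
  using derivation_comp(2)[of x k] by (simp add: comp_zero)

text \<open>The signed Leibniz term contains F y = 0, so the formula no longer depends on the degree
  and extends additively to x of mixed degree.\<close>

lemma derivation_mult_kernel:
  assumes "x \<in> carrier A" and y: "y \<in> carrier A" "F y = \<zero>"
  shows "F (x \<otimes> y) = F x \<otimes> y"
  using assms(1)
proof (induction x rule: graded_induct)
  case (grade k x)
  then show ?case
    using y grade_carrier derivation_closed by (simp add: derivation_mult smult_r_null[simplified])
next
  case (add x x')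
  then show ?case using y by (simp add: l_distr derivation_add derivation_closed)
qed

text \<open>For x of degree k the element z is (-1)^k x y. As it depends on k, an inhomogeneous x is
  treated component by component, and each component is again in the kernel.\<close>

lemma kernel_mult_derivation:
  assumes x: "x \<in> carrier A" "F x = \<zero>" and y: "y \<in> carrier A"
  shows "\<exists>z\<in>carrier A. x \<otimes> F y = F z"
proof (rule comp_induct[OF x(1), where Q = "\<lambda>x. \<exists>z\<in>carrier A. x \<otimes> F y = F z"])
  fix k
  have c: "comp k x \<in> grade A k" "comp k x \<in> carrier A" "F (comp k x) = \<zero>"
    using x comp_grade comp_closed derivation_kernel_comp by auto
  have "comp k x \<otimes> F y = F ((- 1) ^ k \<odot> (comp k x \<otimes> y))"
    using c y derivation_mult[OF c(1) y]
    by (simp add: derivation_smult derivation_closed smult_assoc[symmetric] smult_1 flip: power_mult_distrib)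
  then show "\<exists>z\<in>carrier A. comp k x \<otimes> F y = F z"
    by (rule bexI) (simp add: c y)
next
  show "\<exists>z\<in>carrier A. \<zero> \<otimes> F y = F z"
    by (rule bexI[of _ \<zero>]) (simp_all add: derivation_closed[OF y] derivation_zero)
next
  fix u v assume uv: "u \<in> carrier A" "v \<in> carrier A"
    and "\<exists>z\<in>carrier A. u \<otimes> F y = F z" "\<exists>z\<in>carrier A. v \<otimes> F y = F z"
  then obtain z z' where z: "z \<in> carrier A" "u \<otimes> F y = F z" "z' \<in> carrier A" "v \<otimes> F y = F z'"
    by blast
  show "\<exists>z\<in>carrier A. (u \<oplus> v) \<otimes> F y = F z"
    by (rule bexI[of _ "z \<oplus> z'"]) (simp_all add: uv z derivation_closed[OF y] l_distr derivation_add)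
qed

text \<open>Used with F the differential, for the cocycles, and with F = P, for the middle algebra
  of the zigzag.\<close>

lemma dg_algebra_kernel:
  assumes "\<And>x. x \<in> carrier A \<Longrightarrow> F x = \<zero> \<Longrightarrow> F (diff A x) = \<zero>"
  shows "dg_algebra (dg_restrict A {x \<in> carrier A. F x = \<zero>})"
  by (rule dg_algebra_restrict)
    (auto simp: assms derivation_one derivation_add derivation_smult derivation_closed diff_closed
      derivation_kernel_comp comp_closed derivation_mult_kernel smult_r_null[simplified])

end

lemma dg_algebra_cocycles: "dg_algebra (dg_restrict A (cocycles A))"
  using dg_algebra_kernel[OF derivation_diff] unfolding cocycles_def by (simp add: diff_zero diff_diff)

lemma cocycle_comp: "x \<in> cocycles A \<Longrightarrow> comp k x \<in> cocycles A"
  using derivation_kernel_comp[OF derivation_diff, of x k] by (simp add: cocycles_def comp_closed)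

lemma coboundary_mult_right: "x \<in> coboundaries A \<Longrightarrow> y \<in> cocycles A \<Longrightarrow> x \<otimes> y \<in> coboundaries A"
  using derivation_mult_kernel[OF derivation_diff, symmetric]
  by (auto simp: coboundaries_def cocycles_def)

lemma coboundary_mult_left: "x \<in> coboundaries A \<Longrightarrow> y \<in> cocycles A \<Longrightarrow> y \<otimes> x \<in> coboundaries A"
  using kernel_mult_derivation[OF derivation_diff] by (fastforce simp: coboundaries_def cocycles_def)

lemma ring_cocycle_ring: "ring (cocycle_ring A)"
proof -
  interpret Z: dg_algebra "dg_restrict A (cocycles A)" by (rule dg_algebra_cocycles)
  show ?thesis
  proof (intro ringI abelian_groupI monoidI)
    show "\<exists>y\<in>carrier (cocycle_ring A). y \<oplus>\<^bsub>cocycle_ring A\<^esub> x = \<zero>\<^bsub>cocycle_ring A\<^esub>"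
      if "x \<in> carrier (cocycle_ring A)" for x
      using that Z.M.l_neg[of x] Z.M.a_inv_closed[of x] by (auto simp: cocycle_ring_def)
  qed (use Z.M.a_closed Z.M.zero_closed Z.m_closed Z.one_closed in \<open>auto simp: cocycle_ring_def cocycle_carrier M.a_ac m_assoc l_distr r_distr\<close>)
qed

lemma ideal_coboundaries: "ideal (coboundaries A) (cocycle_ring A)"
proof (rule idealI[OF ring_cocycle_ring])
  interpret Z: ring "cocycle_ring A" by (rule ring_cocycle_ring)
  show "subgroup (coboundaries A) (add_monoid (cocycle_ring A))"
  proof (rule Z.add.subgroupI)
    show "coboundaries A \<subseteq> carrier (cocycle_ring A)"
      by (auto simp: cocycle_ring_def coboundary_cocycle)
    show "coboundaries A \<noteq> {}" by (auto simp: coboundaries_def)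
    show "x \<oplus>\<^bsub>cocycle_ring A\<^esub> y \<in> coboundaries A" if "x \<in> coboundaries A" "y \<in> coboundaries A" for x y
      using that by (auto simp: coboundaries_def cocycle_ring_def simp flip: diff_add)
    fix x assume x: "x \<in> coboundaries A"
    then have "\<ominus>\<^bsub>cocycle_ring A\<^esub> x = \<ominus> x"
      using coboundary_cocycle[OF x] 
      by (intro Z.minus_equality)
        (auto simp: cocycle_ring_def cocycle_carrier minus_smult smult_minus_one_add,
         auto simp: cocycles_def diff_smult smult_r_null[simplified])
    then show "\<ominus>\<^bsub>cocycle_ring A\<^esub> x \<in> coboundaries A"
      using x by (auto simp: coboundaries_def simp flip: diff_minus)
  qed
qed (use coboundary_mult_left coboundary_mult_right in \<open>auto simp: cocycle_ring_def\<close>)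

lemma cohomology_class_eq_iff:
  assumes "x \<in> cocycles A" "y \<in> cocycles A"
  shows "cohomology_class A x = cohomology_class A y \<longleftrightarrow> (\<exists>w\<in>carrier A. x = diff A w \<oplus> y)"
proof -
  interpret I: ideal "coboundaries A" "cocycle_ring A" by (rule ideal_coboundaries)
  have mem: "z \<in> cohomology_class A y \<longleftrightarrow> (\<exists>w\<in>carrier A. z = diff A w \<oplus> y)" for z y
    by (auto simp: a_r_coset_def' cocycle_ring_def coboundaries_def)
  have "cohomology_class A x = cohomology_class A y \<longleftrightarrow> x \<in> cohomology_class A y"
    using I.a_repr_independence'[of x y] I.a_rcos_self[of x] assms
    by (auto simp: cocycle_ring_def)
  then show ?thesis using mem by simp
qed

lemma cohomology_carrier: "carrier (cohomology A) = cohomology_class A ` cocycles A"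
  by (auto simp: cohomology_def Let_def FactRing_simps cocycle_ring_def)

lemma cohomology_class_zero: "cohomology_class A \<zero> = coboundaries A"
proof -
  interpret I: ideal "coboundaries A" "cocycle_ring A" by (rule ideal_coboundaries)
  show ?thesis using I.a_coset_add_zero[OF I.a_subset] by (simp add: cocycle_ring_def)
qed

text \<open>\<open>cohomology\<close> and \<open>cohomology_map\<close> define operations by a union
  over representatives; for a function constant on the class this union is a single value.\<close>

lemma UN_cohomology_class:
  assumes "\<And>w. w \<in> carrier A \<Longrightarrow> F (diff A w \<oplus> x) = F x"
  shows "(\<Union>y\<in>cohomology_class A x. F y) = F x"
proof -
  have "cohomology_class A x = (\<lambda>w. diff A w \<oplus> x) ` carrier A"
    by (auto simp: a_r_coset_def' cocycle_ring_def coboundaries_def)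
  then show ?thesis using assms M.zero_closed by auto
qed

lemma cohomology_ops:
  assumes "x \<in> cocycles A" "y \<in> cocycles A"
  shows "cohomology_class A x \<otimes>\<^bsub>cohomology A\<^esub> cohomology_class A y = cohomology_class A (x \<otimes> y)"
    and "cohomology_class A x \<oplus>\<^bsub>cohomology A\<^esub> cohomology_class A y = cohomology_class A (x \<oplus> y)"
    and "c \<odot>\<^bsub>cohomology A\<^esub> cohomology_class A x = cohomology_class A (c \<odot> x)"
proof -
  interpret I: ideal "coboundaries A" "cocycle_ring A" by (rule ideal_coboundaries)
  interpret Z: dg_algebra "dg_restrict A (cocycles A)" by (rule dg_algebra_cocycles)
  show "cohomology_class A x \<otimes>\<^bsub>cohomology A\<^esub> cohomology_class A y = cohomology_class A (x \<otimes> y)"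
    using I.rcoset_mult_add[of x y] assms by (simp add: cohomology_def Let_def FactRing_def cocycle_ring_def)
  show "cohomology_class A x \<oplus>\<^bsub>cohomology A\<^esub> cohomology_class A y = cohomology_class A (x \<oplus> y)"
    using I.a_rcos_sum[of x y] assms by (simp add: cohomology_def Let_def FactRing_def cocycle_ring_def)
  have "c \<odot>\<^bsub>cohomology A\<^esub> cohomology_class A x = (\<Union>y\<in>cohomology_class A x. cohomology_class A (c \<odot> y))"
    by (simp add: cohomology_def Let_def)
  also have "\<dots> = cohomology_class A (c \<odot> x)"
  proof (rule UN_cohomology_class)
    fix w assume w: "w \<in> carrier A"
    have "c \<odot> x \<in> cocycles A" "c \<odot> (diff A w \<oplus> x) \<in> cocycles A"
      using Z.smult_carrier Z.M.a_closed assms(1) coboundary_cocycle w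
      by (auto simp: coboundaries_def)
    then show "cohomology_class A (c \<odot> (diff A w \<oplus> x)) = cohomology_class A (c \<odot> x)"
      using w assms cocycle_carrier
      by (subst cohomology_class_eq_iff)
        (auto intro!: bexI[of _ "c \<odot> w"] simp: smult_distrib_right diff_smult diff_closed)
  qed
  finally show "c \<odot>\<^bsub>cohomology A\<^esub> cohomology_class A x = cohomology_class A (c \<odot> x)" .
qed

lemma cohomology_simps:
  "\<one>\<^bsub>cohomology A\<^esub> = cohomology_class A \<one>"
  "\<zero>\<^bsub>cohomology A\<^esub> = cohomology_class A \<zero>"
  "grade (cohomology A) k = cohomology_class A ` (cocycles A \<inter> grade A k)"
  "diff (cohomology A) = (\<lambda>_. cohomology_class A \<zero>)"
  unfolding cohomology_class_zero by (auto simp: cohomology_def Let_def FactRing_def cocycle_ring_def)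

text \<open>The class map presents the algebra as an image of the cocycle subalgebra; its kernel is
  homogeneous because components of coboundaries are coboundaries.\<close>

lemma dg_algebra_cohomology: "dg_algebra (cohomology A)"
proof -
  interpret Z: dg_algebra "dg_restrict A (cocycles A)" by (rule dg_algebra_cocycles)
  have Zcomp: "Z.comp k x = comp k x" if "x \<in> cocycles A" for k x
    by (rule restrict_comp[OF dg_algebra_cocycles]) (use that cocycle_carrier in auto)
  show ?thesis
  proof (rule Z.dg_algebra_image[where h = "cohomology_class A"])
    show "cohomology_class A (Z.comp k x) = cohomology_class A (Z.comp k y)"
      if "x \<in> carrier (dg_restrict A (cocycles A))" "y \<in> carrier (dg_restrict A (cocycles A))"
        "cohomology_class A x = cohomology_class A y" for k x y
    proof -
      have xy: "x \<in> cocycles A" "y \<in> cocycles A" using that by auto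
      have "\<exists>w\<in>carrier A. x = diff A w \<oplus> y"
        using that(3) cohomology_class_eq_iff[OF xy] by blast
      then obtain w where w: "w \<in> carrier A" "x = diff A w \<oplus> y" by blast
      have "comp k x = comp k (diff A w) \<oplus> comp k y"
        using w xy cocycle_carrier diff_closed by (simp add: comp_add)
      moreover have "\<exists>v\<in>carrier A. comp k (diff A w) = diff A v"
        by (rule comp_derivation_image[OF derivation_diff w(1)])
      ultimately show ?thesis
        using cohomology_class_eq_iff[OF cocycle_comp cocycle_comp, OF xy, of k k] xy by (auto simp: Zcomp)
    qed
  qed (auto simp: cohomology_carrier cohomology_ops cohomology_simps cocycles_def derivation_one[OF derivation_diff])
qed

end

section \<open>A criterion for formality\<close>

lemma dga_homI:
  assumes "\<And>x. x \<in> carrier A \<Longrightarrow> f x \<in> carrier B"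
    and "\<And>x y. x \<in> carrier A \<Longrightarrow> y \<in> carrier A \<Longrightarrow> f (x \<oplus>\<^bsub>A\<^esub> y) = f x \<oplus>\<^bsub>B\<^esub> f y"
    and "\<And>x y. x \<in> carrier A \<Longrightarrow> y \<in> carrier A \<Longrightarrow> f (x \<otimes>\<^bsub>A\<^esub> y) = f x \<otimes>\<^bsub>B\<^esub> f y"
    and "f \<one>\<^bsub>A\<^esub> = \<one>\<^bsub>B\<^esub>"
    and "\<And>c x. x \<in> carrier A \<Longrightarrow> f (c \<odot>\<^bsub>A\<^esub> x) = c \<odot>\<^bsub>B\<^esub> f x"
    and "\<And>k x. x \<in> grade A k \<Longrightarrow> f x \<in> grade B k"
    and "\<And>x. x \<in> carrier A \<Longrightarrow> f (diff A x) = diff B (f x)"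
  shows "f \<in> dga_hom A B"
  using assms by (auto simp: dga_hom_def intro!: ring_hom_memI)

lemma dga_homD:
  assumes "f \<in> dga_hom A B"
  shows "x \<in> carrier A \<Longrightarrow> f x \<in> carrier B"
    and "x \<in> carrier A \<Longrightarrow> y \<in> carrier A \<Longrightarrow> f (x \<oplus>\<^bsub>A\<^esub> y) = f x \<oplus>\<^bsub>B\<^esub> f y"
    and "x \<in> carrier A \<Longrightarrow> f (c \<odot>\<^bsub>A\<^esub> x) = c \<odot>\<^bsub>B\<^esub> f x"
    and "x \<in> carrier A \<Longrightarrow> f (diff A x) = diff B (f x)"
  using assms by (auto simp: dga_hom_def ring_hom_def)

text \<open>By linearity injectivity only has to be checked on the kernel, and surjectivity up to a
  coboundary.\<close>

lemma quasi_isoI: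
  assumes A: "dg_algebra A" and B: "dg_algebra B" and f: "f \<in> dga_hom A B"
    and inj: "\<And>x. x \<in> cocycles A \<Longrightarrow> f x \<in> coboundaries B \<Longrightarrow> x \<in> coboundaries A"
    and surj: "\<And>y. y \<in> cocycles B \<Longrightarrow> \<exists>x\<in>cocycles A. \<exists>w\<in>carrier B. f x = diff B w \<oplus>\<^bsub>B\<^esub> y"
  shows "quasi_iso A B f"
proof -
  interpret A: dg_algebra A by (rule A)
  interpret B: dg_algebra B by (rule B)
  have f_zero: "f \<zero>\<^bsub>A\<^esub> = \<zero>\<^bsub>B\<^esub>"
    using dga_homD(3)[OF f, of "\<zero>\<^bsub>A\<^esub>" 0] dga_homD(1)[OF f, of "\<zero>\<^bsub>A\<^esub>"]
    by (simp add: A.smult_zero B.smult_zero)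
  have cocycle: "f x \<in> cocycles B" if "x \<in> cocycles A" for x
    using that dga_homD(1,4)[OF f, of x] f_zero by (simp add: cocycles_def)
  have map: "cohomology_map A B f (cohomology_class A x) = cohomology_class B (f x)"
    if x: "x \<in> cocycles A" for x
    unfolding cohomology_map_def
  proof (rule A.UN_cohomology_class)
    fix w assume w: "w \<in> carrier A"
    have "f (diff A w \<oplus>\<^bsub>A\<^esub> x) = diff B (f w) \<oplus>\<^bsub>B\<^esub> f x"
      using dga_homD[OF f] w x A.cocycle_carrier A.diff_closed by metis
    moreover have "diff B (f w) \<oplus>\<^bsub>B\<^esub> f x \<in> cocycles B"
      using dga_homD(1)[OF f w] cocycle[OF x] B.diff_closed
      by (auto simp: cocycles_def B.diff_add B.diff_diff)
    ultimately show "cohomology_class B (f (diff A w \<oplus>\<^bsub>A\<^esub> x)) = cohomology_class B (f x)"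
      using dga_homD(1)[OF f w] cocycle[OF x] by (subst B.cohomology_class_eq_iff) auto
  qed
  have "bij_betw (cohomology_map A B f) (carrier (cohomology A)) (carrier (cohomology B))"
    unfolding bij_betw_def A.cohomology_carrier B.cohomology_carrier
  proof
    show "inj_on (cohomology_map A B f) (cohomology_class A ` cocycles A)"
    proof (rule inj_onI, elim imageE)
      fix S T x y assume xy: "x \<in> cocycles A" "y \<in> cocycles A"
        and ST: "S = cohomology_class A x" "T = cohomology_class A y"
        and eq: "cohomology_map A B f S = cohomology_map A B f T"
      \<comment> \<open>The difference is written with the scalar -1 since \<open>dga_hom\<close>
        records sums and scalar multiples but no negation.\<close>
      let ?z = "x \<oplus>\<^bsub>A\<^esub> (- 1) \<odot>\<^bsub>A\<^esub> y"
      have c: "x \<in> carrier A" "y \<in> carrier A" "f x \<in> carrier B" "f y \<in> carrier B"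
        using xy A.cocycle_carrier dga_homD(1)[OF f] by auto
      obtain w where w: "w \<in> carrier B" "f x = diff B w \<oplus>\<^bsub>B\<^esub> f y"
        using eq xy cocycle by (auto simp: ST map B.cohomology_class_eq_iff)
      have "f ?z = diff B w"
        using c w B.diff_closed[OF w(1)] B.minus_smult[of "f y"]
        by (simp add: dga_homD(2,3)[OF f] B.M.a_assoc B.M.r_neg flip: B.minus_smult)
      moreover have "?z \<in> cocycles A"
        using xy by (auto simp: cocycles_def A.diff_add A.diff_smult A.smult_r_null[simplified])
      ultimately obtain v where v: "v \<in> carrier A" "?z = diff A v"
        using inj[of ?z] w(1) by (auto simp: coboundaries_def)
      have "x = ?z \<oplus>\<^bsub>A\<^esub> y"
        using c by (simp add: A.M.a_assoc A.smult_minus_one_add)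
      then show "S = T"
        using v xy by (auto simp: ST A.cohomology_class_eq_iff)
    qed
    show "cohomology_map A B f ` cohomology_class A ` cocycles A = cohomology_class B ` cocycles B"
    proof safe
      fix y assume y: "y \<in> cocycles B"
      obtain x w where x: "x \<in> cocycles A" "w \<in> carrier B" "f x = diff B w \<oplus>\<^bsub>B\<^esub> y"
        using surj[OF y] by blast
      then have "cohomology_class B (f x) = cohomology_class B y"
        using y cocycle[OF x(1)] by (auto simp: B.cohomology_class_eq_iff)
      then have "cohomology_class B y = cohomology_map A B f (cohomology_class A x)"
        using map[OF x(1)] by simp
      then show "cohomology_class B y \<in> cohomology_map A B f ` cohomology_class A ` cocycles A"
        using x(1) by blast
    qed (use map cocycle in auto)
  qed
  then show ?thesis using A B f by (simp add: quasi_iso_def)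
qed

text \<open>The copy on singletons moves an algebra to the type carrying its cohomology.\<close>

definition singleton_dga :: "'b dga \<Rightarrow> 'b set dga" where
  "singleton_dga A =
     \<lparr>carrier = (\<lambda>x. {x}) ` carrier A,
      monoid.mult = (\<lambda>S T. {the_elem S \<otimes>\<^bsub>A\<^esub> the_elem T}),
      monoid.one = {\<one>\<^bsub>A\<^esub>}, ring.zero = {\<zero>\<^bsub>A\<^esub>},
      ring.add = (\<lambda>S T. {the_elem S \<oplus>\<^bsub>A\<^esub> the_elem T}),
      module.smult = (\<lambda>c S. {c \<odot>\<^bsub>A\<^esub> the_elem S}),
      grade = (\<lambda>k. (\<lambda>x. {x}) ` grade A k),
      diff = (\<lambda>S. {diff A (the_elem S)})\<rparr>"

lemma singleton_dga_simps [simp]: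
  "carrier (singleton_dga A) = (\<lambda>x. {x}) ` carrier A"
  "{x} \<otimes>\<^bsub>singleton_dga A\<^esub> {y} = {x \<otimes>\<^bsub>A\<^esub> y}"
  "\<one>\<^bsub>singleton_dga A\<^esub> = {\<one>\<^bsub>A\<^esub>}" "\<zero>\<^bsub>singleton_dga A\<^esub> = {\<zero>\<^bsub>A\<^esub>}"
  "{x} \<oplus>\<^bsub>singleton_dga A\<^esub> {y} = {x \<oplus>\<^bsub>A\<^esub> y}"
  "c \<odot>\<^bsub>singleton_dga A\<^esub> {x} = {c \<odot>\<^bsub>A\<^esub> x}"
  "grade (singleton_dga A) k = (\<lambda>x. {x}) ` grade A k"
  "diff (singleton_dga A) {x} = {diff A x}"
  by (simp_all add: singleton_dga_def)

lemma (in dg_algebra) dg_algebra_singleton: "dg_algebra (singleton_dga A)"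
  by (rule dg_algebra_image[where h = "\<lambda>x. {x}"]) auto


text \<open>With Q = d - P one has Q Q = 0 and P d = P Q. The three exactness hypotheses concern the
  images of d, P and Q and all lead into the image of P d = P Q. Their premises say that the element
  is killed by P, by d and by P respectively, which in each case means that all three operators kill
  it.\<close>

theorem (in dg_algebra) formalI:
  fixes P :: "'b \<Rightarrow> 'b"
  assumes P: "derivation P"
    and P_P: "\<And>x. x \<in> carrier A \<Longrightarrow> P (P x) = \<zero>"
    and P_diff: "\<And>x. x \<in> carrier A \<Longrightarrow> P (diff A x) = (- 1) \<odot> diff A (P x)"
    and exact_diff: "\<And>x. x \<in> carrier A \<Longrightarrow> P (diff A x) = \<zero> \<Longrightarrow>
        \<exists>w\<in>carrier A. diff A x = P (diff A w)"
    and exact_P: "\<And>x. x \<in> carrier A \<Longrightarrow> diff A (P x) = \<zero> \<Longrightarrow> \<exists>w\<in>carrier A. P x = P (diff A w)"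
    and exact_Q: "\<And>x. x \<in> carrier A \<Longrightarrow> P (diff A x \<oplus> (- 1) \<odot> P x) = \<zero> \<Longrightarrow>
        \<exists>w\<in>carrier A. diff A x \<oplus> (- 1) \<odot> P x = P (diff A w)"
  shows "formal A"
proof -
  note [simp] = derivation_closed[OF P] derivation_add[OF P] derivation_smult[OF P] P_P P_diff
    derivation_zero[OF P] diff_add diff_smult diff_closed diff_diff diff_zero smult_r_null[simplified]
    smult_minus_one_add
  define K where "K = {x \<in> carrier A. P x = \<zero>}"
  define C where "C = singleton_dga (dg_restrict A K)"
  have K: "x \<in> K \<longleftrightarrow> x \<in> carrier A \<and> P x = \<zero>" for x
    by (simp add: K_def)
  interpret K: dg_algebra "dg_restrict A K"
    unfolding K_def by (rule dg_algebra_kernel[OF P]) simp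
  have C: "dg_algebra C"
    unfolding C_def by (rule K.dg_algebra_singleton)
  have H: "dg_algebra (cohomology A)"
    by (rule dg_algebra_cohomology)
  have diff_P: "diff A (P x) = P ((- 1) \<odot> diff A x)" if "x \<in> carrier A" for x
    using that by (simp add: smult_assoc[symmetric] smult_1)
  \<comment> \<open>Injectivity for the inclusion: x = P d w = d (- P w), and - P w lies in K
    because P P = 0.\<close>
  have exact_K: "\<exists>z\<in>K. x = diff A z" if x: "x \<in> K" "y \<in> carrier A" "x = diff A y" for x y
  proof -
    obtain w where w: "w \<in> carrier A" "x = P (diff A w)"
      using exact_diff[of y] x K by auto
    then show ?thesis
      by (intro bexI[of _ "(- 1) \<odot> P w"]) (simp_all add: K)
  qed
  \<comment> \<open>Surjectivity for the inclusion: d P y = - P d y = 0, so P y = P d w for some w,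
    and y - d w is a representative in K.\<close>
  have closed_K: "\<exists>x\<in>K. diff A x = \<zero> \<and> (\<exists>w\<in>carrier A. x = diff A w \<oplus> y)" if y: "y \<in> cocycles A" for y
  proof -
    have y: "y \<in> carrier A" "diff A y = \<zero>" using that by (auto simp: cocycles_def)
    obtain w where w: "w \<in> carrier A" "P y = P (diff A w)"
      using exact_P[of y] y diff_P[of y] by auto
    let ?w = "(- 1) \<odot> w"
    have "P (diff A ?w \<oplus> y) = \<zero>"
      using w y smult_minus_one_add[of "P (diff A w)"] by (simp del: P_diff)
    then show ?thesis
      using w y by (intro bexI[of _ "diff A ?w \<oplus> y"] conjI bexI[of _ ?w]) (simp_all add: K del: P_diff)
  qed

  have incl: "quasi_iso C A the_elem"
  proof (rule quasi_isoI[OF C dg_algebra_axioms])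
    show "the_elem \<in> dga_hom C A"
      by (rule dga_homI) (auto simp: C_def K)
    show "S \<in> coboundaries C" if S: "S \<in> cocycles C" "the_elem S \<in> coboundaries A" for S
    proof -
      obtain x where x: "S = {x}" "x \<in> K"
        using S(1) by (auto simp: C_def cocycles_def)
      moreover obtain y where "y \<in> carrier A" "x = diff A y"
        using S(2) x(1) by (auto simp: coboundaries_def)
      ultimately obtain z where z: "z \<in> K" "x = diff A z" using exact_K by blast
      then have "S = diff C {z}" "{z} \<in> carrier C" using x(1) by (auto simp: C_def)
      then show ?thesis by (auto simp: coboundaries_def)
    qed
    show "\<exists>S\<in>cocycles C. \<exists>w\<in>carrier A. the_elem S = diff A w \<oplus> y" if y: "y \<in> cocycles A" for y
    proof -
      obtain x where "x \<in> K" "diff A x = \<zero>" "\<exists>w\<in>carrier A. x = diff A w \<oplus> y"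
        using closed_K[OF y] by blast
      then show ?thesis by (intro bexI[of _ "{x}"]) (auto simp: cocycles_def C_def)
    qed
  qed

  \<comment> \<open>As P x = 0, d x equals Q x, and \<open>exact_Q\<close> gives d x = P d w = - d
    (P w).\<close>
  have correct: "\<exists>w\<in>carrier A. x \<oplus> P w \<in> cocycles A" if x: "x \<in> K" for x
  proof -
    obtain w where w: "w \<in> carrier A" "diff A x = P (diff A w)"
      using exact_Q[of x] x K by auto
    then show ?thesis
      using x by (intro bexI[of _ w]) (simp_all add: cocycles_def K)
  qed
  \<comment> \<open>Two corrections differ by some P v with d P v = 0; \<open>exact_P\<close> turns
    P v into P d u = d (- P u), a coboundary.\<close>
  have unique: "cohomology_class A (x \<oplus> P w) = cohomology_class A (x \<oplus> P w')"
    if x: "x \<in> K" and w: "w \<in> carrier A" "w' \<in> carrier A"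
      and c: "x \<oplus> P w \<in> cocycles A" "x \<oplus> P w' \<in> cocycles A" for x w w'
  proof -
    have xc: "x \<in> carrier A" using x K by blast
    let ?v = "w \<oplus> (- 1) \<odot> w'"
    have "diff A (P w) = diff A (P w')"
    proof -
      have "diff A x \<oplus> diff A (P w) = \<zero>" "diff A x \<oplus> diff A (P w') = \<zero>"
        using c xc w by (simp_all add: cocycles_def)
      then show ?thesis
        using xc w by (metis M.minus_equality M.minus_minus derivation_closed[OF P] diff_closed)
    qed
    then have "diff A (P ?v) = \<zero>"
      using w M.a_comm[of "diff A (P w')" "(- 1) \<odot> diff A (P w')"] by simp
    then obtain u where u: "u \<in> carrier A" "P ?v = P (diff A u)"
      using exact_P[of ?v] w by auto
    have "P w = P ?v \<oplus> P w'"
      using w by (simp add: M.a_assoc)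
    then have "x \<oplus> P w = diff A ((- 1) \<odot> P u) \<oplus> (x \<oplus> P w')"
      using u w xc by (simp add: M.a_lcomm)
    then show ?thesis
      using u(1) unfolding cohomology_class_eq_iff[OF c] by (intro bexI[of _ "(- 1) \<odot> P u"]) simp_all
  qed
  \<comment> \<open>A particular w is chosen here, but by \<open>unique\<close> every w that closes
    the form computes the same class.\<close>
  define g where "g S = cohomology_class A (the_elem S \<oplus> P (SOME w. w \<in> carrier A \<and> the_elem S \<oplus> P w \<in> cocycles A))" for S
  have g: "g {x} = cohomology_class A z"
    if "x \<in> K" "w \<in> carrier A" "z = x \<oplus> P w" "z \<in> cocycles A" for x w z
  proof -
    have "\<exists>w. w \<in> carrier A \<and> x \<oplus> P w \<in> cocycles A" using that by blast
    from someI_ex[OF this] show ?thesis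
      unfolding g_def using unique[of x "SOME w. w \<in> carrier A \<and> x \<oplus> P w \<in> cocycles A" w] that by simp
  qed
  have g_closed: "g {x} = cohomology_class A x" if "x \<in> K" "diff A x = \<zero>" for x
    using that K by (intro g[of x \<zero>]) (auto simp: cocycles_def)
  have zero_cocycle: "\<zero> \<in> cocycles A" by (simp add: cocycles_def)
  interpret Z: dg_algebra "dg_restrict A (cocycles A)" by (rule dg_algebra_cocycles)

  have proj: "quasi_iso C (cohomology A) g"
  proof (rule quasi_isoI[OF C H])
    show "g \<in> dga_hom C (cohomology A)"
    proof (rule dga_homI)
      show "g \<one>\<^bsub>C\<^esub> = \<one>\<^bsub>cohomology A\<^esub>"
        using g_closed[of \<one>] derivation_one[OF P] derivation_one[OF derivation_diff]
        by (simp add: C_def K cohomology_simps)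
    next
      fix S assume "S \<in> carrier C"
      then obtain x where x: "S = {x}" "x \<in> K" "x \<in> carrier A" "P x = \<zero>" by (auto simp: C_def K)
      obtain w where w: "w \<in> carrier A" "x \<oplus> P w \<in> cocycles A" using correct[OF x(2)] by blast
      have gx: "g S = cohomology_class A (x \<oplus> P w)" using g[OF x(2) w(1) refl w(2)] x(1) by simp
      then show "g S \<in> carrier (cohomology A)" using w by (simp add: cohomology_carrier)
      \<comment> \<open>This is d (x + P w) = 0, rewritten so that zero appears as a corrected form
        of d x. Hence g kills d x, as the zero differential of the target requires.\<close>
      have dx: "diff A x \<oplus> P ((- 1) \<odot> diff A w) = \<zero>"
        using w(2) x w(1) by (simp add: cocycles_def smult_assoc[symmetric] smult_1)
      show "g (diff C S) = diff (cohomology A) (g S)"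
        using g[OF _ _ dx[symmetric] zero_cocycle] x w(1) by (simp add: C_def K cohomology_simps)
      show "g (c \<odot>\<^bsub>C\<^esub> S) = c \<odot>\<^bsub>cohomology A\<^esub> g S" for c
      proof -
        have "g {c \<odot> x} = cohomology_class A (c \<odot> (x \<oplus> P w))"
          using Z.smult_carrier[of "x \<oplus> P w" c] x w
          by (intro g[of _ "c \<odot> w"]) (simp_all add: K smult_distrib_right)
        then show ?thesis using x w by (simp add: C_def gx[unfolded x(1)] cohomology_ops)
      qed
      fix T assume "T \<in> carrier C"
      then obtain y where y: "T = {y}" "y \<in> K" "y \<in> carrier A" "P y = \<zero>" by (auto simp: C_def K)
      obtain v where v: "v \<in> carrier A" "y \<oplus> P v \<in> cocycles A" using correct[OF y(2)] by blast
      have gy: "g T = cohomology_class A (y \<oplus> P v)" using g[OF y(2) v(1) refl v(2)] y(1) by simp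
      have "g {x \<oplus> y} = cohomology_class A ((x \<oplus> P w) \<oplus> (y \<oplus> P v))"
        using Z.M.a_closed[of "x \<oplus> P w" "y \<oplus> P v"] x w y v
        by (intro g[of _ "w \<oplus> v"]) (simp_all add: K M.a_ac)
      then show "g (S \<oplus>\<^bsub>C\<^esub> T) = g S \<oplus>\<^bsub>cohomology A\<^esub> g T"
        using x y w v by (simp add: C_def gx[unfolded x(1)] gy[unfolded y(1)] cohomology_ops)
      \<comment> \<open>The product (x + P w)(y + P v) must be x y plus a P-exact term: x P v is
        P-exact because P x = 0, and P w (y + P v) is because P kills y + P v.\<close>
      obtain u where u: "u \<in> carrier A" "x \<otimes> P v = P u"
        using kernel_mult_derivation[OF P x(3,4) v(1)] by blast
      have "P w \<otimes> (y \<oplus> P v) = P (w \<otimes> (y \<oplus> P v))"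
        using derivation_mult_kernel[OF P w(1), of "y \<oplus> P v"] y v by simp
      then have eq: "(x \<oplus> P w) \<otimes> (y \<oplus> P v) = x \<otimes> y \<oplus> P (u \<oplus> w \<otimes> (y \<oplus> P v))"
        using x y w v u by (simp add: l_distr r_distr[of y "P v" x] M.a_assoc)
      have "P (x \<otimes> y) = \<zero>"
        using derivation_mult_kernel[OF P x(3) y(3,4)] x y by simp
      then have "g {x \<otimes> y} = cohomology_class A ((x \<oplus> P w) \<otimes> (y \<oplus> P v))"
        using Z.m_closed[of "x \<oplus> P w" "y \<oplus> P v"] x w y v u
        by (intro g[OF _ _ eq]) (simp_all add: K)
      then show "g (S \<otimes>\<^bsub>C\<^esub> T) = g S \<otimes>\<^bsub>cohomology A\<^esub> g T"
        using x y w v by (simp add: C_def gx[unfolded x(1)] gy[unfolded y(1)] cohomology_ops)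
    next
      fix k S assume "S \<in> grade C k"
      then obtain x where x: "S = {x}" "x \<in> K" "x \<in> carrier A" "x \<in> grade A k" by (auto simp: C_def K)
      obtain w where w: "w \<in> carrier A" "x \<oplus> P w \<in> cocycles A" using correct[OF x(2)] by blast
      \<comment> \<open>w may have mixed degree. The degree k component of x + P w is still closed
        and still a correction of x, since components of P w lie in the image of P.\<close>
      obtain v where v: "v \<in> carrier A" "comp k (P w) = P v"
        using comp_derivation_image[OF P w(1)] by blast
      have eq: "comp k (x \<oplus> P w) = x \<oplus> P v"
        using x w v comp_of_grade[OF x(4), of k] by (simp add: comp_add)
      have c: "comp k (x \<oplus> P w) \<in> cocycles A" "comp k (x \<oplus> P w) \<in> grade A k"
        using cocycle_comp[OF w(2)] comp_grade[of "x \<oplus> P w" k] x w by auto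
      have "g S = cohomology_class A (comp k (x \<oplus> P w))"
        using g[OF x(2) v(1) eq c(1)] x(1) by simp
      then show "g S \<in> grade (cohomology A) k"
        using c by (simp add: cohomology_simps)
    qed
    show "S \<in> coboundaries C" if S: "S \<in> cocycles C" "g S \<in> coboundaries (cohomology A)" for S
    proof -
      obtain x where x: "S = {x}" "x \<in> K" "diff A x = \<zero>" "x \<in> cocycles A"
        using S(1) by (auto simp: C_def cocycles_def K)
      have "cohomology_class A x = cohomology_class A \<zero>"
        using S(2) g_closed[OF x(2,3)] x(1) by (auto simp: coboundaries_def cohomology_simps)
      then obtain y where "y \<in> carrier A" "x = diff A y \<oplus> \<zero>"
        using cohomology_class_eq_iff[OF x(4) zero_cocycle] by blast
      then obtain z where z: "z \<in> K" "x = diff A z" using exact_K[OF x(2), of y] by auto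
      then have "S = diff C {z}" "{z} \<in> carrier C" using x(1) by (auto simp: C_def)
      then show ?thesis by (auto simp: coboundaries_def)
    qed
    show "\<exists>S\<in>cocycles C. \<exists>w\<in>carrier (cohomology A). g S = diff (cohomology A) w \<oplus>\<^bsub>cohomology A\<^esub> y"
      if y: "y \<in> cocycles (cohomology A)" for y
    proof -
      obtain c where c: "c \<in> cocycles A" "y = cohomology_class A c"
        using y by (auto simp: cocycles_def[of "cohomology A"] cohomology_carrier)
      \<comment> \<open>\<open>closed_K\<close> yields a representative in K that is already closed,
        on which g is the plain class map.\<close>
      obtain x w where x: "x \<in> K" "diff A x = \<zero>" "w \<in> carrier A" "x = diff A w \<oplus> c"
        using closed_K[OF c(1)] by blast
      have "cohomology_class A x = cohomology_class A c"
        using x c K by (subst cohomology_class_eq_iff) (auto simp: cocycles_def)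
      then have "g {x} = diff (cohomology A) y \<oplus>\<^bsub>cohomology A\<^esub> y"
        using c cocycle_carrier g_closed[OF x(1,2)] by (simp add: cohomology_simps cohomology_ops zero_cocycle)
      moreover have "{x} \<in> cocycles C" "y \<in> carrier (cohomology A)"
        using x c by (auto simp: cocycles_def C_def cohomology_carrier)
      ultimately show ?thesis by blast
    qed
  qed
  show ?thesis
    unfolding formal_def using incl proj by (intro exI[of _ C]) (auto intro: r_into_equivclp)
qed

section \<open>Calculus\<close>

lemma has_derivative_D: "f differentiable (at z) \<Longrightarrow> (f has_derivative D f z) (at z)"
  using frechet_derivative_works by blast

lemma D_eq: "(f has_derivative f') (at z) \<Longrightarrow> D f z = f'"
  using frechet_derivative_at by metis

lemma D_linear: "f differentiable (at z) \<Longrightarrow> linear (D f z)"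
  by (rule linear_frechet_derivative)

text \<open>Locally equal functions have the same derivatives, so the choice hidden in
  \<open>frechet_derivative\<close> falls on the same map whether or not they are
  differentiable.\<close>

lemma D_cong:
  assumes "open S" "z \<in> S" "\<And>y. y \<in> S \<Longrightarrow> f y = g y"
  shows "D f z = D g z"
proof -
  have "(f has_derivative h) (at z) \<longleftrightarrow> (g has_derivative h) (at z)" for h
    using has_derivative_transform_within_open[of f h z UNIV S g]
      has_derivative_transform_within_open[of g h z UNIV S f] assms by auto
  then show ?thesis unfolding frechet_derivative_def by simp
qed

lemma differentiable_cong:
  assumes "open S" "z \<in> S" "\<And>y. y \<in> S \<Longrightarrow> f y = g y" "f differentiable (at z)"
  shows "g differentiable (at z)"
  using assms unfolding differentiable_def by (metis has_derivative_transform_within_open)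

lemma D_const: "D (\<lambda>_. c) z v = 0"
  using D_eq[OF has_derivative_const] by (metis (no_types))

lemma D_add: "f differentiable (at z) \<Longrightarrow> g differentiable (at z) \<Longrightarrow> D (\<lambda>y. f y + g y) z v = D f z v + D g z v"
  by (subst D_eq[OF has_derivative_add[OF has_derivative_D has_derivative_D]]) auto

lemma D_mult:
  fixes f g :: "'v::real_normed_vector \<Rightarrow> 'w::real_normed_algebra"
  shows "f differentiable (at z) \<Longrightarrow> g differentiable (at z) \<Longrightarrow>
    D (\<lambda>y. f y * g y) z v = f z * D g z v + D f z v * g z"
  by (subst D_eq[OF has_derivative_mult[OF has_derivative_D has_derivative_D]]) auto

lemma D_bounded_linear:
  "bounded_linear h \<Longrightarrow> f differentiable (at z) \<Longrightarrow> D (\<lambda>y. h (f y)) z v = h (D f z v)"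
  by (subst D_eq[OF bounded_linear.has_derivative[OF _ has_derivative_D]]) auto

subsection \<open>Smooth functions\<close>

lemma C_diff_on_cong:
  "open S \<Longrightarrow> (\<And>y. y \<in> S \<Longrightarrow> f y = g y) \<Longrightarrow> C_diff_on k S f \<Longrightarrow> C_diff_on k S g"
proof (induction k arbitrary: f g)
  case 0
  then show ?case using continuous_on_cong by force
next
  case (Suc k)
  show ?case
    unfolding C_diff_on.simps
  proof (intro conjI allI ballI)
    show "g differentiable (at z)" if "z \<in> S" for z
      using Suc.prems that differentiable_cong[of S z f g] by simp
    show "C_diff_on k S (\<lambda>z. D g z v)" for v
    proof (rule Suc.IH[OF \<open>open S\<close>])
      show "C_diff_on k S (\<lambda>z. D f z v)" using Suc.prems by simp
      show "D f y v = D g y v" if "y \<in> S" for y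
        using D_cong[OF \<open>open S\<close> that, of f g] Suc.prems(2) by simp
    qed
  qed
qed

lemma C_diff_on_Suc_imp: "C_diff_on (Suc k) S f \<Longrightarrow> C_diff_on k S f"
proof (induction k arbitrary: f)
  case 0
  then show ?case
    by (auto simp: differentiable_at_imp_differentiable_on intro!: differentiable_imp_continuous_on)
qed (simp only: C_diff_on.simps, blast)

lemma C_diff_on_const: "C_diff_on k S (\<lambda>_. c)"
  by (induction k arbitrary: c) (auto simp: D_const)

lemma C_diff_on_add:
  "open S \<Longrightarrow> C_diff_on k S f \<Longrightarrow> C_diff_on k S g \<Longrightarrow> C_diff_on k S (\<lambda>y. f y + g y)"
proof (induction k arbitrary: f g)
  case (Suc k)
  have "C_diff_on k S (\<lambda>z. D (\<lambda>y. f y + g y) z v)" for v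
    by (rule C_diff_on_cong[OF \<open>open S\<close> _ Suc.IH, of "\<lambda>z. D f z v" "\<lambda>z. D g z v"])
      (use Suc.prems in \<open>auto simp: D_add\<close>)
  then show ?case using Suc.prems by auto
qed (auto intro: continuous_on_add)

lemma C_diff_on_mult:
  fixes f g :: "'v::real_normed_vector \<Rightarrow> 'w::real_normed_algebra"
  shows "open S \<Longrightarrow> C_diff_on k S f \<Longrightarrow> C_diff_on k S g \<Longrightarrow> C_diff_on k S (\<lambda>y. f y * g y)"
proof (induction k arbitrary: f g)
  case (Suc k)
  have "C_diff_on k S (\<lambda>z. D (\<lambda>y. f y * g y) z v)" for v
  proof (rule C_diff_on_cong[OF \<open>open S\<close> _ C_diff_on_add[OF \<open>open S\<close> Suc.IH Suc.IH]])
    show "f y * D g y v + D f y v * g y = D (\<lambda>y. f y * g y) y v" if "y \<in> S" for y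
      using Suc.prems that by (simp add: D_mult)
  qed (use Suc.prems C_diff_on_Suc_imp in auto)
  then show ?case using Suc.prems by auto
qed (auto intro: continuous_on_mult)

lemma C_diff_on_bounded_linear:
  assumes "bounded_linear h"
  shows "open S \<Longrightarrow> C_diff_on k S f \<Longrightarrow> C_diff_on k S (\<lambda>y. h (f y))"
proof (induction k arbitrary: f)
  case 0
  then show ?case using bounded_linear.continuous_on[OF assms] by auto
next
  case (Suc k)
  have "C_diff_on k S (\<lambda>z. D (\<lambda>y. h (f y)) z v)" for v
    by (rule C_diff_on_cong[OF \<open>open S\<close> _ Suc.IH, of "\<lambda>z. D f z v"])
      (use Suc.prems assms in \<open>auto simp: D_bounded_linear\<close>)
  then show ?case
    using Suc.prems bounded_linear_imp_differentiable[OF assms] differentiable_compose[of h f]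
    by auto
qed

lemma smooth_on_differentiable: "smooth_on S f \<Longrightarrow> z \<in> S \<Longrightarrow> f differentiable (at z)"
  unfolding smooth_on_def by (metis C_diff_on.simps(2))

lemma smooth_on_D: "smooth_on S f \<Longrightarrow> smooth_on S (\<lambda>z. D f z v)"
  unfolding smooth_on_def by (metis C_diff_on.simps(2))

lemma smooth_on_cong: "open S \<Longrightarrow> (\<And>y. y \<in> S \<Longrightarrow> f y = g y) \<Longrightarrow> smooth_on S f \<Longrightarrow> smooth_on S g"
  unfolding smooth_on_def using C_diff_on_cong by blast

lemma smooth_on_const [simp]: "smooth_on S (\<lambda>_. c)"
  by (simp add: smooth_on_def C_diff_on_const)

lemma smooth_on_add: "open S \<Longrightarrow> smooth_on S f \<Longrightarrow> smooth_on S g \<Longrightarrow> smooth_on S (\<lambda>y. f y + g y)"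
  by (simp add: smooth_on_def C_diff_on_add)

lemma smooth_on_mult:
  fixes f g :: "'v::real_normed_vector \<Rightarrow> 'w::real_normed_algebra"
  shows "open S \<Longrightarrow> smooth_on S f \<Longrightarrow> smooth_on S g \<Longrightarrow> smooth_on S (\<lambda>y. f y * g y)"
  by (simp add: smooth_on_def C_diff_on_mult)

lemma smooth_on_sum:
  assumes "open S" "\<And>i. i \<in> I \<Longrightarrow> smooth_on S (f i)"
  shows "smooth_on S (\<lambda>y. \<Sum>i\<in>I. f i y)"
  using assms(2) by (induction I rule: infinite_finite_induct) (auto intro: smooth_on_add assms(1))

lemma smooth_on_bounded_linear: "open S \<Longrightarrow> bounded_linear h \<Longrightarrow> smooth_on S f \<Longrightarrow> smooth_on S (\<lambda>y. h (f y))"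
  by (simp add: smooth_on_def C_diff_on_bounded_linear)

text \<open>The second difference quotient of \<open>f\<close> along \<open>u\<close> and \<open>v\<close> is symmetric in \<open>u\<close> and \<open>v\<close>, and by the
  mean value inequality it approximates \<open>D (D f u) v\<close>.\<close>

lemma second_difference_bound:
  fixes f :: "'v::real_normed_vector \<Rightarrow> 'w::real_normed_vector"
  assumes "open S" "z \<in> S" "e > 0"
    and f: "\<And>y. y \<in> S \<Longrightarrow> f differentiable (at y)"
    and G: "(\<lambda>y. D f y u) differentiable (at z)"
  shows "\<exists>d>0. \<forall>t. 0 < t \<and> t < d \<longrightarrow>
    norm (f (z + t *\<^sub>R u + t *\<^sub>R v) - f (z + t *\<^sub>R u) - f (z + t *\<^sub>R v) + f z
          - t\<^sup>2 *\<^sub>R D (\<lambda>y. D f y u) z v) \<le> t\<^sup>2 * (e * (2 * norm u + norm v))"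
proof -
  define G where "G y = D f y u" for y
  define G' where "G' = D G z"
  have G': "(G has_derivative G') (at z)"
    unfolding G'_def using G G_def has_derivative_D by (metis (no_types, lifting) ext)
  have lin: "linear G'" using G' has_derivative_linear by blast
  obtain r where r: "r > 0" "ball z r \<subseteq> S" using assms(1,2) open_contains_ball by blast
  obtain d where d: "d > 0" "\<And>y. norm (y - z) < d \<Longrightarrow> norm (G y - G z - G' (y - z)) \<le> e * norm (y - z)"
    using G' \<open>e > 0\<close> unfolding has_derivative_at_alt by blast
  \<comment> \<open>For t below this radius the parallelogram spanned by t u and t v at z stays in S
    and in the range of the estimate for G; the 1 keeps the denominator positive.\<close>
  define \<rho> where "\<rho> = min r d / (norm u + norm v + 1)"
  have "\<rho> > 0" using r(1) d(1) by (simp add: \<rho>_def add_nonneg_pos)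
  moreover have "norm (f (z + t *\<^sub>R u + t *\<^sub>R v) - f (z + t *\<^sub>R u) - f (z + t *\<^sub>R v) + f z - t\<^sup>2 *\<^sub>R G' v)
      \<le> t\<^sup>2 * (e * (2 * norm u + norm v))" if t: "0 < t" "t < \<rho>" for t
  proof -
    have "t * (norm u + norm v + 1) < min r d"
      using t(2) unfolding \<rho>_def by (simp add: pos_less_divide_eq add_nonneg_pos)
    then have tb: "t * norm u + t * norm v < min r d"
      using t(1) by (simp add: algebra_simps)
    have nb: "norm (s *\<^sub>R u + q *\<^sub>R v) \<le> s * norm u + q * norm v"
      "norm (s *\<^sub>R u + q *\<^sub>R v) < min r d"
      if s: "0 \<le> s" "s \<le> t" "0 \<le> q" "q \<le> t" for s q
    proof -
      show *: "norm (s *\<^sub>R u + q *\<^sub>R v) \<le> s * norm u + q * norm v"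
        using norm_triangle_ineq[of "s *\<^sub>R u" "q *\<^sub>R v"] s by simp
      have "s * norm u + q * norm v \<le> t * norm u + t * norm v"
        using s by (intro add_mono mult_right_mono) auto
      then show "norm (s *\<^sub>R u + q *\<^sub>R v) < min r d" using * tb by linarith
    qed
    have inS: "z + s *\<^sub>R u + q *\<^sub>R v \<in> S" if "0 \<le> s" "s \<le> t" "0 \<le> q" "q \<le> t" for s q
    proof -
      have "dist z (z + w) = norm w" for w by (simp add: dist_norm)
      then have "z + (s *\<^sub>R u + q *\<^sub>R v) \<in> ball z r"
        using nb(2)[OF that] unfolding mem_ball by simp
      then show ?thesis using r(2) by (auto simp: add.assoc)
    qed
    \<comment> \<open>The difference along t v as a function of the step s along u, minus its
      expected value s t G' v. Its derivative is small on [0, t], so the mean value inequality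
      applies. The summand 0 v lets both terms use the same differentiation rule, with q = t and q =
      0.\<close>
    define \<psi> where "\<psi> s = f (z + s *\<^sub>R u + t *\<^sub>R v) - f (z + s *\<^sub>R u + 0 *\<^sub>R v) - s *\<^sub>R (t *\<^sub>R G' v)" for s
    \<comment> \<open>This is e times the sum of the bounds t|u| + t|v| and t|u| for the distances
      of the two points from z.\<close>
    define B where "B = e * (t * (2 * norm u + norm v))"
    have der: "(\<psi> has_derivative (\<lambda>h. h *\<^sub>R (G (z + s *\<^sub>R u + t *\<^sub>R v) - G (z + s *\<^sub>R u + 0 *\<^sub>R v) - t *\<^sub>R G' v)))
       (at s within {0..t})" if s: "s \<in> {0..t}" for s
    proof -
      have *: "((\<lambda>s. f (z + s *\<^sub>R u + q *\<^sub>R v)) has_derivative (\<lambda>h. h *\<^sub>R G (z + s *\<^sub>R u + q *\<^sub>R v))) (at s within {0..t})"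
        if q: "0 \<le> q" "q \<le> t" for q
      proof -
        have "((\<lambda>s. z + s *\<^sub>R u + q *\<^sub>R v) has_derivative (\<lambda>h. h *\<^sub>R u)) (at s within {0..t})"
          by (auto intro!: derivative_eq_intros)
        moreover have df: "f differentiable (at (z + s *\<^sub>R u + q *\<^sub>R v))"
          using f inS s q by auto
        ultimately have "((\<lambda>s. f (z + s *\<^sub>R u + q *\<^sub>R v)) has_derivative
            (\<lambda>h. D f (z + s *\<^sub>R u + q *\<^sub>R v) (h *\<^sub>R u))) (at s within {0..t})"
          using has_derivative_compose[of "\<lambda>s. z + s *\<^sub>R u + q *\<^sub>R v" "\<lambda>h. h *\<^sub>R u" s "{0..t}" f]
            has_derivative_D[OF df] by blast
        then show ?thesis
          by (simp add: G_def linear_cmul[OF D_linear[OF df]])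
      qed
      have eq: "(\<lambda>h. h *\<^sub>R G (z + s *\<^sub>R u + t *\<^sub>R v) - h *\<^sub>R G (z + s *\<^sub>R u + 0 *\<^sub>R v) - h *\<^sub>R (t *\<^sub>R G' v))
        = (\<lambda>h. h *\<^sub>R (G (z + s *\<^sub>R u + t *\<^sub>R v) - G (z + s *\<^sub>R u + 0 *\<^sub>R v) - t *\<^sub>R G' v))"
        by (simp add: algebra_simps)
      show ?thesis
        unfolding \<psi>_def eq[symmetric]
        by (intro has_derivative_diff * has_derivative_scaleR_left has_derivative_ident) (use t in auto)
    qed
    have bound: "onorm (\<lambda>h. h *\<^sub>R (G (z + s *\<^sub>R u + t *\<^sub>R v) - G (z + s *\<^sub>R u + 0 *\<^sub>R v) - t *\<^sub>R G' v)) \<le> B"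
      if s: "s \<in> {0..t}" for s
    proof -
      let ?a = "s *\<^sub>R u + t *\<^sub>R v" and ?b = "s *\<^sub>R u + 0 *\<^sub>R v"
      have a: "norm (G (z + ?a) - G z - G' ?a) \<le> e * norm ?a"
        using d(2)[of "z + ?a"] nb(2)[of s t] s t by simp
      have b: "norm (G (z + ?b) - G z - G' ?b) \<le> e * norm ?b"
        using d(2)[of "z + ?b"] nb(2)[of s 0] s t by simp
      have "G' ?a - G' ?b = t *\<^sub>R G' v"
        by (simp add: linear_add[OF lin] linear_cmul[OF lin])
      then have "G (z + ?a) - G (z + ?b) - t *\<^sub>R G' v
          = (G (z + ?a) - G z - G' ?a) - (G (z + ?b) - G z - G' ?b)"
        by (simp add: algebra_simps)
      then have "norm (G (z + ?a) - G (z + ?b) - t *\<^sub>R G' v)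
          \<le> norm (G (z + ?a) - G z - G' ?a) + norm (G (z + ?b) - G z - G' ?b)"
        by (simp only: norm_triangle_ineq4)
      also have "\<dots> \<le> e * norm ?a + e * norm ?b"
        using a b by (rule add_mono)
      also have "\<dots> = e * (norm ?a + norm ?b)" by (simp add: algebra_simps)
      also have "\<dots> \<le> e * ((t * norm u + t * norm v) + t * norm u)"
      proof (intro mult_left_mono add_mono)
        show "norm ?a \<le> t * norm u + t * norm v"
          using nb(1)[of s t] s t mult_right_mono[of s t "norm u"] by auto
        show "norm ?b \<le> t * norm u"
          using s mult_right_mono[of s t "norm u"] by auto
      qed (use \<open>e > 0\<close> in auto)
      also have "\<dots> = B" by (simp add: B_def algebra_simps)
      finally have le: "norm (G (z + ?a) - G (z + ?b) - t *\<^sub>R G' v) \<le> B" .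
      then show ?thesis
        by (intro onorm_le) (auto simp: add.assoc[symmetric] mult.commute[of B] intro!: mult_left_mono)
    qed
    have "norm (\<psi> t - \<psi> 0) \<le> B * norm (t - 0)"
      by (rule differentiable_bound[OF _ der bound]) (use t in auto)
    moreover have "\<psi> t - \<psi> 0 = f (z + t *\<^sub>R u + t *\<^sub>R v) - f (z + t *\<^sub>R u) - f (z + t *\<^sub>R v) + f z - t\<^sup>2 *\<^sub>R G' v"
      by (simp add: \<psi>_def power2_eq_square)
    ultimately show ?thesis using t by (simp add: B_def power2_eq_square mult_ac)
  qed
  ultimately show ?thesis
    unfolding G'_def G_def by blast
qed

lemma second_derivative_symmetric:
  fixes f :: "'v::real_normed_vector \<Rightarrow> 'w::real_normed_vector"
  assumes S: "open S" "z \<in> S" and f: "\<And>y. y \<in> S \<Longrightarrow> f differentiable (at y)"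
    and u: "(\<lambda>y. D f y u) differentiable (at z)" and v: "(\<lambda>y. D f y v) differentiable (at z)"
  shows "D (\<lambda>y. D f y u) z v = D (\<lambda>y. D f y v) z u"
proof -
  let ?a = "D (\<lambda>y. D f y u) z v" and ?b = "D (\<lambda>y. D f y v) z u"
  \<comment> \<open>The weights of the two bounds, 2|u| + |v| and 2|v| + |u|, add up to 3|u| + 3|v|;
    the 1 makes N positive.\<close>
  define N where "N = 3 * norm u + 3 * norm v + 1"
  have N: "N > 0" by (simp add: N_def add_nonneg_pos)
  have "norm (?a - ?b) \<le> e" if e: "e > 0" for e
  proof -
    have e': "e / N > 0" using e N by simp
    obtain d1 where d1: "d1 > 0" "\<And>t. 0 < t \<and> t < d1 \<Longrightarrow>
      norm (f (z + t *\<^sub>R u + t *\<^sub>R v) - f (z + t *\<^sub>R u) - f (z + t *\<^sub>R v) + f z - t\<^sup>2 *\<^sub>R ?a) \<le> t\<^sup>2 * (e / N * (2 * norm u + norm v))"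
      using second_difference_bound[OF S e' f u, of v] by blast
    obtain d2 where d2: "d2 > 0" "\<And>t. 0 < t \<and> t < d2 \<Longrightarrow>
      norm (f (z + t *\<^sub>R v + t *\<^sub>R u) - f (z + t *\<^sub>R v) - f (z + t *\<^sub>R u) + f z - t\<^sup>2 *\<^sub>R ?b) \<le> t\<^sup>2 * (e / N * (2 * norm v + norm u))"
      using second_difference_bound[OF S e' f v, of u] by blast
    define t where "t = min d1 d2 / 2"
    have t: "0 < t" "t < d1" "t < d2" using d1(1) d2(1) by (auto simp: t_def)
    let ?\<Delta> = "f (z + t *\<^sub>R u + t *\<^sub>R v) - f (z + t *\<^sub>R u) - f (z + t *\<^sub>R v) + f z"
    have a: "norm (?\<Delta> - t\<^sup>2 *\<^sub>R ?a) \<le> t\<^sup>2 * (e / N * (2 * norm u + norm v))" using d1(2) t by blast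
    have b: "norm (?\<Delta> - t\<^sup>2 *\<^sub>R ?b) \<le> t\<^sup>2 * (e / N * (2 * norm v + norm u))"
      using d2(2)[of t] t by (simp add: algebra_simps)
    have "t\<^sup>2 * norm (?a - ?b) = norm ((?\<Delta> - t\<^sup>2 *\<^sub>R ?b) - (?\<Delta> - t\<^sup>2 *\<^sub>R ?a))"
      by (simp add: scaleR_diff_right[symmetric])
    also have "\<dots> \<le> t\<^sup>2 * (e / N * (2 * norm v + norm u)) + t\<^sup>2 * (e / N * (2 * norm u + norm v))"
      using norm_triangle_ineq4[of "?\<Delta> - t\<^sup>2 *\<^sub>R ?b" "?\<Delta> - t\<^sup>2 *\<^sub>R ?a"] a b by linarith
    also have "\<dots> = t\<^sup>2 * (e / N * (3 * norm u + 3 * norm v))" by (simp add: algebra_simps)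
    also have "\<dots> \<le> t\<^sup>2 * (e / N * N)"
      using e' by (intro mult_left_mono) (auto simp: N_def)
    finally show ?thesis using t N by simp
  qed
  then have "norm (?a - ?b) \<le> 0" using field_le_epsilon[of "norm (?a - ?b)" 0] by simp
  then show ?thesis by simp
qed

section \<open>Alternating forms at a point\<close>

lemma wedge_zero_left: "wedge (\<lambda>_. 0) \<beta> us = 0"
  by (induction us arbitrary: \<beta>) simp_all

lemma wedge_zero_right: "wedge \<alpha> (\<lambda>_. 0) us = 0"
  by (induction us arbitrary: \<alpha>) simp_all

lemma wedge_add_left: "wedge (\<lambda>ws. \<alpha> ws + \<alpha>' ws) \<beta> us = wedge \<alpha> \<beta> us + wedge \<alpha>' \<beta> us"
  by (induction us arbitrary: \<alpha> \<alpha>' \<beta>) (simp_all add: algebra_simps)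

lemma wedge_add_right: "wedge \<alpha> (\<lambda>ws. \<beta> ws + \<beta>' ws) us = wedge \<alpha> \<beta> us + wedge \<alpha> \<beta>' us"
  by (induction us arbitrary: \<alpha> \<beta> \<beta>') (simp_all add: algebra_simps)

lemma wedge_cmult_left: "wedge (\<lambda>ws. c * \<alpha> ws) \<beta> us = c * wedge \<alpha> \<beta> us"
proof (induction us arbitrary: \<alpha> \<beta>)
  case (Cons v us)
  have "(\<lambda>ws. (- 1) ^ length ws * (c * \<alpha> ws)) = (\<lambda>ws. c * ((- 1) ^ length ws * \<alpha> ws))"
    by (simp add: mult.left_commute)
  then show ?case by (simp add: Cons distrib_left)
qed simp

lemma wedge_cmult_right: "wedge \<alpha> (\<lambda>ws. c * \<beta> ws) us = c * wedge \<alpha> \<beta> us"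
  by (induction us arbitrary: \<alpha> \<beta>) (simp_all add: algebra_simps)

lemma wedge_uminus_left: "wedge (\<lambda>ws. - \<alpha> ws) \<beta> us = - wedge \<alpha> \<beta> us"
  using wedge_cmult_left[of "-1" \<alpha> \<beta> us] by simp

lemma wedge_uminus_right: "wedge \<alpha> (\<lambda>ws. - \<beta> ws) us = - wedge \<alpha> \<beta> us"
  using wedge_cmult_right[of \<alpha> "-1" \<beta> us] by simp

lemma wedge_diff_left: "wedge (\<lambda>ws. \<alpha> ws - \<alpha>' ws) \<beta> us = wedge \<alpha> \<beta> us - wedge \<alpha>' \<beta> us"
  using wedge_add_left[of \<alpha> "\<lambda>ws. - \<alpha>' ws" \<beta> us] by (simp add: wedge_uminus_left)

lemma wedge_diff_right: "wedge \<alpha> (\<lambda>ws. \<beta> ws - \<beta>' ws) us = wedge \<alpha> \<beta> us - wedge \<alpha> \<beta>' us"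
  using wedge_add_right[of \<alpha> \<beta> "\<lambda>ws. - \<beta>' ws" us] by (simp add: wedge_uminus_right)

lemma wedge_sum_left: "wedge (\<lambda>ws. \<Sum>i\<in>I. \<alpha> i ws) \<beta> us = (\<Sum>i\<in>I. wedge (\<alpha> i) \<beta> us)"
  by (induction I rule: infinite_finite_induct) (simp_all add: wedge_zero_left wedge_add_left)

lemma wedge_sum_right: "wedge \<alpha> (\<lambda>ws. \<Sum>i\<in>I. \<beta> i ws) us = (\<Sum>i\<in>I. wedge \<alpha> (\<beta> i) us)"
  by (induction I rule: infinite_finite_induct) (simp_all add: wedge_zero_right wedge_add_right)

text \<open>The grading involution. It is the sign picked up when an argument passes the left
  factor, and contraction with a vector is an antiderivation relative to it
  (\<open>wedge_Cons\<close>).\<close>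

definition sgn_form :: "'n cform \<Rightarrow> 'n cform" where
  "sgn_form \<alpha> us = (- 1) ^ length us * \<alpha> us"

lemma sgn_form_sgn_form [simp]: "sgn_form (sgn_form \<alpha>) = \<alpha>"
  by (simp add: sgn_form_def fun_eq_iff mult.assoc[symmetric] flip: power_mult_distrib)

lemma sgn_form_Cons: "(\<lambda>ws. sgn_form \<alpha> (v # ws)) = (\<lambda>ws. - sgn_form (\<lambda>ws. \<alpha> (v # ws)) ws)"
  by (simp add: sgn_form_def fun_eq_iff)

lemma wedge_Cons:
  "wedge \<alpha> \<beta> (v # us) = wedge (\<lambda>ws. \<alpha> (v # ws)) \<beta> us + wedge (sgn_form \<alpha>) (\<lambda>ws. \<beta> (v # ws)) us"
  by (simp add: sgn_form_def[abs_def])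

declare wedge.simps(2) [simp del]

lemma wedge_sgn_form: "wedge (sgn_form \<alpha>) (sgn_form \<beta>) us = sgn_form (wedge \<alpha> \<beta>) us"
proof (induction us arbitrary: \<alpha> \<beta>)
  case (Cons v us)
  show ?case
    unfolding wedge_Cons sgn_form_Cons sgn_form_sgn_form wedge_uminus_left wedge_uminus_right
    using Cons[of "\<lambda>ws. \<alpha> (v # ws)" \<beta>] Cons[of "sgn_form \<alpha>" "\<lambda>ws. \<beta> (v # ws)"]
    by (simp add: wedge_Cons sgn_form_def[of _ "v # us"] sgn_form_def[of _ us] algebra_simps)
qed (simp add: sgn_form_def)

text \<open>Contraction with the first argument is an antiderivation on both sides, and the signs
  match because \<open>sgn_form\<close> is multiplicative (\<open>wedge_sgn_form\<close>).\<close>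

lemma wedge_assoc: "wedge (wedge \<alpha> \<beta>) \<gamma> us = wedge \<alpha> (wedge \<beta> \<gamma>) us"
proof (induction us arbitrary: \<alpha> \<beta> \<gamma>)
  case (Cons v us)
  have "sgn_form (wedge \<alpha> \<beta>) = wedge (sgn_form \<alpha>) (sgn_form \<beta>)"
    by (intro ext) (simp add: wedge_sgn_form)
  then show ?case
    by (simp add: wedge_Cons wedge_add_left wedge_add_right Cons)
qed simp

lemma sgn_form_scalar: "sgn_form (\<lambda>ws. if ws = [] then c else 0) = (\<lambda>ws. if ws = [] then c else 0)"
  by (auto simp: sgn_form_def fun_eq_iff)

lemma wedge_scalar_left: "wedge (\<lambda>ws. if ws = [] then c else 0) \<beta> us = c * \<beta> us"
  by (induction us arbitrary: \<beta>) (simp_all add: wedge_Cons wedge_zero_left sgn_form_scalar)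

lemma wedge_scalar_right: "wedge \<beta> (\<lambda>ws. if ws = [] then c else 0) us = \<beta> us * c"
  by (induction us arbitrary: \<beta>) (simp_all add: wedge_Cons wedge_zero_right)

lemma wedge_degree:
  assumes "\<And>us. length us \<noteq> k \<Longrightarrow> \<alpha> us = 0" "\<And>us. length us \<noteq> l \<Longrightarrow> \<beta> us = 0" "length us \<noteq> k + l"
  shows "wedge \<alpha> \<beta> us = 0"
  using assms
proof (induction us arbitrary: \<alpha> \<beta> k l)
  case Nil
  then show ?case by (cases k) auto
next
  case (Cons v us)
  have "wedge (\<lambda>ws. \<alpha> (v # ws)) \<beta> us = 0"
  proof (cases k)
    case 0
    then have "(\<lambda>ws. \<alpha> (v # ws)) = (\<lambda>_. 0)" using Cons.prems(1) by (intro ext) simp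
    then show ?thesis by (simp only: wedge_zero_left)
  next
    case (Suc k')
    show ?thesis
      by (rule Cons.IH[of k' _ l]) (use Cons.prems Suc in auto)
  qed
  moreover have "wedge (sgn_form \<alpha>) (\<lambda>ws. \<beta> (v # ws)) us = 0"
  proof (cases l)
    case 0
    then have "(\<lambda>ws. \<beta> (v # ws)) = (\<lambda>_. 0)" using Cons.prems(2) by (intro ext) simp
    then show ?thesis by (simp only: wedge_zero_right)
  next
    case (Suc l')
    show ?thesis
      by (rule Cons.IH[of k _ l']) (use Cons.prems Suc in \<open>auto simp: sgn_form_def\<close>)
  qed
  ultimately show ?case unfolding wedge_Cons by simp
qed

lemma wedge_map: "wedge (\<lambda>ws. \<alpha> (map f ws)) (\<lambda>ws. \<beta> (map f ws)) us = wedge \<alpha> \<beta> (map f us)"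
proof (induction us arbitrary: \<alpha> \<beta>)
  case (Cons v us)
  have "sgn_form (\<lambda>ws. \<alpha> (map f ws)) = (\<lambda>ws. sgn_form \<alpha> (map f ws))"
    by (simp add: sgn_form_def fun_eq_iff)
  then show ?case
    using Cons[of "\<lambda>ws. \<alpha> (f v # ws)" \<beta>] Cons[of "sgn_form \<alpha>" "\<lambda>ws. \<beta> (f v # ws)"]
    by (simp add: wedge_Cons)
qed simp

section \<open>Alternating forms\<close>

lemma alternating_linear: "alternating \<alpha> \<Longrightarrow> linear (\<lambda>v. \<alpha> (us @ v # ws))"
  by (simp add: alternating_def)

lemma alternating_linear_hd: "alternating \<alpha> \<Longrightarrow> linear (\<lambda>v. \<alpha> (v # ws))"
  using alternating_linear[of \<alpha> "[]"] by simp

lemma alternating_not_distinct: "alternating \<alpha> \<Longrightarrow> \<not> distinct us \<Longrightarrow> \<alpha> us = 0"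
  by (simp add: alternating_def)

text \<open>Polarising on v + w turns vanishing on equal neighbours into antisymmetry under
  neighbour swaps, and swaps bring two equal arguments next to each other.\<close>

lemma alternatingI:
  assumes lin: "\<And>us ws. linear (\<lambda>v. \<alpha> (us @ v # ws))"
    and alt: "\<And>us v ws. \<alpha> (us @ v # v # ws) = 0"
  shows "alternating \<alpha>"
proof -
  have swap: "\<alpha> (us @ v # w # ws) = - \<alpha> (us @ w # v # ws)" for us v w ws
  proof -
    have "0 = \<alpha> (us @ (v + w) # (v + w) # ws)" by (simp add: alt)
    also have "\<dots> = \<alpha> (us @ v # (v + w) # ws) + \<alpha> (us @ w # (v + w) # ws)"
      using linear_add[OF lin[of us "(v + w) # ws"]] by simp
    also have "\<dots> = \<alpha> (us @ v # w # ws) + \<alpha> (us @ w # v # ws)"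
      using linear_add[OF lin[of "us @ [v]" ws], of v w] linear_add[OF lin[of "us @ [w]" ws], of v w]
      by (simp add: alt)
    finally show ?thesis by (simp add: eq_neg_iff_add_eq_0)
  qed
  have rep: "\<alpha> (us @ v # xs @ v # ws) = 0" for us v xs ws
  proof (induction xs arbitrary: us)
    case (Cons x xs)
    have "\<alpha> (us @ v # x # xs @ v # ws) = - \<alpha> ((us @ [x]) @ v # xs @ v # ws)"
      using swap[of us v x] by simp
    then show ?case using Cons[of "us @ [x]"] by simp
  qed (simp add: alt)
  show ?thesis
    unfolding alternating_def
  proof (intro conjI allI impI)
    fix us :: "(complex^'a) list" assume "\<not> distinct us"
    then obtain xs v ys zs where "us = xs @ v # ys @ v # zs"
      using not_distinct_decomp[of us] by auto
    then show "\<alpha> us = 0" using rep by simp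
  qed (rule lin)
qed

lemma alternating_Cons:
  assumes "alternating \<alpha>"
  shows "alternating (\<lambda>ws. \<alpha> (v # ws))"
proof (rule alternatingI)
  show "linear (\<lambda>w. \<alpha> (v # us @ w # ws))" for us ws
    using alternating_linear[OF assms, of "v # us" ws] by simp
qed (simp add: alternating_not_distinct[OF assms])

lemma alternating_swap: "alternating \<alpha> \<Longrightarrow> \<alpha> (v # w # us) = - \<alpha> (w # v # us)"
proof -
  assume a: "alternating \<alpha>"
  have "0 = \<alpha> ((v + w) # (v + w) # us)" by (simp add: alternating_not_distinct[OF a])
  also have "\<dots> = \<alpha> (v # (v + w) # us) + \<alpha> (w # (v + w) # us)"
    using linear_add[OF alternating_linear_hd[OF a]] by simp
  also have "\<dots> = \<alpha> (v # w # us) + \<alpha> (w # v # us)"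
    using linear_add[OF alternating_linear_hd[OF alternating_Cons[OF a]]]
    by (simp add: alternating_not_distinct[OF a])
  finally show ?thesis by (simp add: eq_neg_iff_add_eq_0)
qed

lemma alternating_zero: "alternating (\<lambda>_. 0)"
  by (simp add: alternating_def linear_zero)

lemma alternating_add: "alternating \<alpha> \<Longrightarrow> alternating \<beta> \<Longrightarrow> alternating (\<lambda>us. \<alpha> us + \<beta> us)"
  by (simp add: alternating_def linear_compose_add)

lemma linear_cmult: "linear f \<Longrightarrow> linear (\<lambda>v. c * f v)" for f :: "'v::real_vector \<Rightarrow> complex"
  by (simp add: linear_iff algebra_simps)

lemma alternating_cmult: "alternating \<alpha> \<Longrightarrow> alternating (\<lambda>us. c * \<alpha> us)"
  by (simp add: alternating_def linear_cmult)

lemma alternating_sum: "(\<And>i. i \<in> I \<Longrightarrow> alternating (\<alpha> i)) \<Longrightarrow> alternating (\<lambda>us. \<Sum>i\<in>I. \<alpha> i us)"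
  by (induction I rule: infinite_finite_induct) (simp_all add: alternating_zero alternating_add)

lemma alternating_sgn_form: "alternating \<alpha> \<Longrightarrow> alternating (sgn_form \<alpha>)"
  unfolding alternating_def
proof (intro conjI allI impI, goal_cases)
  case (1 us ws)
  have "(\<lambda>v. sgn_form \<alpha> (us @ v # ws)) = (\<lambda>v. (- 1) ^ Suc (length us + length ws) * \<alpha> (us @ v # ws))"
    by (simp add: sgn_form_def)
  then show ?case using linear_cmult[OF 1[THEN conjunct1, rule_format]] by (simp del: power_Suc)
qed (simp add: sgn_form_def)

lemma alternating_wedge:
  assumes "alternating \<alpha>" "alternating \<beta>"
  shows "alternating (wedge \<alpha> \<beta>)"
proof (rule alternatingI)
  show "linear (\<lambda>v. wedge \<alpha> \<beta> (us @ v # ws))" for us ws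
    using assms
  proof (induction us arbitrary: \<alpha> \<beta>)
    case Nil
    have add: "\<alpha> ((v + w) # ws) = \<alpha> (v # ws) + \<alpha> (w # ws)" "\<beta> ((v + w) # ws) = \<beta> (v # ws) + \<beta> (w # ws)" for v w ws
      using linear_add[OF alternating_linear_hd] Nil by blast+
    have scale: "\<alpha> (r *\<^sub>R v # ws) = of_real r * \<alpha> (v # ws)" "\<beta> (r *\<^sub>R v # ws) = of_real r * \<beta> (v # ws)" for r v ws
      using linear_cmul[OF alternating_linear_hd[OF Nil(1)]] linear_cmul[OF alternating_linear_hd[OF Nil(2)]]
      by (simp_all add: scaleR_conv_of_real)
    have conv: "r *\<^sub>R x = of_real r * x" for r and x :: complex
      by (rule scaleR_conv_of_real)
    show ?case
      by (rule linearI) (simp_all add: wedge_Cons add scale wedge_add_left wedge_add_right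
          wedge_cmult_left wedge_cmult_right conv algebra_simps)
  next
    case (Cons x us)
    then show ?case
      by (simp add: wedge_Cons alternating_Cons alternating_sgn_form linear_compose_add)
  qed
  show "wedge \<alpha> \<beta> (us @ v # v # ws) = 0" for us v ws
    using assms
  proof (induction us arbitrary: \<alpha> \<beta>)
    case Nil
    \<comment> \<open>Both copies of v in the same factor give zero; the two terms with one copy in
      each factor cancel by the sign of \<open>sgn_form_Cons\<close>.\<close>
    have "\<alpha> (v # v # ws) = 0" "\<beta> (v # v # ws) = 0" for ws
      using Nil by (simp_all add: alternating_not_distinct)
    then show ?case
      by (simp add: wedge_Cons wedge_zero_left wedge_zero_right sgn_form_Cons wedge_uminus_left)
  next
    case (Cons x us)
    then show ?case
      by (simp add: wedge_Cons alternating_Cons alternating_sgn_form)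
  qed
qed

lemma alternating_covector:
  assumes "linear l"
  shows "alternating (covector l)"
proof (rule alternatingI)
  show "linear (\<lambda>v. covector l (us @ v # ws))" for us ws
  proof (cases "us = [] \<and> ws = []")
    case True
    then show ?thesis using assms by (simp add: covector_def)
  next
    case False
    then have "covector l (us @ v # ws) = 0" for v
      by (cases us; cases ws) (auto simp: covector_def split: list.splits)
    then show ?thesis by (simp add: linear_zero)
  qed
  show "covector l (us @ v # v # ws) = 0" for us v ws
    by (cases us) (auto simp: covector_def split: list.splits)
qed

lemma alternating_scalar: "alternating (\<lambda>us. if us = [] then c else 0)"
  by (rule alternatingI) (simp_all add: linear_zero)

lemma alternating_map:
  assumes "alternating \<alpha>" "linear f"
  shows "alternating (\<lambda>us. \<alpha> (map f us))"
proof (rule alternatingI)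
  show "linear (\<lambda>v. \<alpha> (map f (us @ v # ws)))" for us ws
    using linear_compose[OF assms(2) alternating_linear[OF assms(1), of "map f us" "map f ws"]]
    by (simp add: o_def)
qed (simp add: alternating_not_distinct[OF assms(1)])

text \<open>The prefix ps collects the arguments already replaced by basis vectors, so that the
  induction can treat one argument at a time.\<close>

lemma multilinear_expand:
  fixes \<alpha> :: "'n::finite cform"
  assumes lin: "\<And>us ws. linear (\<lambda>v. \<alpha> (us @ v # ws))"
    and zero: "\<And>us. length us = k \<Longrightarrow> set us \<subseteq> Basis \<Longrightarrow> \<alpha> (ps @ us) = 0"
    and "length us = k"
  shows "\<alpha> (ps @ us) = 0"
  using zero assms(3)
proof (induction k arbitrary: ps us)
  case (Suc k)
  then obtain v vs where us: "us = v # vs" "length vs = k" by (cases us) auto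
  have "\<alpha> (ps @ b # vs) = 0" if "b \<in> Basis" for b
  proof -
    have "\<alpha> ((ps @ [b]) @ vs) = 0"
      by (rule Suc.IH) (use that us Suc.prems(1)[of "b # _"] in auto)
    then show ?thesis by simp
  qed
  then show ?case
    using linear_eq_0_on_span[OF lin[of ps vs], of Basis v] us by (simp add: span_Basis)
qed auto

text \<open>Multilinearity reduces to real basis vectors, and a list of these longer than the real
  dimension has a repetition.\<close>

lemma alternating_degree_bound:
  fixes \<alpha> :: "'n::finite cform"
  assumes "alternating \<alpha>" "length us > DIM(complex^'n)"
  shows "\<alpha> us = 0"
proof -
  have "\<alpha> ([] @ us) = 0"
  proof (rule multilinear_expand[OF alternating_linear[OF assms(1)], of "length us"])
    fix ws :: "(complex^'n) list" assume ws: "length ws = length us" "set ws \<subseteq> Basis"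
    have "card (set ws) \<le> DIM(complex^'n)" using card_mono[OF finite_Basis ws(2)] .
    then have "\<not> distinct ws" using distinct_card[of ws] ws(1) assms(2) by auto
    then show "\<alpha> ([] @ ws) = 0" by (simp add: alternating_not_distinct[OF assms(1)])
  qed simp
  then show ?thesis by simp
qed

subsection \<open>Contraction with a matrix and its exponential\<close>

text \<open>Interior product with the (1,0)-vector whose components are \<open>bel M v $ j\<close>,
  that is with the value of the Beltrami differential on v, through the complex linear extension of
  the form.\<close>

definition contract_bel :: "complex^'n::finite^'n \<Rightarrow> complex^'n \<Rightarrow> 'n cform \<Rightarrow> 'n cform" where
  "contract_bel M v \<alpha> us = (\<Sum>j\<in>UNIV. bel M v $ j * contract_dz j \<alpha> us)"

text \<open>\<open>contract_rec M\<close> agrees with \<^term>\<open>contract_matrix M\<close> on alternating forms, and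
  \<open>contract_exp M\<close> is its exponential: it substitutes \<open>v + (bel M v)\<^sup>1\<^sup>,\<^sup>0\<close> for every argument \<open>v\<close>.\<close>

primrec contract_rec :: "complex^'n::finite^'n \<Rightarrow> 'n cform \<Rightarrow> 'n cform" where
  "contract_rec M \<alpha> [] = 0"
| "contract_rec M \<alpha> (v # us) = contract_bel M v \<alpha> us + contract_rec M (\<lambda>ws. \<alpha> (v # ws)) us"

primrec contract_exp :: "complex^'n::finite^'n \<Rightarrow> 'n cform \<Rightarrow> 'n cform" where
  "contract_exp M \<alpha> [] = \<alpha> []"
| "contract_exp M \<alpha> (v # us) = contract_exp M (\<lambda>ws. \<alpha> (v # ws) + contract_bel M v \<alpha> ws) us"

lemma bel_nth: "bel M v $ i = (\<Sum>j\<in>UNIV. M $ i $ j * cnj (v $ j))"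
  by (simp add: bel_def matrix_vector_mult_def)

lemma bel_add: "bel M (v + w) = bel M v + bel M w"
  by (simp add: vec_eq_iff bel_nth algebra_simps sum.distrib)

lemma bel_smult: "bel M (c *s v) = cnj c *s bel M v"
  by (simp add: vec_eq_iff bel_nth sum_distrib_left algebra_simps)

lemma bel_scaleR: "bel M (r *\<^sub>R v) = r *\<^sub>R bel M v"
  by (simp add: vec_eq_iff bel_nth scaleR_sum_right)

lemma bel_uminus: "bel (- M) v = - bel M v"
  by (simp add: vec_eq_iff bel_nth sum_negf)

lemma axis_smult: "c *s axis i 1 = (axis i c :: complex^'n::finite)"
  by (simp add: vec_eq_iff axis_def)

lemma axis_nth': "axis j c $ i = (if i = j then c else 0)"
  by (simp add: axis_def)

lemma bel_axis: "bel M (axis i \<i>) = - \<i> *s bel M (axis i 1)"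
  using bel_smult[of M \<i> "axis i 1"] by (simp add: axis_smult)

lemma contract_dz_add: "contract_dz j (\<lambda>ws. \<alpha> ws + \<beta> ws) us = contract_dz j \<alpha> us + contract_dz j \<beta> us"
  by (simp add: contract_dz_def algebra_simps add_divide_distrib diff_divide_distrib)

lemma contract_dz_cmult: "contract_dz j (\<lambda>ws. c * \<alpha> ws) us = c * contract_dz j \<alpha> us"
  by (simp add: contract_dz_def algebra_simps)

lemma contract_dz_zero: "contract_dz j (\<lambda>ws. 0) us = 0"
  by (simp add: contract_dz_def)

lemma contract_dz_sum: "contract_dz j (\<lambda>ws. \<Sum>i\<in>I. \<alpha> i ws) us = (\<Sum>i\<in>I. contract_dz j (\<alpha> i) us)"
  by (induction I rule: infinite_finite_induct) (simp_all add: contract_dz_add contract_dz_zero)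

lemma contract_bel_add: "contract_bel M v (\<lambda>ws. \<alpha> ws + \<beta> ws) us = contract_bel M v \<alpha> us + contract_bel M v \<beta> us"
  by (simp add: contract_bel_def contract_dz_add sum.distrib algebra_simps)

lemma contract_bel_cmult: "contract_bel M v (\<lambda>ws. c * \<alpha> ws) us = c * contract_bel M v \<alpha> us"
  by (simp add: contract_bel_def contract_dz_cmult sum_distrib_left algebra_simps)

lemma contract_bel_axis: "contract_bel M (axis i \<i>) \<alpha> us = - \<i> * contract_bel M (axis i 1) \<alpha> us"
  unfolding contract_bel_def bel_axis by (simp add: sum_distrib_left sum_negf algebra_simps)

lemma contract_rec_add: "contract_rec M (\<lambda>ws. \<alpha> ws + \<beta> ws) us = contract_rec M \<alpha> us + contract_rec M \<beta> us"
  by (induction us arbitrary: \<alpha> \<beta>) (simp_all add: contract_bel_add)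

lemma contract_rec_cmult: "contract_rec M (\<lambda>ws. c * \<alpha> ws) us = c * contract_rec M \<alpha> us"
  by (induction us arbitrary: \<alpha>) (simp_all add: contract_bel_cmult algebra_simps)

lemma contract_rec_zero: "contract_rec M (\<lambda>ws. 0) us = 0"
  using contract_rec_cmult[of M 0 "\<lambda>_. 0" us] by simp

lemma contract_rec_sum: "contract_rec M (\<lambda>ws. \<Sum>i\<in>I. \<alpha> i ws) us = (\<Sum>i\<in>I. contract_rec M (\<alpha> i) us)"
  by (induction I rule: infinite_finite_induct) (simp_all add: contract_rec_add contract_rec_zero)

lemma contract_exp_add: "contract_exp M (\<lambda>ws. \<alpha> ws + \<beta> ws) us = contract_exp M \<alpha> us + contract_exp M \<beta> us"
proof (induction us arbitrary: \<alpha> \<beta>)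
  case (Cons v us)
  have "(\<lambda>ws. \<alpha> (v # ws) + \<beta> (v # ws) + contract_bel M v (\<lambda>ws. \<alpha> ws + \<beta> ws) ws)
      = (\<lambda>ws. (\<alpha> (v # ws) + contract_bel M v \<alpha> ws) + (\<beta> (v # ws) + contract_bel M v \<beta> ws))"
    by (simp add: contract_bel_add algebra_simps)
  then show ?case by (simp only: contract_exp.simps Cons)
qed simp

lemma contract_exp_cmult: "contract_exp M (\<lambda>ws. c * \<alpha> ws) us = c * contract_exp M \<alpha> us"
proof (induction us arbitrary: \<alpha>)
  case (Cons v us)
  have "(\<lambda>ws. c * \<alpha> (v # ws) + contract_bel M v (\<lambda>ws. c * \<alpha> ws) ws)
      = (\<lambda>ws. c * (\<alpha> (v # ws) + contract_bel M v \<alpha> ws))"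
    by (simp add: contract_bel_cmult algebra_simps)
  then show ?case by (simp only: contract_exp.simps Cons)
qed simp

lemma contract_exp_zero: "contract_exp M (\<lambda>ws. 0) us = 0"
  using contract_exp_cmult[of M 0 "\<lambda>_. 0" us] by simp

lemma contract_exp_sum: "contract_exp M (\<lambda>ws. \<Sum>i\<in>I. \<alpha> i ws) us = (\<Sum>i\<in>I. contract_exp M (\<alpha> i) us)"
  by (induction I rule: infinite_finite_induct) (simp_all add: contract_exp_add contract_exp_zero)

lemma contract_rec_contract_dz_expand:
  "contract_rec M (contract_dz j \<alpha>) us
    = (contract_rec M (\<lambda>ws. \<alpha> (axis j 1 # ws)) us - \<i> * contract_rec M (\<lambda>ws. \<alpha> (axis j \<i> # ws)) us) / 2"
proof -
  have "contract_dz j \<alpha> = (\<lambda>ws. (1/2) * \<alpha> (axis j 1 # ws) + (- \<i> / 2) * \<alpha> (axis j \<i> # ws))"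
    by (simp add: contract_dz_def fun_eq_iff field_simps)
  then show ?thesis by (simp only: contract_rec_add contract_rec_cmult) (simp add: field_simps)
qed

lemma contract_exp_contract_dz_expand:
  "contract_exp M (contract_dz j \<alpha>) us
    = (contract_exp M (\<lambda>ws. \<alpha> (axis j 1 # ws)) us - \<i> * contract_exp M (\<lambda>ws. \<alpha> (axis j \<i> # ws)) us) / 2"
proof -
  have "contract_dz j \<alpha> = (\<lambda>ws. (1/2) * \<alpha> (axis j 1 # ws) + (- \<i> / 2) * \<alpha> (axis j \<i> # ws))"
    by (simp add: contract_dz_def fun_eq_iff field_simps)
  then show ?thesis by (simp only: contract_exp_add contract_exp_cmult) (simp add: field_simps)
qed

text \<open>An additional first argument w contributes a term \<open>contract_bel M w\<close>. In
  the combination defining \<open>contract_dz\<close> the two such terms cancel, because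
  \<open>bel M\<close> is conjugate linear: M kills (1,0)-vectors.\<close>

lemma contract_dz_contract_rec: "contract_dz j (contract_rec M \<alpha>) us = contract_rec M (contract_dz j \<alpha>) us"
  unfolding contract_rec_contract_dz_expand
  by (simp add: contract_dz_def[of j "contract_rec M \<alpha>"] contract_bel_axis algebra_simps)

lemma contract_dz_contract_exp: "contract_dz j (contract_exp M \<alpha>) us = contract_exp M (contract_dz j \<alpha>) us"
proof -
  have "contract_exp M (contract_bel M (axis j \<i>) \<alpha>) us = - \<i> * contract_exp M (contract_bel M (axis j 1) \<alpha>) us"
    unfolding contract_exp_cmult[symmetric] by (simp add: contract_bel_axis[abs_def])
  then show ?thesis
    unfolding contract_exp_contract_dz_expand
    by (simp add: contract_dz_def[of j "contract_exp M \<alpha>"] contract_exp_add algebra_simps)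
qed

lemma contract_bel_contract_rec: "contract_bel M v (contract_rec N \<alpha>) us = contract_rec N (contract_bel M v \<alpha>) us"
  by (simp add: contract_bel_def[abs_def] contract_dz_contract_rec contract_rec_sum contract_rec_cmult)

lemma contract_bel_contract_exp: "contract_bel M v (contract_exp N \<alpha>) us = contract_exp N (contract_bel M v \<alpha>) us"
  by (simp add: contract_bel_def[abs_def] contract_dz_contract_exp contract_exp_sum contract_exp_cmult)

lemma contract_dz_wedge:
  "contract_dz j (wedge \<alpha> \<beta>) us = wedge (contract_dz j \<alpha>) \<beta> us + wedge (sgn_form \<alpha>) (contract_dz j \<beta>) us"
proof -
  have c: "contract_dz j \<gamma> = (\<lambda>ws. (1/2) * \<gamma> (axis j 1 # ws) + (- \<i> / 2) * \<gamma> (axis j \<i> # ws))" for \<gamma>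
    by (simp add: contract_dz_def fun_eq_iff field_simps)
  show ?thesis
    unfolding c wedge_add_left wedge_add_right wedge_cmult_left wedge_cmult_right wedge_Cons
    by (simp add: algebra_simps)
qed

lemma contract_bel_wedge:
  "contract_bel M v (wedge \<alpha> \<beta>) us = wedge (contract_bel M v \<alpha>) \<beta> us + wedge (sgn_form \<alpha>) (contract_bel M v \<beta>) us"
  by (simp add: contract_bel_def[abs_def] contract_dz_wedge wedge_sum_left wedge_sum_right
      wedge_cmult_left wedge_cmult_right sum.distrib distrib_left)

lemma contract_dz_sgn_form: "contract_dz j (sgn_form \<alpha>) us = - sgn_form (contract_dz j \<alpha>) us"
  by (simp add: contract_dz_def sgn_form_def field_simps)

lemma contract_bel_sgn_form: "contract_bel M v (sgn_form \<alpha>) us = - sgn_form (contract_bel M v \<alpha>) us"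
  by (simp add: contract_bel_def contract_dz_sgn_form sum_negf sgn_form_def sum_distrib_left mult.left_commute)

lemma contract_rec_uminus: "contract_rec M (\<lambda>ws. - \<alpha> ws) us = - contract_rec M \<alpha> us"
  using contract_rec_cmult[of M "-1" \<alpha> us] by simp

lemma contract_exp_uminus: "contract_exp M (\<lambda>ws. - \<alpha> ws) us = - contract_exp M \<alpha> us"
  using contract_exp_cmult[of M "-1" \<alpha> us] by simp

lemma contract_rec_sgn_form: "contract_rec M (sgn_form \<alpha>) us = sgn_form (contract_rec M \<alpha>) us"
proof (induction us arbitrary: \<alpha>)
  case (Cons v us)
  show ?case
    by (simp add: sgn_form_Cons contract_rec_uminus Cons contract_bel_sgn_form)
      (simp add: sgn_form_def algebra_simps)
qed (simp add: sgn_form_def)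

lemma contract_exp_sgn_form: "contract_exp M (sgn_form \<alpha>) us = sgn_form (contract_exp M \<alpha>) us"
proof (induction us arbitrary: \<alpha>)
  case (Cons v us)
  have "(\<lambda>ws. sgn_form \<alpha> (v # ws) + contract_bel M v (sgn_form \<alpha>) ws)
    = (\<lambda>ws. - sgn_form (\<lambda>ws. \<alpha> (v # ws) + contract_bel M v \<alpha> ws) ws)"
    by (simp add: contract_bel_sgn_form fun_eq_iff) (simp add: sgn_form_def algebra_simps)
  then have "contract_exp M (sgn_form \<alpha>) (v # us)
      = - sgn_form (contract_exp M (\<lambda>ws. \<alpha> (v # ws) + contract_bel M v \<alpha> ws)) us"
    by (simp only: contract_exp.simps contract_exp_uminus Cons)
  also have "\<dots> = sgn_form (contract_exp M \<alpha>) (v # us)" by (simp add: sgn_form_def)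
  finally show ?case .
qed (simp add: sgn_form_def)

text \<open>No sign appears: wedging with a (0,1)-form and contracting have degrees 1 and -1, so
  together they form a derivation of degree 0.\<close>

lemma contract_rec_wedge:
  "contract_rec M (wedge \<alpha> \<beta>) us = wedge (contract_rec M \<alpha>) \<beta> us + wedge \<alpha> (contract_rec M \<beta>) us"
proof (induction us arbitrary: \<alpha> \<beta>)
  case (Cons v us)
  have "contract_rec M (sgn_form \<alpha>) = sgn_form (contract_rec M \<alpha>)"
    by (intro ext) (rule contract_rec_sgn_form)
  then show ?case
    by (simp add: wedge_Cons contract_bel_wedge contract_rec_add Cons wedge_add_left wedge_add_right)
qed simp

text \<open>The substitution acts on all arguments alike, so it passes through every shuffle. This
  makes the exponential an algebra homomorphism, whence P is a derivation.\<close>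

lemma contract_exp_wedge: "contract_exp M (wedge \<alpha> \<beta>) us = wedge (contract_exp M \<alpha>) (contract_exp M \<beta>) us"
proof (induction us arbitrary: \<alpha> \<beta>)
  case (Cons v us)
  have sgn: "contract_exp M (sgn_form \<alpha>) = sgn_form (contract_exp M \<alpha>)"
    by (intro ext) (rule contract_exp_sgn_form)
  let ?\<alpha> = "\<lambda>ws. \<alpha> (v # ws) + contract_bel M v \<alpha> ws" and ?\<beta> = "\<lambda>ws. \<beta> (v # ws) + contract_bel M v \<beta> ws"
  have eq: "(\<lambda>ws. wedge \<alpha> \<beta> (v # ws) + contract_bel M v (wedge \<alpha> \<beta>) ws)
    = (\<lambda>ws. wedge (\<lambda>ws. \<alpha> (v # ws) + contract_bel M v \<alpha> ws) \<beta> ws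
          + wedge (sgn_form \<alpha>) (\<lambda>ws. \<beta> (v # ws) + contract_bel M v \<beta> ws) ws)"
    by (simp add: wedge_Cons contract_bel_wedge wedge_add_left wedge_add_right algebra_simps)
  show ?case
  proof -
    have "contract_exp M (wedge \<alpha> \<beta>) (v # us) = contract_exp M (\<lambda>ws. wedge ?\<alpha> \<beta> ws + wedge (sgn_form \<alpha>) ?\<beta> ws) us"
      by (simp only: contract_exp.simps eq)
    also have "\<dots> = wedge (contract_exp M ?\<alpha>) (contract_exp M \<beta>) us + wedge (sgn_form (contract_exp M \<alpha>)) (contract_exp M ?\<beta>) us"
      by (simp only: contract_exp_add[of M "wedge ?\<alpha> \<beta>" "wedge (sgn_form \<alpha>) ?\<beta>"] Cons sgn)
    finally show ?thesis by (simp add: wedge_Cons)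
  qed
qed simp

lemma contract_exp_scalar: "contract_exp M (\<lambda>ws. if ws = [] then c else 0) us = (if us = [] then c else 0)"
  by (cases us) (simp_all add: contract_bel_def contract_dz_def contract_exp_zero)

text \<open>\<open>bel M\<close> shifts the arguments only by (1,0)-vectors, on which -M vanishes
  (\<open>contract_bel_contract_exp\<close>), so the two shifts add up to zero.\<close>

lemma contract_exp_inverse: "contract_exp (- M) (contract_exp M \<alpha>) us = \<alpha> us"
proof (induction us arbitrary: \<alpha>)
  case (Cons v us)
  have neg: "contract_bel (- M) v \<beta> ws = - contract_bel M v \<beta> ws" for \<beta> ws
    by (simp add: contract_bel_def bel_uminus sum_negf)
  have "(\<lambda>ws. contract_exp M \<alpha> (v # ws) + contract_bel (- M) v (contract_exp M \<alpha>) ws)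
      = contract_exp M (\<lambda>ws. \<alpha> (v # ws))"
  proof
    fix ws
    have "contract_bel (- M) v (contract_exp M \<alpha>) ws = - contract_exp M (contract_bel M v \<alpha>) ws"
      by (simp add: neg[abs_def] contract_bel_contract_exp contract_exp_uminus)
    then show "contract_exp M \<alpha> (v # ws) + contract_bel (- M) v (contract_exp M \<alpha>) ws
        = contract_exp M (\<lambda>ws. \<alpha> (v # ws)) ws"
      by (simp add: contract_exp_add)
  qed
  then show ?case by (simp only: contract_exp.simps Cons)
qed simp

lemma contract_bel_covector:
  "contract_bel M v (covector l) us
    = (if us = [] then (\<Sum>j\<in>UNIV. bel M v $ j * ((l (axis j 1) - \<i> * l (axis j \<i>)) / 2)) else 0)"
  by (cases us) (simp_all add: contract_bel_def contract_dz_def covector_def)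

lemma contract_exp_covector:
  "contract_exp M (covector l) us
    = covector (\<lambda>v. l v + (\<Sum>j\<in>UNIV. bel M v $ j * ((l (axis j 1) - \<i> * l (axis j \<i>)) / 2))) us"
proof (cases us)
  case (Cons v ws)
  have "(\<lambda>ws. covector l (v # ws) + contract_bel M v (covector l) ws)
    = (\<lambda>ws. if ws = [] then l v + (\<Sum>j\<in>UNIV. bel M v $ j * ((l (axis j 1) - \<i> * l (axis j \<i>)) / 2)) else 0)"
    by (auto simp: contract_bel_covector fun_eq_iff covector_def split: list.splits)
  then show ?thesis
    unfolding Cons by (simp only: contract_exp.simps contract_exp_scalar) (auto simp: covector_def split: list.splits)
qed (simp add: covector_def)

lemma contract_rec_covector:
  "contract_rec M (covector l) us
    = covector (\<lambda>v. \<Sum>j\<in>UNIV. bel M v $ j * ((l (axis j 1) - \<i> * l (axis j \<i>)) / 2)) us"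
proof (cases us)
  case (Cons v ws)
  have z: "contract_rec M (\<lambda>us. covector l (v # us)) ws = 0"
  proof (cases ws)
    case (Cons w xs)
    have "(\<lambda>us. covector l (v # w # us)) = (\<lambda>_. 0)" by (simp add: covector_def)
    then show ?thesis unfolding Cons 
      by (simp add: contract_rec_zero contract_bel_def contract_dz_def) (simp add: covector_def)
  qed simp
  show ?thesis
    unfolding Cons contract_rec.simps z contract_bel_covector by (auto simp: covector_def split: list.splits)
qed (simp add: covector_def)

lemma row_form_covector: "row_form i M = covector (\<lambda>v. bel M v $ i)"
  by (auto simp: row_form_def fun_eq_iff dz_bar_def covector_def bel_nth split: list.splits)

text \<open>The (1,0)-vectors added by the substitution are annihilated by dzbar.\<close>

lemma contract_exp_dz_bar: "contract_exp M (dz_bar i) = dz_bar i"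
  unfolding dz_bar_def by (intro ext) (simp add: contract_exp_covector axis_def if_distrib cong: if_cong)

text \<open>The exponential sends \<open>dz i\<close> to \<open>dz i\<close> plus
  \<open>row_form i M\<close> and fixes the latter. Read backwards, the lemma moves a factor
  \<open>dz i\<close> inside the exponential.\<close>

lemma contract_exp_dz: "contract_exp M (\<lambda>us. dz i us - row_form i M us) = dz i"
proof -
  have "(\<lambda>us. dz i us - row_form i M us) = covector (\<lambda>v. v $ i - bel M v $ i)"
    by (auto simp: row_form_covector dz_def covector_def fun_eq_iff split: list.splits)
  moreover have "(\<Sum>j\<in>UNIV. bel M v $ j * (((axis j 1 $ i - bel M (axis j 1) $ i) - \<i> * (axis j \<i> $ i - bel M (axis j \<i>) $ i)) / 2))
    = bel M v $ i" for v
  proof -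
    have "(\<Sum>j\<in>UNIV. bel M v $ j * (((axis j 1 $ i - bel M (axis j 1) $ i) - \<i> * (axis j \<i> $ i - bel M (axis j \<i>) $ i)) / 2))
      = (\<Sum>j\<in>UNIV. if j = i then bel M v $ j else 0)"
      by (rule sum.cong) (auto simp: bel_axis axis_nth' algebra_simps)
    then show ?thesis by simp
  qed
  ultimately show ?thesis by (intro ext) (simp add: contract_exp_covector dz_def)
qed

lemma contract_rec_dz: "contract_rec M (dz i) = row_form i M"
proof -
  have "(\<Sum>j\<in>UNIV. bel M v $ j * ((axis j 1 $ i - \<i> * axis j \<i> $ i) / 2)) = bel M v $ i" for v
  proof -
    have "(\<Sum>j\<in>UNIV. bel M v $ j * ((axis j 1 $ i - \<i> * axis j \<i> $ i) / 2)) = (\<Sum>j\<in>UNIV. if j = i then bel M v $ j else 0)"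
      by (rule sum.cong) (auto simp: axis_def)
    then show ?thesis by simp
  qed
  then show ?thesis
    unfolding dz_def row_form_covector by (intro ext) (simp add: contract_rec_covector)
qed

section \<open>Type decomposition of real linear maps\<close>

lemma complex_scaleR: "r *\<^sub>R x = of_real r * x" for x :: complex
  by (rule scaleR_conv_of_real)

lemma sum_axis_expand: "(w :: complex^'n::finite) = (\<Sum>j\<in>UNIV. Re (w $ j) *\<^sub>R axis j 1 + Im (w $ j) *\<^sub>R axis j \<i>)"
proof -
  have "(\<Sum>j\<in>UNIV. Re (w $ j) *\<^sub>R axis j 1 + Im (w $ j) *\<^sub>R axis j \<i>) $ i
      = (\<Sum>j\<in>UNIV. if j = i then w $ i else 0)" for i :: 'n
    unfolding sum_component
    by (rule sum.cong) (auto simp: axis_nth' complex_eq_iff)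
  then show ?thesis by (simp add: vec_eq_iff)
qed

lemma linear_axis_expand:
  fixes f :: "complex^'n::finite \<Rightarrow> complex"
  assumes "linear f"
  shows "f w = (\<Sum>j\<in>UNIV. Re (w $ j) * f (axis j 1) + Im (w $ j) * f (axis j \<i>))"
proof -
  have "f w = f (\<Sum>j\<in>UNIV. Re (w $ j) *\<^sub>R axis j 1 + Im (w $ j) *\<^sub>R axis j \<i>)"
    using sum_axis_expand[of w] by simp
  then show ?thesis
    by (simp add: linear_sum[OF assms] linear_add[OF assms] linear_cmul[OF assms] complex_scaleR)
qed

lemma linear_smult: "linear ((*s) c :: complex^'n \<Rightarrow> complex^'n)"
  by (rule linearI) (simp_all add: vec_eq_iff algebra_simps)

text \<open>Both sides are the complex linear extension of f at the (1,0)-part of w; the right one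
  is free of coordinates, as naturality requires.\<close>

lemma linear_part_10:
  fixes f :: "complex^'n::finite \<Rightarrow> complex"
  assumes "linear f"
  shows "(\<Sum>j\<in>UNIV. w $ j * ((f (axis j 1) - \<i> * f (axis j \<i>)) / 2)) = (f w - \<i> * f (\<i> *s w)) / 2"
proof -
  have "(f w - \<i> * f (\<i> *s w)) / 2 = (\<Sum>j\<in>UNIV. (Re (w $ j) * f (axis j 1) + Im (w $ j) * f (axis j \<i>)
      - \<i> * (Re (\<i> * w $ j) * f (axis j 1) + Im (\<i> * w $ j) * f (axis j \<i>))) / 2)"
    unfolding linear_axis_expand[OF assms, of w] linear_axis_expand[OF assms, of "\<i> *s w"]
    by (simp add: sum_subtractf[symmetric] sum_distrib_left sum_divide_distrib)
  also have "\<dots> = (\<Sum>j\<in>UNIV. w $ j * ((f (axis j 1) - \<i> * f (axis j \<i>)) / 2))"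
  proof (rule sum.cong)
    fix j
    have w: "w $ j = of_real (Re (w $ j)) + \<i> * of_real (Im (w $ j))" by (rule complex_eq)
    show "(Re (w $ j) * f (axis j 1) + Im (w $ j) * f (axis j \<i>)
        - \<i> * (Re (\<i> * w $ j) * f (axis j 1) + Im (\<i> * w $ j) * f (axis j \<i>))) / 2
      = w $ j * ((f (axis j 1) - \<i> * f (axis j \<i>)) / 2)"
      by (subst (5) w) (simp add: field_simps)
  qed simp
  finally show ?thesis by simp
qed

lemma linear_part_01:
  fixes f :: "complex^'n::finite \<Rightarrow> complex"
  assumes "linear f"
  shows "(\<Sum>j\<in>UNIV. cnj (w $ j) * ((f (axis j 1) + \<i> * f (axis j \<i>)) / 2)) = (f w + \<i> * f (\<i> *s w)) / 2"
proof -
  have "(f w + \<i> * f (\<i> *s w)) / 2 = (\<Sum>j\<in>UNIV. (Re (w $ j) * f (axis j 1) + Im (w $ j) * f (axis j \<i>)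
      + \<i> * (Re (\<i> * w $ j) * f (axis j 1) + Im (\<i> * w $ j) * f (axis j \<i>))) / 2)"
    unfolding linear_axis_expand[OF assms, of w] linear_axis_expand[OF assms, of "\<i> *s w"]
    by (simp add: sum.distrib[symmetric] sum_distrib_left sum_divide_distrib)
  also have "\<dots> = (\<Sum>j\<in>UNIV. cnj (w $ j) * ((f (axis j 1) + \<i> * f (axis j \<i>)) / 2))"
  proof (rule sum.cong)
    fix j
    have w: "cnj (w $ j) = of_real (Re (w $ j)) - \<i> * of_real (Im (w $ j))"
      by (simp add: complex_eq_iff)
    show "(Re (w $ j) * f (axis j 1) + Im (w $ j) * f (axis j \<i>)
        + \<i> * (Re (\<i> * w $ j) * f (axis j 1) + Im (\<i> * w $ j) * f (axis j \<i>))) / 2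
      = cnj (w $ j) * ((f (axis j 1) + \<i> * f (axis j \<i>)) / 2)"
      unfolding w by (simp add: field_simps)
  qed simp
  finally show ?thesis by simp
qed

section \<open>Contractions of alternating forms\<close>

lemma contract_bel_eq:
  assumes "alternating \<alpha>"
  shows "contract_bel M v \<alpha> us = (\<alpha> (bel M v # us) - \<i> * \<alpha> ((\<i> *s bel M v) # us)) / 2"
  unfolding contract_bel_def contract_dz_def
  by (rule linear_part_10[OF alternating_linear_hd[OF assms]])

lemma alternating_contract_dz: "alternating \<alpha> \<Longrightarrow> alternating (contract_dz j \<alpha>)"
proof -
  assume a: "alternating \<alpha>"
  have "contract_dz j \<alpha> = (\<lambda>ws. (1/2) * \<alpha> (axis j 1 # ws) + (- \<i> / 2) * \<alpha> (axis j \<i> # ws))"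
    by (simp add: contract_dz_def fun_eq_iff field_simps)
  then show ?thesis
    by (simp only:) (intro alternating_add alternating_cmult alternating_Cons a)
qed

lemma alternating_contract_bel: "alternating \<alpha> \<Longrightarrow> alternating (contract_bel M v \<alpha>)"
  unfolding contract_bel_def[abs_def] by (intro alternating_sum alternating_cmult alternating_contract_dz)

lemma contract_dz_Cons:
  "alternating \<alpha> \<Longrightarrow> contract_dz j \<alpha> (v # us) = - contract_dz j (\<lambda>ws. \<alpha> (v # ws)) us"
  using alternating_swap[of \<alpha> "axis j 1" v us] alternating_swap[of \<alpha> "axis j \<i>" v us]
  by (simp add: contract_dz_def field_simps)

lemma contract_bel_Cons:
  "alternating \<alpha> \<Longrightarrow> contract_bel M v \<alpha> (w # us) = - contract_bel M v (\<lambda>ws. \<alpha> (w # ws)) us"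
  by (simp add: contract_bel_def contract_dz_Cons sum_negf)

lemma contract_dz_contract_dz:
  "alternating \<alpha> \<Longrightarrow> contract_dz i (contract_dz j \<alpha>) us = - contract_dz j (contract_dz i \<alpha>) us"
  using alternating_swap[of \<alpha> "axis i 1" "axis j 1" us] alternating_swap[of \<alpha> "axis i 1" "axis j \<i>" us]
    alternating_swap[of \<alpha> "axis i \<i>" "axis j 1" us] alternating_swap[of \<alpha> "axis i \<i>" "axis j \<i>" us]
  by (simp add: contract_dz_def field_simps)

text \<open>The coefficients are symmetric in i and j while the contractions anticommute, so the
  double sum is its own negative.\<close>

lemma contract_bel_contract_bel_self:
  assumes "alternating \<alpha>"
  shows "contract_bel M v (contract_bel M v \<alpha>) us = 0"
proof -
  define s where "s = (\<Sum>i\<in>UNIV. \<Sum>j\<in>UNIV. bel M v $ i * (bel M v $ j * contract_dz i (contract_dz j \<alpha>) us))"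
  have "s = (\<Sum>j\<in>UNIV. \<Sum>i\<in>UNIV. bel M v $ i * (bel M v $ j * contract_dz i (contract_dz j \<alpha>) us))"
    unfolding s_def by (rule sum.swap)
  also have "\<dots> = - s"
    unfolding s_def sum_negf[symmetric]
    by (intro sum.cong refl, subst contract_dz_contract_dz[OF assms]) (simp add: mult.left_commute)
  finally have "s + s = 0" by (metis add.right_inverse)
  then have "s = 0" by (simp only: mult_2[symmetric] mult_eq_0_iff) simp
  then show ?thesis
    by (simp add: s_def contract_bel_def[abs_def] contract_dz_sum contract_dz_cmult sum_distrib_left)
qed

lemma contract_bel_vadd: "contract_bel M (v + w) \<alpha> us = contract_bel M v \<alpha> us + contract_bel M w \<alpha> us"
  by (simp add: contract_bel_def bel_add sum.distrib distrib_right)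

lemma contract_bel_scaleR: "contract_bel M (r *\<^sub>R v) \<alpha> us = of_real r * contract_bel M v \<alpha> us"
  by (simp add: contract_bel_def bel_scaleR sum_distrib_left mult.assoc complex_scaleR)

lemma alternating_contract_exp:
  assumes "alternating \<alpha>"
  shows "alternating (contract_exp M \<alpha>)"
proof (rule alternatingI)
  show "linear (\<lambda>v. contract_exp M \<alpha> (us @ v # ws))" for us ws
    using assms
  proof (induction us arbitrary: \<alpha>)
    case Nil
    have add: "(\<lambda>ws. \<alpha> ((v + w) # ws) + contract_bel M (v + w) \<alpha> ws)
      = (\<lambda>ws. (\<alpha> (v # ws) + contract_bel M v \<alpha> ws) + (\<alpha> (w # ws) + contract_bel M w \<alpha> ws))" for v w
      by (simp add: contract_bel_vadd linear_add[OF alternating_linear_hd[OF Nil]] add_ac)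
    have scale: "(\<lambda>ws. \<alpha> ((r *\<^sub>R v) # ws) + contract_bel M (r *\<^sub>R v) \<alpha> ws)
      = (\<lambda>ws. of_real r * (\<alpha> (v # ws) + contract_bel M v \<alpha> ws))" for r v
      using linear_cmul[OF alternating_linear_hd[OF Nil]]
      by (intro ext) (simp add: contract_bel_scaleR distrib_left complex_scaleR)
    show ?case
      unfolding append_Nil contract_exp.simps
      by (rule linearI; unfold add scale contract_exp_cmult complex_scaleR) (rule contract_exp_add, rule refl)
  next
    case (Cons x us)
    then show ?case
      by (simp add: alternating_Cons alternating_add alternating_contract_bel)
  qed
  show "contract_exp M \<alpha> (us @ v # v # ws) = 0" for us v ws
    using assms
  proof (induction us arbitrary: \<alpha>)
    case Nil
    \<comment> \<open>Of the four terms of the double substitution, the mixed ones cancel by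
      \<open>contract_bel_Cons\<close>, and the quadratic one vanishes by
      \<open>contract_bel_contract_bel_self\<close>.\<close>
    have "\<alpha> (v # v # ws) = 0" for ws by (simp add: alternating_not_distinct[OF Nil])
    then show ?case
      by (simp add: contract_bel_add contract_bel_Cons[OF Nil] contract_bel_contract_bel_self[OF Nil] contract_exp_zero)
  next
    case (Cons x us)
    then show ?case
      by (simp add: alternating_Cons alternating_add alternating_contract_bel)
  qed
qed

text \<open>Expanding the wedge with \<open>row_form i M\<close> along the first argument v gives
  the \<open>contract_bel\<close> term and a remainder in which two signs cancel: one from moving v
  past the covector, one from alternation as the contraction passes v.\<close>

lemma contract_matrix_eq_contract_rec: "alternating \<alpha> \<Longrightarrow> contract_matrix M \<alpha> us = contract_rec M \<alpha> us"
proof (induction us arbitrary: \<alpha>)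
  case Nil
  then show ?case by (simp add: contract_matrix_def row_form_covector covector_def)
next
  case (Cons v us)
  have "wedge (row_form i M) (contract_dz i \<alpha>) (v # us)
    = bel M v $ i * contract_dz i \<alpha> us + wedge (row_form i M) (contract_dz i (\<lambda>ws. \<alpha> (v # ws))) us" for i
  proof -
    have 1: "(\<lambda>ws. row_form i M (v # ws)) = (\<lambda>ws. if ws = [] then bel M v $ i else 0)"
      by (auto simp: row_form_covector covector_def fun_eq_iff split: list.splits)
    have 2: "sgn_form (row_form i M) = (\<lambda>ws. - row_form i M ws)"
      by (auto simp: row_form_covector covector_def sgn_form_def fun_eq_iff split: list.splits)
    show ?thesis
      unfolding wedge_Cons 1 2 contract_dz_Cons[OF Cons.prems] wedge_scalar_left wedge_uminus_left wedge_uminus_right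
      by simp
  qed
  then show ?case
    using Cons.IH[OF alternating_Cons[OF Cons.prems, of v]]
    by (simp add: contract_matrix_def sum.distrib contract_bel_def)
qed

text \<open>By \<open>contract_bel_eq\<close> the substitution uses only \<open>bel\<close> and
  multiplication by \<i>, both respected by A. The map A will be the derivative of a transition
  map.\<close>

lemma contract_exp_map:
  assumes A: "linear A" "\<And>v. A (\<i> *s v) = \<i> *s A v" "\<And>v. A (bel M v) = bel M' (A v)"
  shows "alternating \<alpha> \<Longrightarrow> contract_exp M (\<lambda>ws. \<alpha> (map A ws)) us = contract_exp M' \<alpha> (map A us)"
proof (induction us arbitrary: \<alpha>)
  case (Cons v us)
  have "contract_bel M v (\<lambda>ws. \<alpha> (map A ws)) ws = contract_bel M' (A v) \<alpha> (map A ws)" for ws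
    unfolding contract_bel_eq[OF alternating_map[OF Cons.prems A(1)]] contract_bel_eq[OF Cons.prems]
    by (simp add: A(2)[symmetric] A(3)[symmetric])
  then show ?case
    using Cons.IH[of "\<lambda>ws. \<alpha> (A v # ws) + contract_bel M' (A v) \<alpha> ws"] Cons.prems
    by (simp add: alternating_Cons alternating_add alternating_contract_bel)
qed simp

lemma contract_rec_map:
  assumes A: "linear A" "\<And>v. A (\<i> *s v) = \<i> *s A v" "\<And>v. A (bel M v) = bel M' (A v)"
  shows "alternating \<alpha> \<Longrightarrow> contract_rec M (\<lambda>ws. \<alpha> (map A ws)) us = contract_rec M' \<alpha> (map A us)"
proof (induction us arbitrary: \<alpha>)
  case (Cons v us)
  have "contract_bel M v (\<lambda>ws. \<alpha> (map A ws)) ws = contract_bel M' (A v) \<alpha> (map A ws)" for ws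
    unfolding contract_bel_eq[OF alternating_map[OF Cons.prems A(1)]] contract_bel_eq[OF Cons.prems]
    by (simp add: A(2)[symmetric] A(3)[symmetric])
  then show ?case
    using Cons.IH[of "\<lambda>ws. \<alpha> (A v # ws)"] Cons.prems
    by (simp add: alternating_Cons)
qed simp

section \<open>Multiplication by \<i> on tangent vectors\<close>

definition rot :: "complex^'n \<Rightarrow> complex^'n" where
  "rot v = \<i> *s v"

lemma rot_rot: "rot (rot v) = - v"
  by (simp add: rot_def vec_eq_iff)

lemma linear_rot: "linear rot"
  unfolding rot_def[abs_def] by (rule linear_smult)

lemma contract_dz_rot:
  assumes "alternating \<alpha>"
  shows "contract_dz j (\<lambda>ws. \<alpha> (map rot ws)) us = \<i> * contract_dz j \<alpha> (map rot us)"
proof -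
  have "rot (axis j 1) = axis j \<i>" "rot (axis j \<i>) = - axis j 1"
    using rot_rot[of "axis j 1"] by (simp_all add: rot_def axis_smult)
  then show ?thesis
    using linear_neg[OF alternating_linear_hd[OF assms]]
    by (simp add: contract_dz_def field_simps)
qed

text \<open>Pullback by \<open>rot\<close> acts on type (p,q) as \<i>^(p-q), and the contraction
  changes (p,q) into (p-1,q+1), which costs \<i>^(-2) = -1.\<close>

lemma contract_rec_rot:
  assumes "alternating \<alpha>"
  shows "contract_rec M (\<lambda>ws. \<alpha> (map rot ws)) us = - contract_rec M \<alpha> (map rot us)"
  using assms
proof (induction us arbitrary: \<alpha>)
  case (Cons v us)
  have "contract_bel M v (\<lambda>ws. \<alpha> (map rot ws)) us = - contract_bel M (rot v) \<alpha> (map rot us)"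
    by (simp add: contract_bel_def contract_dz_rot[OF Cons.prems] rot_def bel_smult sum_negf algebra_simps)
  then show ?case
    using Cons.IH[of "\<lambda>ws. \<alpha> (rot v # ws)"] Cons.prems by (simp add: alternating_Cons)
qed simp

section \<open>Differential operators in coordinates\<close>

text \<open>The exterior derivative and the operators \<open>\<partial>\<close>, \<open>\<partial>bar\<close> arise from the derivations
  \<open>cdir a b v\<close> with \<open>(a, b) = (1, 0)\<close>, \<open>(1/2, -\<i>/2)\<close> and \<open>(1/2, \<i>/2)\<close>; the recursion is Cartan's
  formula for the constant vector field \<open>v\<close>.\<close>

definition cdir :: "complex \<Rightarrow> complex \<Rightarrow> complex^'n \<Rightarrow> (complex^'n \<Rightarrow> complex) \<Rightarrow> complex^'n \<Rightarrow> complex" where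
  "cdir a b v f z = a * D f z v + b * D f z (rot v)"

definition ldir :: "complex \<Rightarrow> complex \<Rightarrow> complex^'n \<Rightarrow> 'n lform \<Rightarrow> 'n lform" where
  "ldir a b v \<omega> z us = cdir a b v (\<lambda>y. \<omega> y us) z"

primrec ext_d :: "complex \<Rightarrow> complex \<Rightarrow> 'n::finite lform \<Rightarrow> 'n lform" where
  "ext_d a b \<omega> z [] = 0"
| "ext_d a b \<omega> z (v # us) = ldir a b v \<omega> z us - ext_d a b (\<lambda>y ws. \<omega> y (v # ws)) z us"

definition smooth_lform :: "(complex^'n) set \<Rightarrow> 'n::finite lform \<Rightarrow> bool" where
  "smooth_lform S \<omega> \<longleftrightarrow> (\<forall>us. smooth_on S (\<lambda>z. \<omega> z us))"

definition smooth_matrix :: "(complex^'n) set \<Rightarrow> (complex^'n \<Rightarrow> complex^'n::finite^'n) \<Rightarrow> bool" where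
  "smooth_matrix S \<phi> \<longleftrightarrow> (\<forall>i j. smooth_on S (\<lambda>z. \<phi> z $ i $ j))"

definition mdir :: "complex \<Rightarrow> complex \<Rightarrow> complex^'n \<Rightarrow> (complex^'n \<Rightarrow> complex^'n::finite^'n) \<Rightarrow> complex^'n \<Rightarrow> complex^'n^'n" where
  "mdir a b v \<phi> z = (\<chi> i j. cdir a b v (\<lambda>y. \<phi> y $ i $ j) z)"

lemma ext_deriv_local_eq: "ext_deriv_local \<omega> z us = ext_d 1 0 \<omega> z us"
proof (induction us arbitrary: \<omega>)
  case (Cons v us)
  have "ext_deriv_local \<omega> z (v # us) = D (\<lambda>y. \<omega> y us) z v - ext_deriv_local (\<lambda>y ws. \<omega> y (v # ws)) z us"
    unfolding ext_deriv_local_def by (simp add: sum.lessThan_Suc_shift sum_negf del: sum.lessThan_Suc)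
  then show ?case by (simp add: Cons ldir_def cdir_def)
qed (simp add: ext_deriv_local_def)

lemma rot_axis: "rot (axis i 1) = axis i \<i>"
  by (simp add: rot_def axis_smult)

lemma lform_wirt_eq: "lform_wirt i \<omega> = ldir (1/2) (- \<i>/2) (axis i 1) \<omega>"
  by (simp add: fun_eq_iff lform_wirt_def wirt_def ldir_def cdir_def rot_axis diff_divide_distrib)

lemma lform_wirt_bar_eq: "lform_wirt_bar i \<omega> = ldir (1/2) (\<i>/2) (axis i 1) \<omega>"
  by (simp add: fun_eq_iff lform_wirt_bar_def wirt_bar_def ldir_def cdir_def rot_axis add_divide_distrib)

lemma ldir_Cons: "ldir a b v (\<lambda>y ws. \<omega> y (u # ws)) z us = ldir a b v \<omega> z (u # us)"
  by (simp add: ldir_def)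

lemma wedge_covector_Cons:
  "wedge (covector l) \<beta> (v # us) = l v * \<beta> us - wedge (covector l) (\<lambda>ws. \<beta> (v # ws)) us"
proof -
  have 1: "(\<lambda>ws. covector l (v # ws)) = (\<lambda>ws. if ws = [] then l v else 0)"
    by (auto simp: covector_def fun_eq_iff split: list.splits)
  have 2: "sgn_form (covector l) = (\<lambda>ws. - covector l ws)"
    by (auto simp: covector_def sgn_form_def fun_eq_iff split: list.splits)
  show ?thesis
    unfolding wedge_Cons 1 2 wedge_scalar_left wedge_uminus_left by simp
qed

lemma lform_wirt_Cons: "(\<lambda>ws. lform_wirt i \<omega> z (v # ws)) = lform_wirt i (\<lambda>y ws. \<omega> y (v # ws)) z"
  by (simp add: fun_eq_iff lform_wirt_def)

lemma lform_wirt_bar_Cons: "(\<lambda>ws. lform_wirt_bar i \<omega> z (v # ws)) = lform_wirt_bar i (\<lambda>y ws. \<omega> y (v # ws)) z"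
  by (simp add: fun_eq_iff lform_wirt_bar_def)

lemma ldir_Cons_fun: "(\<lambda>ws. ldir a b v \<omega> z (u # ws)) = ldir a b v (\<lambda>y ws. \<omega> y (u # ws)) z"
  by (simp add: fun_eq_iff ldir_def)

text \<open>After contraction with v the sum over \<open>dz i\<close> becomes the complex linear
  part of the derivative at v (\<open>linear_part_10\<close>), which is \<open>cdir\<close> with
  coefficients 1/2 and -\<i>/2.\<close>

lemma del_local_eq:
  assumes "\<And>us. (\<lambda>y. \<omega> y us) differentiable (at z)"
  shows "del_local \<omega> z us = ext_d (1/2) (- \<i>/2) \<omega> z us"
  using assms
proof (induction us arbitrary: \<omega>)
  case Nil
  then show ?case by (simp add: del_local_def dz_def covector_def)
next
  case (Cons v us)
  have "del_local \<omega> z (v # us) = (\<Sum>i\<in>UNIV. v $ i * lform_wirt i \<omega> z us) - del_local (\<lambda>y ws. \<omega> y (v # ws)) z us"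
    unfolding del_local_def dz_def by (simp add: wedge_covector_Cons sum_subtractf lform_wirt_Cons)
  also have "(\<Sum>i\<in>UNIV. v $ i * lform_wirt i \<omega> z us) = ldir (1/2) (- \<i>/2) v \<omega> z us"
    using linear_part_10[OF D_linear[OF Cons.prems[of us]], of v]
    by (simp add: lform_wirt_def wirt_def ldir_def cdir_def rot_def diff_divide_distrib)
  finally show ?case using Cons by simp
qed

lemma delbar_local_eq:
  assumes "\<And>us. (\<lambda>y. \<omega> y us) differentiable (at z)"
  shows "delbar_local \<omega> z us = ext_d (1/2) (\<i>/2) \<omega> z us"
  using assms
proof (induction us arbitrary: \<omega>)
  case Nil
  then show ?case by (simp add: delbar_local_def dz_bar_def covector_def)
next
  case (Cons v us)
  have "delbar_local \<omega> z (v # us) = (\<Sum>i\<in>UNIV. cnj (v $ i) * lform_wirt_bar i \<omega> z us) - delbar_local (\<lambda>y ws. \<omega> y (v # ws)) z us"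
    unfolding delbar_local_def dz_bar_def by (simp add: wedge_covector_Cons sum_subtractf lform_wirt_bar_Cons)
  also have "(\<Sum>i\<in>UNIV. cnj (v $ i) * lform_wirt_bar i \<omega> z us) = ldir (1/2) (\<i>/2) v \<omega> z us"
    using linear_part_01[OF D_linear[OF Cons.prems[of us]], of v]
    by (simp add: lform_wirt_bar_def wirt_bar_def ldir_def cdir_def rot_def add_divide_distrib)
  finally show ?case using Cons by simp
qed

lemma ext_d_add_coeff: "ext_d (a + a') (b + b') \<omega> z us = ext_d a b \<omega> z us + ext_d a' b' \<omega> z us"
  by (induction us arbitrary: \<omega>) (simp_all add: ldir_def cdir_def algebra_simps)

section \<open>Leibniz rules for directional derivatives\<close>

lemma cdir_const: "cdir a b v (\<lambda>_. c) z = 0"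
  by (simp add: cdir_def D_const)

lemma cdir_add:
  "f differentiable (at z) \<Longrightarrow> g differentiable (at z) \<Longrightarrow>
    cdir a b v (\<lambda>y. f y + g y) z = cdir a b v f z + cdir a b v g z"
  by (simp add: cdir_def D_add algebra_simps)

lemma cdir_mult:
  "f differentiable (at z) \<Longrightarrow> g differentiable (at z) \<Longrightarrow>
    cdir a b v (\<lambda>y. f y * g y) z = f z * cdir a b v g z + cdir a b v f z * g z"
  by (simp add: cdir_def D_mult algebra_simps)

lemma cdir_cmult: "f differentiable (at z) \<Longrightarrow> cdir a b v (\<lambda>y. c * f y) z = c * cdir a b v f z"
  using cdir_mult[of "\<lambda>_. c" z f] by (simp add: cdir_const)

lemma cdir_sum:
  assumes "\<And>i. i \<in> I \<Longrightarrow> f i differentiable (at z)"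
  shows "cdir a b v (\<lambda>y. \<Sum>i\<in>I. f i y) z = (\<Sum>i\<in>I. cdir a b v (f i) z)"
  using assms by (induction I rule: infinite_finite_induct) (auto simp: cdir_const cdir_add)

section \<open>Smooth forms on an open set\<close>

context
  fixes S :: "(complex^'n::finite) set"
  assumes S: "open S"
begin

lemma smooth_lform_D: "smooth_lform S \<omega> \<Longrightarrow> z \<in> S \<Longrightarrow> (\<lambda>y. \<omega> y us) differentiable (at z)"
  unfolding smooth_lform_def using smooth_on_differentiable by blast

lemma smooth_matrix_D: "smooth_matrix S \<phi> \<Longrightarrow> z \<in> S \<Longrightarrow> (\<lambda>y. \<phi> y $ i $ j) differentiable (at z)"
  unfolding smooth_matrix_def using smooth_on_differentiable by blast

lemma cdir_cong: "z \<in> S \<Longrightarrow> (\<And>y. y \<in> S \<Longrightarrow> f y = g y) \<Longrightarrow> cdir a b v f z = cdir a b v g z"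
  using D_cong[OF S, of z f g] by (simp add: cdir_def)

lemma ldir_cong: "z \<in> S \<Longrightarrow> (\<And>y. y \<in> S \<Longrightarrow> \<omega> y us = \<eta> y us) \<Longrightarrow> ldir a b v \<omega> z us = ldir a b v \<eta> z us"
  unfolding ldir_def by (rule cdir_cong)

lemma ext_d_cong:
  "z \<in> S \<Longrightarrow> (\<And>y us. y \<in> S \<Longrightarrow> \<omega> y us = \<eta> y us) \<Longrightarrow> ext_d a b \<omega> z us = ext_d a b \<eta> z us"
proof (induction us arbitrary: \<omega> \<eta>)
  case (Cons v us)
  have "ldir a b v \<omega> z us = ldir a b v \<eta> z us"
    by (rule ldir_cong) (use Cons.prems in auto)
  moreover have "ext_d a b (\<lambda>y ws. \<omega> y (v # ws)) z us = ext_d a b (\<lambda>y ws. \<eta> y (v # ws)) z us"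
    by (rule Cons.IH) (use Cons.prems in auto)
  ultimately show ?case by simp
qed simp

lemma smooth_lform_Cons: "smooth_lform S \<omega> \<Longrightarrow> smooth_lform S (\<lambda>y ws. \<omega> y (v # ws))"
  by (simp add: smooth_lform_def)

lemma smooth_lform_add: "smooth_lform S \<omega> \<Longrightarrow> smooth_lform S \<eta> \<Longrightarrow> smooth_lform S (\<lambda>y ws. \<omega> y ws + \<eta> y ws)"
  by (simp add: smooth_lform_def smooth_on_add[OF S])

lemma smooth_lform_cmult: "smooth_lform S \<omega> \<Longrightarrow> smooth_lform S (\<lambda>y ws. c * \<omega> y ws)"
  by (simp add: smooth_lform_def smooth_on_mult[OF S])

lemma smooth_lform_uminus: "smooth_lform S \<omega> \<Longrightarrow> smooth_lform S (\<lambda>y ws. - \<omega> y ws)"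
  using smooth_lform_cmult[of \<omega> "-1"] by simp

lemma smooth_lform_sum: "(\<And>i. i \<in> I \<Longrightarrow> smooth_lform S (\<omega> i)) \<Longrightarrow> smooth_lform S (\<lambda>y ws. \<Sum>i\<in>I. \<omega> i y ws)"
  by (simp add: smooth_lform_def smooth_on_sum[OF S])

lemma smooth_lform_mult: "smooth_on S f \<Longrightarrow> smooth_lform S \<omega> \<Longrightarrow> smooth_lform S (\<lambda>y ws. f y * \<omega> y ws)"
  by (simp add: smooth_lform_def smooth_on_mult[OF S])

lemma smooth_lform_const: "smooth_lform S (\<lambda>_. \<alpha>)"
  by (simp add: smooth_lform_def)

lemma smooth_lform_sgn_form: "smooth_lform S \<omega> \<Longrightarrow> smooth_lform S (\<lambda>y. sgn_form (\<omega> y))"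
  by (simp add: smooth_lform_def sgn_form_def smooth_on_mult[OF S])

lemma smooth_on_cdir: "smooth_on S f \<Longrightarrow> smooth_on S (cdir a b v f)"
  unfolding cdir_def[abs_def] by (intro smooth_on_add[OF S] smooth_on_mult[OF S] smooth_on_const smooth_on_D)

lemma smooth_lform_ldir: "smooth_lform S \<omega> \<Longrightarrow> smooth_lform S (ldir a b v \<omega>)"
  using smooth_on_cdir by (simp add: smooth_lform_def ldir_def[abs_def])

lemma smooth_lform_ext_d: "smooth_lform S \<omega> \<Longrightarrow> smooth_lform S (ext_d a b \<omega>)"
  unfolding smooth_lform_def[of S "ext_d a b \<omega>"]
proof
  fix us
  show "smooth_lform S \<omega> \<Longrightarrow> smooth_on S (\<lambda>z. ext_d a b \<omega> z us)"
  proof (induction us arbitrary: \<omega>)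
    case (Cons v us)
    have "smooth_on S (\<lambda>z. ldir a b v \<omega> z us + (- 1) * ext_d a b (\<lambda>y ws. \<omega> y (v # ws)) z us)"
      using smooth_lform_ldir[OF Cons.prems] Cons.IH[OF smooth_lform_Cons[OF Cons.prems]]
      by (intro smooth_on_add[OF S] smooth_on_mult[OF S] smooth_on_const) (auto simp: smooth_lform_def)
    then show ?case by simp
  qed simp
qed

lemma smooth_lform_wedge: "smooth_lform S \<omega> \<Longrightarrow> smooth_lform S \<eta> \<Longrightarrow> smooth_lform S (\<lambda>y. wedge (\<omega> y) (\<eta> y))"
  unfolding smooth_lform_def[of S "\<lambda>y. wedge (\<omega> y) (\<eta> y)"]
proof
  fix us
  show "smooth_lform S \<omega> \<Longrightarrow> smooth_lform S \<eta> \<Longrightarrow> smooth_on S (\<lambda>y. wedge (\<omega> y) (\<eta> y) us)"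
  proof (induction us arbitrary: \<omega> \<eta>)
    case Nil
    then show ?case by (simp add: smooth_lform_def smooth_on_mult[OF S])
  next
    case (Cons v us)
    show ?case
      unfolding wedge_Cons
      by (intro smooth_on_add[OF S] Cons.IH smooth_lform_Cons smooth_lform_sgn_form Cons.prems)
  qed
qed

lemma smooth_on_bel: "smooth_matrix S \<phi> \<Longrightarrow> smooth_on S (\<lambda>y. bel (\<phi> y) v $ i)"
  unfolding bel_nth smooth_matrix_def by (intro smooth_on_sum[OF S] smooth_on_mult[OF S] smooth_on_const) auto

lemma smooth_lform_contract_dz: "smooth_lform S \<omega> \<Longrightarrow> smooth_lform S (\<lambda>y. contract_dz j (\<omega> y))"
proof -
  assume \<omega>: "smooth_lform S \<omega>"
  have "(\<lambda>y. contract_dz j (\<omega> y)) = (\<lambda>y ws. (1/2) * \<omega> y (axis j 1 # ws) + (- \<i> / 2) * \<omega> y (axis j \<i> # ws))"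
    by (simp add: contract_dz_def fun_eq_iff field_simps)
  then show ?thesis
    by (simp only:) (intro smooth_lform_add smooth_lform_cmult smooth_lform_Cons \<omega>)
qed

lemma smooth_lform_contract_bel:
  "smooth_matrix S \<phi> \<Longrightarrow> smooth_lform S \<omega> \<Longrightarrow> smooth_lform S (\<lambda>y. contract_bel (\<phi> y) v (\<omega> y))"
  unfolding contract_bel_def[abs_def]
  by (intro smooth_lform_sum smooth_lform_mult smooth_on_bel smooth_lform_contract_dz)

lemma smooth_lform_contract_exp:
  "smooth_matrix S \<phi> \<Longrightarrow> smooth_lform S \<omega> \<Longrightarrow> smooth_lform S (\<lambda>y. contract_exp (\<phi> y) (\<omega> y))"
  unfolding smooth_lform_def[of S "\<lambda>y. contract_exp (\<phi> y) (\<omega> y)"]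
proof
  fix us
  show "smooth_matrix S \<phi> \<Longrightarrow> smooth_lform S \<omega> \<Longrightarrow> smooth_on S (\<lambda>y. contract_exp (\<phi> y) (\<omega> y) us)"
  proof (induction us arbitrary: \<omega>)
    case (Cons v us)
    show ?case
      unfolding contract_exp.simps
      by (intro Cons.IH smooth_lform_add smooth_lform_Cons smooth_lform_contract_bel Cons.prems)
  qed (simp add: smooth_lform_def)
qed

lemma smooth_lform_contract_rec:
  "smooth_matrix S \<phi> \<Longrightarrow> smooth_lform S \<omega> \<Longrightarrow> smooth_lform S (\<lambda>y. contract_rec (\<phi> y) (\<omega> y))"
  unfolding smooth_lform_def[of S "\<lambda>y. contract_rec (\<phi> y) (\<omega> y)"]
proof
  fix us
  show "smooth_matrix S \<phi> \<Longrightarrow> smooth_lform S \<omega> \<Longrightarrow> smooth_on S (\<lambda>y. contract_rec (\<phi> y) (\<omega> y) us)"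
  proof (induction us arbitrary: \<omega>)
    case (Cons v us)
    show ?case
      unfolding contract_rec.simps
      using smooth_lform_contract_bel[OF Cons.prems, of v]
      by (intro smooth_on_add[OF S] Cons.IH smooth_lform_Cons Cons.prems) (simp add: smooth_lform_def)
  qed simp
qed

context
  fixes z
  assumes z: "z \<in> S"
begin

lemma ldir_add: "smooth_lform S \<omega> \<Longrightarrow> smooth_lform S \<eta> \<Longrightarrow>
    ldir a b v (\<lambda>y ws. \<omega> y ws + \<eta> y ws) z us = ldir a b v \<omega> z us + ldir a b v \<eta> z us"
  by (simp add: ldir_def cdir_add smooth_lform_D z)

lemma ldir_cmult: "smooth_lform S \<omega> \<Longrightarrow> ldir a b v (\<lambda>y ws. c * \<omega> y ws) z us = c * ldir a b v \<omega> z us"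
  by (simp add: ldir_def cdir_cmult smooth_lform_D z)

lemma ldir_sgn_form: "smooth_lform S \<omega> \<Longrightarrow> ldir a b v (\<lambda>y. sgn_form (\<omega> y)) z us = sgn_form (ldir a b v \<omega> z) us"
  by (simp add: ldir_def sgn_form_def cdir_cmult smooth_lform_D z)

lemma ldir_wedge:
  "smooth_lform S \<omega> \<Longrightarrow> smooth_lform S \<eta> \<Longrightarrow> ldir a b v (\<lambda>y. wedge (\<omega> y) (\<eta> y)) z us
    = wedge (ldir a b v \<omega> z) (\<eta> z) us + wedge (\<omega> z) (ldir a b v \<eta> z) us"
proof (induction us arbitrary: \<omega> \<eta>)
  case Nil
  then show ?case by (simp add: ldir_def cdir_mult smooth_lform_D z algebra_simps)
next
  case (Cons u us)
  note sm = smooth_lform_Cons[OF Cons.prems(1)] smooth_lform_Cons[OF Cons.prems(2)] smooth_lform_sgn_form[OF Cons.prems(1)]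
  have sgn: "ldir a b v (\<lambda>y. sgn_form (\<omega> y)) z = sgn_form (ldir a b v \<omega> z)"
    by (intro ext) (rule ldir_sgn_form[OF Cons.prems(1)])
  have L: "(ldir a b v (\<lambda>y ws. \<omega> y (u # ws)) z) = (\<lambda>ws. ldir a b v \<omega> z (u # ws))" for \<omega>
    by (simp add: ldir_def[abs_def])
  have "ldir a b v (\<lambda>y. wedge (\<omega> y) (\<eta> y)) z (u # us)
    = ldir a b v (\<lambda>y ws. wedge (\<lambda>ws. \<omega> y (u # ws)) (\<eta> y) ws + wedge (sgn_form (\<omega> y)) (\<lambda>ws. \<eta> y (u # ws)) ws) z us"
    by (simp add: ldir_def wedge_Cons)
  also have "\<dots> = ldir a b v (\<lambda>y. wedge (\<lambda>ws. \<omega> y (u # ws)) (\<eta> y)) z us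
      + ldir a b v (\<lambda>y. wedge (sgn_form (\<omega> y)) (\<lambda>ws. \<eta> y (u # ws))) z us"
    by (intro ldir_add smooth_lform_wedge sm Cons.prems)
  also have "\<dots> = wedge (ldir a b v \<omega> z) (\<eta> z) (u # us) + wedge (\<omega> z) (ldir a b v \<eta> z) (u # us)"
    unfolding Cons.IH[OF sm(1) Cons.prems(2)] Cons.IH[OF sm(3,2)] L sgn wedge_Cons by simp
  finally show ?case .
qed

lemma ldir_contract_bel:
  assumes "smooth_matrix S \<phi>" "smooth_lform S \<omega>"
  shows "ldir a b v (\<lambda>y. contract_bel (\<phi> y) u (\<omega> y)) z us
    = contract_bel (mdir a b v \<phi> z) u (\<omega> z) us + contract_bel (\<phi> z) u (ldir a b v \<omega> z) us"
proof -
  have 1: "cdir a b v (\<lambda>y. bel (\<phi> y) u $ j) z = bel (mdir a b v \<phi> z) u $ j" for j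
  proof -
    have "cdir a b v (\<lambda>y. bel (\<phi> y) u $ j) z = cdir a b v (\<lambda>y. \<Sum>k\<in>UNIV. cnj (u $ k) * \<phi> y $ j $ k) z"
      by (simp add: bel_nth mult.commute)
    also have "\<dots> = (\<Sum>k\<in>UNIV. cdir a b v (\<lambda>y. cnj (u $ k) * \<phi> y $ j $ k) z)"
      by (rule cdir_sum) (simp add: smooth_matrix_D[OF assms(1) z])
    also have "\<dots> = bel (mdir a b v \<phi> z) u $ j"
      by (simp add: bel_nth mdir_def cdir_cmult smooth_matrix_D[OF assms(1) z] mult.commute)
    finally show ?thesis .
  qed
  have 2: "cdir a b v (\<lambda>y. contract_dz j (\<omega> y) us) z = contract_dz j (ldir a b v \<omega> z) us" for j
  proof -
    have d: "(\<lambda>y. c * \<omega> y ws) differentiable (at z)" for c ws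
      using smooth_lform_D[OF assms(2) z] by simp
    have "cdir a b v (\<lambda>y. contract_dz j (\<omega> y) us) z
      = cdir a b v (\<lambda>y. (1/2) * \<omega> y (axis j 1 # us) + (- \<i> / 2) * \<omega> y (axis j \<i> # us)) z"
      by (simp add: contract_dz_def diff_divide_distrib)
    also have "\<dots> = (1/2) * cdir a b v (\<lambda>y. \<omega> y (axis j 1 # us)) z + (- \<i> / 2) * cdir a b v (\<lambda>y. \<omega> y (axis j \<i> # us)) z"
      unfolding cdir_add[OF d d] cdir_cmult[OF smooth_lform_D[OF assms(2) z]] ..
    finally show ?thesis by (simp add: contract_dz_def ldir_def field_simps)
  qed
  have d: "(\<lambda>y. bel (\<phi> y) u $ j) differentiable (at z)" "(\<lambda>y. contract_dz j (\<omega> y) us) differentiable (at z)" for j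
    using smooth_on_differentiable[OF smooth_on_bel[OF assms(1)] z]
      smooth_lform_D[OF smooth_lform_contract_dz[OF assms(2)] z] by auto
  have "ldir a b v (\<lambda>y. contract_bel (\<phi> y) u (\<omega> y)) z us
    = (\<Sum>j\<in>UNIV. cdir a b v (\<lambda>y. bel (\<phi> y) u $ j * contract_dz j (\<omega> y) us) z)"
    unfolding ldir_def contract_bel_def by (rule cdir_sum) (simp add: d)
  then show ?thesis
    by (simp add: cdir_mult d 1 2 contract_bel_def sum.distrib)
qed

text \<open>Since \<open>M \<mapsto> contract_rec M\<close> has commuting values, the derivative of the exponential is
  computed as in the scalar case.\<close>

lemma ldir_contract_exp:
  "smooth_matrix S \<phi> \<Longrightarrow> smooth_lform S \<omega> \<Longrightarrow> ldir a b v (\<lambda>y. contract_exp (\<phi> y) (\<omega> y)) z us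
    = contract_exp (\<phi> z) (\<lambda>ws. ldir a b v \<omega> z ws + contract_rec (mdir a b v \<phi> z) (\<omega> z) ws) us"
proof (induction us arbitrary: \<omega>)
  case (Cons u us)
  let ?M = "mdir a b v \<phi> z"
  let ?\<omega> = "\<lambda>y ws. \<omega> y (u # ws) + contract_bel (\<phi> y) u (\<omega> y) ws"
  have sm: "smooth_lform S ?\<omega>"
    by (intro smooth_lform_add smooth_lform_Cons smooth_lform_contract_bel Cons.prems)
  have "ldir a b v ?\<omega> z ws + contract_rec ?M (?\<omega> z) ws
      = (ldir a b v \<omega> z (u # ws) + contract_rec ?M (\<omega> z) (u # ws))
        + contract_bel (\<phi> z) u (\<lambda>ws. ldir a b v \<omega> z ws + contract_rec ?M (\<omega> z) ws) ws" for ws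
    using Cons.prems
    by (simp add: ldir_add smooth_lform_Cons smooth_lform_contract_bel ldir_contract_bel ldir_Cons
        contract_bel_add contract_rec_add contract_bel_contract_rec)
  then show ?case
    using Cons.IH[OF Cons.prems(1) sm] by (simp add: ldir_def)
qed (simp add: ldir_def)

lemma ldir_contract_rec:
  "smooth_matrix S \<phi> \<Longrightarrow> smooth_lform S \<omega> \<Longrightarrow> ldir a b v (\<lambda>y. contract_rec (\<phi> y) (\<omega> y)) z us
    = contract_rec (mdir a b v \<phi> z) (\<omega> z) us + contract_rec (\<phi> z) (ldir a b v \<omega> z) us"
proof (induction us arbitrary: \<omega>)
  case Nil
  then show ?case by (simp add: ldir_def cdir_const)
next
  case (Cons u us)
  have "ldir a b v (\<lambda>y. contract_rec (\<phi> y) (\<omega> y)) z (u # us)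
      = ldir a b v (\<lambda>y ws. contract_bel (\<phi> y) u (\<omega> y) ws + contract_rec (\<phi> y) (\<lambda>ws. \<omega> y (u # ws)) ws) z us"
    by (simp add: ldir_def)
  also have "\<dots> = ldir a b v (\<lambda>y. contract_bel (\<phi> y) u (\<omega> y)) z us
      + ldir a b v (\<lambda>y. contract_rec (\<phi> y) (\<lambda>ws. \<omega> y (u # ws))) z us"
    by (intro ldir_add smooth_lform_contract_bel smooth_lform_contract_rec smooth_lform_Cons Cons.prems)
  finally show ?case
    using Cons.IH[OF Cons.prems(1) smooth_lform_Cons[OF Cons.prems(2)], of u] Cons.prems
    by (simp add: ldir_contract_bel ldir_Cons_fun)
qed

lemma ext_d_add: "smooth_lform S \<omega> \<Longrightarrow> smooth_lform S \<eta> \<Longrightarrow>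
    ext_d a b (\<lambda>y ws. \<omega> y ws + \<eta> y ws) z us = ext_d a b \<omega> z us + ext_d a b \<eta> z us"
  by (induction us arbitrary: \<omega> \<eta>) (simp_all add: ldir_add smooth_lform_Cons)

lemma ext_d_cmult: "smooth_lform S \<omega> \<Longrightarrow> ext_d a b (\<lambda>y ws. c * \<omega> y ws) z us = c * ext_d a b \<omega> z us"
  by (induction us arbitrary: \<omega>) (simp_all add: ldir_cmult smooth_lform_Cons algebra_simps)

lemma ext_d_uminus: "smooth_lform S \<omega> \<Longrightarrow> ext_d a b (\<lambda>y ws. - \<omega> y ws) z us = - ext_d a b \<omega> z us"
  using ext_d_cmult[of \<omega> a b "-1"] by simp

lemma ext_d_diff: "smooth_lform S \<omega> \<Longrightarrow> smooth_lform S \<eta> \<Longrightarrow>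
    ext_d a b (\<lambda>y ws. \<omega> y ws - \<eta> y ws) z us = ext_d a b \<omega> z us - ext_d a b \<eta> z us"
  using ext_d_add[of \<omega> "\<lambda>y ws. - \<eta> y ws"] by (simp add: smooth_lform_uminus ext_d_uminus)

lemma ext_d_zero: "ext_d a b (\<lambda>_ _. 0) z us = 0"
  by (induction us) (simp_all add: ldir_def cdir_const)

lemma ext_d_sgn_form: "smooth_lform S \<omega> \<Longrightarrow> ext_d a b (\<lambda>y. sgn_form (\<omega> y)) z us = - sgn_form (ext_d a b \<omega> z) us"
proof (induction us arbitrary: \<omega>)
  case (Cons v us)
  have "(\<lambda>y ws. sgn_form (\<omega> y) (v # ws)) = (\<lambda>y ws. - sgn_form (\<lambda>ws. \<omega> y (v # ws)) ws)"
    by (simp add: sgn_form_def)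
  then have "ext_d a b (\<lambda>y. sgn_form (\<omega> y)) z (v # us)
      = sgn_form (ldir a b v \<omega> z) us - sgn_form (ext_d a b (\<lambda>y ws. \<omega> y (v # ws)) z) us"
    by (simp add: ldir_sgn_form Cons ext_d_uminus smooth_lform_sgn_form smooth_lform_Cons)
  also have "\<dots> = - sgn_form (ext_d a b \<omega> z) (v # us)" by (simp add: sgn_form_def algebra_simps)
  finally show ?case .
qed (simp add: sgn_form_def)

text \<open>Cartan's recursion reduces the rule to the Leibniz rule along v
  (\<open>ldir_wedge\<close>) and to the contracted factors. The signs fit because contraction and
  \<open>ext_d\<close> both anticommute with \<open>sgn_form\<close>.\<close>

lemma ext_d_wedge:
  "smooth_lform S \<omega> \<Longrightarrow> smooth_lform S \<eta> \<Longrightarrow> ext_d a b (\<lambda>y. wedge (\<omega> y) (\<eta> y)) z us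
    = wedge (ext_d a b \<omega> z) (\<eta> z) us + wedge (sgn_form (\<omega> z)) (ext_d a b \<eta> z) us"
proof (induction us arbitrary: \<omega> \<eta>)
  case Nil
  then show ?case by simp
next
  case (Cons v us)
  note sm = smooth_lform_Cons[OF Cons.prems(1), of v] smooth_lform_Cons[OF Cons.prems(2), of v] smooth_lform_sgn_form[OF Cons.prems(1)]
  have sgn: "ext_d a b (\<lambda>y. sgn_form (\<omega> y)) z = (\<lambda>ws. - sgn_form (ext_d a b \<omega> z) ws)"
    by (intro ext) (rule ext_d_sgn_form[OF Cons.prems(1)])
  have "ext_d a b (\<lambda>y. wedge (\<omega> y) (\<eta> y)) z (v # us)
    = ldir a b v (\<lambda>y. wedge (\<omega> y) (\<eta> y)) z us
      - ext_d a b (\<lambda>y ws. wedge (\<lambda>ws. \<omega> y (v # ws)) (\<eta> y) ws + wedge (sgn_form (\<omega> y)) (\<lambda>ws. \<eta> y (v # ws)) ws) z us"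
    by (simp add: wedge_Cons)
  also have "\<dots> = ldir a b v (\<lambda>y. wedge (\<omega> y) (\<eta> y)) z us
      - (ext_d a b (\<lambda>y. wedge (\<lambda>ws. \<omega> y (v # ws)) (\<eta> y)) z us
        + ext_d a b (\<lambda>y. wedge (sgn_form (\<omega> y)) (\<lambda>ws. \<eta> y (v # ws))) z us)"
    by (subst ext_d_add) (intro smooth_lform_wedge sm Cons.prems refl)+
  also have "\<dots> = wedge (ext_d a b \<omega> z) (\<eta> z) (v # us) + wedge (sgn_form (\<omega> z)) (ext_d a b \<eta> z) (v # us)"
    unfolding Cons.IH[OF sm(1) Cons.prems(2)] Cons.IH[OF sm(3,2)] ldir_wedge[OF Cons.prems] sgn wedge_Cons
      sgn_form_sgn_form sgn_form_Cons wedge_uminus_left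
    by (simp add: wedge_diff_left wedge_diff_right)
  finally show ?case .
qed

end

section \<open>Square zero and alternation of the derivatives\<close>

lemma ldir_commute:
  assumes "smooth_lform S \<omega>" "z \<in> S"
  shows "ldir a b u (ldir a b v \<omega>) z us = ldir a b v (ldir a b u \<omega>) z us"
proof -
  let ?f = "\<lambda>y. \<omega> y us"
  have sm: "smooth_on S ?f" using assms(1) by (simp add: smooth_lform_def)
  have d: "(\<lambda>y. D ?f y w) differentiable (at z)" for w
    by (rule smooth_on_differentiable[OF smooth_on_D[OF sm] assms(2)])
  have sym: "D (\<lambda>y. D ?f y u) z v = D (\<lambda>y. D ?f y v) z u" for u v
    by (rule second_derivative_symmetric[OF S assms(2) smooth_on_differentiable[OF sm] d d])
  have *: "cdir a b w (\<lambda>y. cdir a b x ?f y) z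
    = a * cdir a b w (\<lambda>y. D ?f y x) z + b * cdir a b w (\<lambda>y. D ?f y (rot x)) z" for w x
    unfolding cdir_def[of a b x ?f] using d by (simp add: cdir_add cdir_cmult)
  show ?thesis
    unfolding ldir_def * by (simp add: cdir_def sym[of v] sym[of "rot v"] algebra_simps)
qed

lemma ext_d_ldir:
  "smooth_lform S \<omega> \<Longrightarrow> z \<in> S \<Longrightarrow> ext_d a b (ldir a b v \<omega>) z us = ldir a b v (ext_d a b \<omega>) z us"
proof (induction us arbitrary: \<omega>)
  case Nil
  then show ?case by (simp add: ldir_def cdir_const)
next
  case (Cons u us)
  note sm = smooth_lform_Cons[OF Cons.prems(1), of u]
  have L: "(\<lambda>y ws. ldir a b v \<omega> y (u # ws)) = ldir a b v (\<lambda>y ws. \<omega> y (u # ws))"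
    by (simp add: ldir_def fun_eq_iff)
  have "ldir a b v (ext_d a b \<omega>) z (u # us)
    = ldir a b v (\<lambda>y ws. ldir a b u \<omega> y ws + (- 1) * ext_d a b (\<lambda>y ws. \<omega> y (u # ws)) y ws) z us"
    by (simp add: ldir_def)
  also have "\<dots> = ldir a b v (ldir a b u \<omega>) z us - ldir a b v (ext_d a b (\<lambda>y ws. \<omega> y (u # ws))) z us"
    using ldir_add[OF Cons.prems(2) smooth_lform_ldir[OF Cons.prems(1)] smooth_lform_cmult[OF smooth_lform_ext_d[OF sm]], of a b v a b u "-1" a b us]
      ldir_cmult[OF Cons.prems(2) smooth_lform_ext_d[OF sm], of a b v "-1" a b us]
    by simp
  also have "\<dots> = ext_d a b (ldir a b v \<omega>) z (u # us)"
    using Cons.IH[OF sm Cons.prems(2)] ldir_commute[OF Cons.prems] by (simp add: L)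
  finally show ?case by simp
qed

text \<open>Write L for the derivative along v and c for contraction with v. Cartan's formula twice
  gives c d d = L d - d L + d d c; the first two terms cancel by \<open>ext_d_ldir\<close>, and the
  last is the induction hypothesis.\<close>

lemma ext_d_ext_d: "smooth_lform S \<omega> \<Longrightarrow> z \<in> S \<Longrightarrow> ext_d a b (ext_d a b \<omega>) z us = 0"
proof (induction us arbitrary: \<omega>)
  case (Cons v us)
  note sm = smooth_lform_Cons[OF Cons.prems(1), of v]
  show ?case
    using Cons.IH[OF sm Cons.prems(2)] Cons.prems sm
    by (simp add: ext_d_diff[OF Cons.prems(2)] smooth_lform_ldir smooth_lform_ext_d ext_d_ldir)
qed simp

lemma alternating_ext_d:
  assumes "smooth_lform S \<omega>" "\<And>y. y \<in> S \<Longrightarrow> alternating (\<omega> y)" "z \<in> S"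
  shows "alternating (ext_d a b \<omega> z)"
proof (rule alternatingI)
  show "linear (\<lambda>v. ext_d a b \<omega> z (us @ v # ws))" for us ws
    using assms
  proof (induction us arbitrary: \<omega>)
    case Nil
    note sm = smooth_lform_Cons[OF Nil(1)]
    have lin: "linear (D (\<lambda>y. \<omega> y ws) z)" by (rule D_linear[OF smooth_lform_D[OF Nil(1,3)]])
    have "ext_d a b (\<lambda>y us. \<omega> y ((v + w) # us)) z ws
      = ext_d a b (\<lambda>y us. \<omega> y (v # us) + \<omega> y (w # us)) z ws" for v w
      by (rule ext_d_cong[OF Nil(3)]) (rule linear_add[OF alternating_linear_hd[OF Nil(2)]])
    moreover have "ext_d a b (\<lambda>y us. \<omega> y ((r *\<^sub>R v) # us)) z ws
      = ext_d a b (\<lambda>y us. of_real r * \<omega> y (v # us)) z ws" for r v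
      by (rule ext_d_cong[OF Nil(3)]) (simp add: linear_cmul[OF alternating_linear_hd[OF Nil(2)]] complex_scaleR)
    ultimately have "linear (\<lambda>v. ext_d a b (\<lambda>y us. \<omega> y (v # us)) z ws)"
      by (intro linearI) (simp_all add: ext_d_add[OF Nil(3)] ext_d_cmult[OF Nil(3)] sm complex_scaleR)
    moreover have "linear (\<lambda>v. ldir a b v \<omega> z ws)"
      unfolding ldir_def cdir_def
      using linear_cmult linear_compose_add lin linear_compose[OF linear_rot lin, unfolded o_def] by blast
    ultimately show ?case by (simp add: linear_compose_sub)
  next
    case (Cons u us)
    have "linear (\<lambda>v. ldir a b u \<omega> z (us @ v # ws))"
    proof (rule linearI)
      note d = smooth_lform_D[OF Cons.prems(1,3)]
      show "ldir a b u \<omega> z (us @ (v + w) # ws) = ldir a b u \<omega> z (us @ v # ws) + ldir a b u \<omega> z (us @ w # ws)" for v w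
        unfolding ldir_def cdir_add[OF d d, symmetric]
        by (rule cdir_cong[OF Cons.prems(3)]) (rule linear_add[OF alternating_linear[OF Cons.prems(2)]])
      show "ldir a b u \<omega> z (us @ (r *\<^sub>R v) # ws) = r *\<^sub>R ldir a b u \<omega> z (us @ v # ws)" for r v
        unfolding ldir_def complex_scaleR cdir_cmult[OF d, symmetric]
        by (rule cdir_cong[OF Cons.prems(3)])
          (simp add: linear_cmul[OF alternating_linear[OF Cons.prems(2)]] complex_scaleR)
    qed
    moreover have "linear (\<lambda>v. ext_d a b (\<lambda>y ws. \<omega> y (u # ws)) z (us @ v # ws))"
      by (rule Cons.IH) (use Cons.prems in \<open>auto intro: smooth_lform_Cons alternating_Cons\<close>)
    ultimately show ?case by (simp add: linear_compose_sub)
  qed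
  show "ext_d a b \<omega> z (us @ v # v # ws) = 0" for us v ws
    using assms
  proof (induction us arbitrary: \<omega>)
    case Nil
    \<comment> \<open>When the recursion is unfolded twice, the two derivatives along v cancel and
      only this term remains.\<close>
    have "ext_d a b (\<lambda>y us. \<omega> y (v # v # us)) z ws = ext_d a b (\<lambda>_ _. 0) z ws"
      by (rule ext_d_cong[OF Nil(3)]) (simp add: alternating_not_distinct[OF Nil(2)])
    then show ?case by (simp add: ldir_def ext_d_zero[OF Nil(3)])
  next
    case (Cons u us)
    have "ldir a b u \<omega> z (us @ v # v # ws) = cdir a b u (\<lambda>_. 0) z"
      unfolding ldir_def by (rule cdir_cong[OF Cons.prems(3)]) (simp add: alternating_not_distinct[OF Cons.prems(2)])
    moreover have "ext_d a b (\<lambda>y ws. \<omega> y (u # ws)) z (us @ v # v # ws) = 0"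
      by (rule Cons.IH) (use Cons.prems in \<open>auto intro: smooth_lform_Cons alternating_Cons\<close>)
    ultimately show ?case by (simp add: cdir_const)
  qed
qed

end

subsection \<open>Naturality under holomorphic maps\<close>

text \<open>\<open>osum X [u\<^sub>0, u\<^sub>1, \<dots>]\<close> is the alternating sum of \<open>X u\<^sub>k\<close> at the list without \<open>u\<^sub>k\<close>.\<close>

primrec osum :: "('v \<Rightarrow> 'v list \<Rightarrow> complex) \<Rightarrow> 'v list \<Rightarrow> complex" where
  "osum X [] = 0"
| "osum X (v # us) = X v us - osum (\<lambda>u ws. X u (v # ws)) us"

lemma osum_add: "osum (\<lambda>u ws. X u ws + Y u ws) us = osum X us + osum Y us"
  by (induction us arbitrary: X Y) simp_all

lemma osum_uminus: "osum (\<lambda>u ws. - X u ws) us = - osum X us"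
  by (induction us arbitrary: X) simp_all

lemma osum_cmult: "osum (\<lambda>u ws. c * X u ws) us = c * osum X us"
  by (induction us arbitrary: X) (simp_all add: right_diff_distrib)

lemma osum_map: "osum (\<lambda>u ws. X (A u) (map A ws)) us = osum X (map A us)"
proof (induction us arbitrary: X)
  case (Cons v us)
  show ?case using Cons[of "\<lambda>u ws. X u (A v # ws)"] by simp
qed simp

text \<open>Omitting two positions in either order leaves the same list, with opposite
  signs.\<close>

lemma osum_osum_symmetric:
  assumes "\<And>u v ws. H u v ws = H v u ws"
  shows "osum (\<lambda>u. osum (H u)) us = 0"
  using assms
proof (induction us arbitrary: H)
  case (Cons v us)
  have "osum (\<lambda>u. osum (\<lambda>w xs. H u w (v # xs))) us = 0"
    by (rule Cons.IH) (rule Cons.prems)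
  moreover have "(\<lambda>u. H u v) = H v" using Cons.prems by (intro ext) auto
  ultimately show ?case
    using osum_add[of "\<lambda>u. H u v" "\<lambda>u ws. - osum (\<lambda>w xs. H u w (v # xs)) ws" us]
    by (simp add: osum_uminus)
qed simp

lemma ext_d_osum: "ext_d a b \<omega> z us = osum (\<lambda>u. ldir a b u \<omega> z) us"
  by (induction us arbitrary: \<omega>) (simp_all add: ldir_def[abs_def])

text \<open>These are the Leibniz terms of \<gamma> (A v, A w, ...) when A varies with derivative B:
  one argument passes through B, the others through A.\<close>

primrec slot_sum :: "('v \<Rightarrow> 'w) \<Rightarrow> ('v \<Rightarrow> 'w) \<Rightarrow> ('w list \<Rightarrow> complex) \<Rightarrow> 'v list \<Rightarrow> complex" where
  "slot_sum A B \<gamma> [] = 0"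
| "slot_sum A B \<gamma> (v # us) = \<gamma> (B v # map A us) + slot_sum A B (\<lambda>ws. \<gamma> (A v # ws)) us"

text \<open>Alternation carries the argument mapped by B to the front; the sign of this move is the
  one in \<open>osum\<close>.\<close>

lemma slot_sum_osum:
  "alternating \<gamma> \<Longrightarrow> slot_sum A B \<gamma> us = osum (\<lambda>v ws. \<gamma> (B v # map A ws)) us"
proof (induction us arbitrary: \<gamma>)
  case (Cons v us)
  have "osum (\<lambda>w ws. \<gamma> (A v # B w # map A ws)) us = - osum (\<lambda>w ws. \<gamma> (B w # A v # map A ws)) us"
    unfolding osum_uminus[symmetric] by (subst alternating_swap[OF Cons.prems]) simp
  then show ?case
    using Cons.IH[OF alternating_Cons[OF Cons.prems, of "A v"]] by simp
qed simp

lemma slot_sum_add: "slot_sum A B (\<lambda>ws. \<gamma> ws + \<delta> ws) us = slot_sum A B \<gamma> us + slot_sum A B \<delta> us"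
  by (induction us arbitrary: \<gamma> \<delta>) simp_all

lemma slot_sum_cmult: "slot_sum A B (\<lambda>ws. c * \<gamma> ws) us = c * slot_sum A B \<gamma> us"
  by (induction us arbitrary: \<gamma>) (simp_all add: distrib_left)

lemma slot_sum_zero: "slot_sum A B (\<lambda>ws. 0) us = 0"
  by (induction us) simp_all

lemma slot_sum_sum: "slot_sum A B (\<lambda>ws. \<Sum>i\<in>I. \<gamma> i ws) us = (\<Sum>i\<in>I. slot_sum A B (\<gamma> i) us)"
  by (induction I rule: infinite_finite_induct) (simp_all add: slot_sum_add slot_sum_zero)

lemma linear_Basis_expand:
  fixes f :: "'v::euclidean_space \<Rightarrow> complex"
  assumes "linear f"
  shows "f w = (\<Sum>b\<in>Basis. of_real (w \<bullet> b) * f b)"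
proof -
  have "f w = f (\<Sum>b\<in>Basis. (w \<bullet> b) *\<^sub>R b)" by (simp add: euclidean_representation)
  then show ?thesis by (simp add: linear_sum[OF assms] linear_cmul[OF assms] complex_scaleR)
qed

text \<open>Base point and arguments vary together. Expanding the leading argument in a real basis
  splits off scalar factors and leaves forms with a constant leading argument, to which the
  induction applies. Alternation holds only on T, hence the passage to a neighbourhood.\<close>

lemma has_derivative_pullback:
  fixes f :: "complex^'n::finite \<Rightarrow> complex^'n" and A :: "complex^'n \<Rightarrow> complex^'n \<Rightarrow> complex^'n"
  assumes T: "open T" "f z \<in> T" and f: "f differentiable (at z)"
    and A: "\<And>v. (\<lambda>y. A y v) differentiable (at z)"
  shows "smooth_lform T \<eta> \<Longrightarrow> (\<And>y. y \<in> T \<Longrightarrow> alternating (\<eta> y)) \<Longrightarrow>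
    ((\<lambda>y. \<eta> (f y) (map (A y) us)) has_derivative
      (\<lambda>u. D (\<lambda>y. \<eta> y (map (A z) us)) (f z) (D f z u) + slot_sum (A z) (\<lambda>v. D (\<lambda>y. A y v) z u) (\<eta> (f z)) us)) (at z)"
proof (induction us arbitrary: \<eta>)
  case Nil
  show ?case
    using has_derivative_compose[OF has_derivative_D[OF f] has_derivative_D[OF smooth_lform_D[OF T(1) Nil(1) T(2)]]]
    by simp
next
  case (Cons v us)
  have linA: "((\<lambda>y. complex_of_real (A y v \<bullet> b)) has_derivative (\<lambda>u. of_real (D (\<lambda>y. A y v) z u \<bullet> b))) (at z)" for b
    by (intro has_derivative_of_real has_derivative_inner_left has_derivative_D A)
  have IH: "((\<lambda>y. \<eta> (f y) (b # map (A y) us)) has_derivative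
      (\<lambda>u. D (\<lambda>y. \<eta> y (b # map (A z) us)) (f z) (D f z u) + slot_sum (A z) (\<lambda>v. D (\<lambda>y. A y v) z u) (\<lambda>ws. \<eta> (f z) (b # ws)) us)) (at z)" for b
    by (rule Cons.IH) (use Cons.prems in \<open>auto intro: smooth_lform_Cons[OF T(1)] alternating_Cons\<close>)
  have ev: "eventually (\<lambda>y. f y \<in> T) (at z)"
    using differentiable_imp_continuous_within[OF f] T
    by (simp add: continuous_within topological_tendstoD)
  have sum: "((\<lambda>y. \<Sum>b\<in>Basis. of_real (A y v \<bullet> b) * \<eta> (f y) (b # map (A y) us)) has_derivative
     (\<lambda>u. \<Sum>b\<in>Basis. of_real (A z v \<bullet> b) * (D (\<lambda>y. \<eta> y (b # map (A z) us)) (f z) (D f z u)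
            + slot_sum (A z) (\<lambda>v. D (\<lambda>y. A y v) z u) (\<lambda>ws. \<eta> (f z) (b # ws)) us)
        + of_real (D (\<lambda>y. A y v) z u \<bullet> b) * \<eta> (f z) (b # map (A z) us))) (at z)"
    by (intro has_derivative_sum has_derivative_mult linA IH)
  have "((\<lambda>y. \<eta> (f y) (A y v # map (A y) us)) has_derivative
     (\<lambda>u. \<Sum>b\<in>Basis. of_real (A z v \<bullet> b) * (D (\<lambda>y. \<eta> y (b # map (A z) us)) (f z) (D f z u)
            + slot_sum (A z) (\<lambda>v. D (\<lambda>y. A y v) z u) (\<lambda>ws. \<eta> (f z) (b # ws)) us)
        + of_real (D (\<lambda>y. A y v) z u \<bullet> b) * \<eta> (f z) (b # map (A z) us))) (at z)"
  proof (rule has_derivative_transform_eventually[OF sum])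
    show "\<forall>\<^sub>F y in at z. (\<Sum>b\<in>Basis. of_real (A y v \<bullet> b) * \<eta> (f y) (b # map (A y) us)) = \<eta> (f y) (A y v # map (A y) us)"
      by (rule eventually_mono[OF ev]) (rule linear_Basis_expand[OF alternating_linear_hd[OF Cons.prems(2)], symmetric])
    show "(\<Sum>b\<in>Basis. of_real (A z v \<bullet> b) * \<eta> (f z) (b # map (A z) us)) = \<eta> (f z) (A z v # map (A z) us)"
      by (rule linear_Basis_expand[OF alternating_linear_hd[OF Cons.prems(2)[OF T(2)]], symmetric])
  qed simp
  moreover have "(\<Sum>b\<in>Basis. of_real (A z v \<bullet> b) * (D (\<lambda>y. \<eta> y (b # map (A z) us)) (f z) (D f z u)
            + slot_sum (A z) (\<lambda>v. D (\<lambda>y. A y v) z u) (\<lambda>ws. \<eta> (f z) (b # ws)) us)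
        + of_real (D (\<lambda>y. A y v) z u \<bullet> b) * \<eta> (f z) (b # map (A z) us))
     = D (\<lambda>y. \<eta> y (map (A z) (v # us))) (f z) (D f z u) + slot_sum (A z) (\<lambda>v. D (\<lambda>y. A y v) z u) (\<eta> (f z)) (v # us)" for u
  proof -
    have d: "(\<lambda>y. \<eta> y ws) differentiable (at (f z))" for ws
      by (rule smooth_lform_D[OF T(1) Cons.prems(1) T(2)])
    have 1: "D (\<lambda>y. \<eta> y (A z v # map (A z) us)) (f z) w
        = (\<Sum>b\<in>Basis. of_real (A z v \<bullet> b) * D (\<lambda>y. \<eta> y (b # map (A z) us)) (f z) w)" for w
    proof -
      have "((\<lambda>y. \<Sum>b\<in>Basis. of_real (A z v \<bullet> b) * \<eta> y (b # map (A z) us)) has_derivative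
         (\<lambda>w. \<Sum>b\<in>Basis. of_real (A z v \<bullet> b) * D (\<lambda>y. \<eta> y (b # map (A z) us)) (f z) w)) (at (f z))"
        by (intro has_derivative_sum has_derivative_mult_right has_derivative_D d)
      moreover have "D (\<lambda>y. \<eta> y (A z v # map (A z) us)) (f z)
        = D (\<lambda>y. \<Sum>b\<in>Basis. of_real (A z v \<bullet> b) * \<eta> y (b # map (A z) us)) (f z)"
        by (rule D_cong[OF T]) (rule linear_Basis_expand[OF alternating_linear_hd[OF Cons.prems(2)]])
      ultimately show ?thesis by (simp add: D_eq)
    qed
    have 2: "\<eta> (f z) (D (\<lambda>y. A y v) z u # map (A z) us) = (\<Sum>b\<in>Basis. of_real (D (\<lambda>y. A y v) z u \<bullet> b) * \<eta> (f z) (b # map (A z) us))"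
      by (rule linear_Basis_expand[OF alternating_linear_hd[OF Cons.prems(2)[OF T(2)]]])
    have "(\<lambda>ws. \<eta> (f z) (A z v # ws)) = (\<lambda>ws. \<Sum>b\<in>Basis. of_real (A z v \<bullet> b) * \<eta> (f z) (b # ws))"
      by (intro ext linear_Basis_expand[OF alternating_linear_hd[OF Cons.prems(2)[OF T(2)]]])
    then have 3: "slot_sum (A z) B (\<lambda>ws. \<eta> (f z) (A z v # ws)) us
        = (\<Sum>b\<in>Basis. of_real (A z v \<bullet> b) * slot_sum (A z) B (\<lambda>ws. \<eta> (f z) (b # ws)) us)" for B
      by (simp only: slot_sum_sum slot_sum_cmult)
    show ?thesis
      by (simp add: 1 2 3 sum.distrib distrib_left)
  qed
  ultimately show ?case by simp
qed

text \<open>The chain rule adds terms with the second derivative B of f. They form a double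
  alternating sum with symmetric entries, because B is symmetric and \<open>holo\<close> makes it
  commute with \<open>rot\<close>, and so they drop out.\<close>

lemma ext_d_pullback:
  fixes f :: "complex^'n::finite \<Rightarrow> complex^'n"
  assumes S: "open S" "z \<in> S" and T: "open T" "f ` S \<subseteq> T"
    and f: "smooth_on S f" and holo: "\<And>y v. y \<in> S \<Longrightarrow> D f y (rot v) = rot (D f y v)"
    and \<eta>: "smooth_lform T \<eta>" "\<And>y. y \<in> T \<Longrightarrow> alternating (\<eta> y)"
  shows "ext_d a b (\<lambda>y us. \<eta> (f y) (map (D f y) us)) z us = ext_d a b \<eta> (f z) (map (D f z) us)"
proof -
  define B where "B u v = D (\<lambda>y. D f y v) z u" for u v
  have df: "f differentiable (at y)" if "y \<in> S" for y by (rule smooth_on_differentiable[OF f that])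
  have dD: "(\<lambda>y. D f y v) differentiable (at z)" for v
    by (rule smooth_on_differentiable[OF smooth_on_D[OF f] S(2)])
  have fz: "f z \<in> T" using S T by blast
  have B_sym: "B u v = B v u" for u v
    unfolding B_def by (rule second_derivative_symmetric[OF S df dD dD])
  have B_rot: "B u (rot v) = rot (B u v)" for u v
  proof -
    have "bounded_linear (rot :: complex^'n \<Rightarrow> complex^'n)"
      using linear_rot linear_conv_bounded_linear by blast
    then have "D (\<lambda>y. rot (D f y v)) z u = rot (B u v)"
      unfolding B_def by (rule D_bounded_linear[OF _ dD])
    then show ?thesis
      unfolding B_def using D_cong[OF S, of "\<lambda>y. D f y (rot v)" "\<lambda>y. rot (D f y v)"] holo by simp
  qed
  have D: "D (\<lambda>y. \<eta> (f y) (map (D f y) ws)) z u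
    = D (\<lambda>y. \<eta> y (map (D f z) ws)) (f z) (D f z u) + slot_sum (D f z) (B u) (\<eta> (f z)) ws" for u ws
    unfolding B_def by (subst D_eq[OF has_derivative_pullback[OF T(1) fz df[OF S(2)] dD \<eta>]]) auto
  define H where "H u v ws = a * \<eta> (f z) (B u v # map (D f z) ws) + b * \<eta> (f z) (B (rot u) v # map (D f z) ws)" for u v ws
  have "ldir a b u (\<lambda>y us. \<eta> (f y) (map (D f y) us)) z ws
      = ldir a b (D f z u) \<eta> (f z) (map (D f z) ws) + osum (H u) ws" for u ws
    unfolding ldir_def cdir_def D slot_sum_osum[OF \<eta>(2)[OF fz]] H_def
    by (simp add: holo[OF S(2)] osum_add osum_cmult algebra_simps)
  then have eq: "(\<lambda>u. ldir a b u (\<lambda>y us. \<eta> (f y) (map (D f y) us)) z)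
      = (\<lambda>u ws. ldir a b (D f z u) \<eta> (f z) (map (D f z) ws) + osum (H u) ws)"
    by (intro ext)
  have "ext_d a b (\<lambda>y us. \<eta> (f y) (map (D f y) us)) z us
      = osum (\<lambda>u ws. ldir a b (D f z u) \<eta> (f z) (map (D f z) ws)) us + osum (\<lambda>u. osum (H u)) us"
    unfolding ext_d_osum eq osum_add ..
  also have "osum (\<lambda>u. osum (H u)) us = 0"
  proof (rule osum_osum_symmetric)
    \<comment> \<open>Both sides equal \<open>rot (B u v)\<close>, by the symmetry of B and
      \<open>B_rot\<close>.\<close>
    have "B (rot u) v = B (rot v) u" for u v
      using B_sym[of "rot u" v] B_rot[of v u] B_sym[of v u] B_rot[of u v] B_sym[of u "rot v"] by simp
    then show "H u v ws = H v u ws" for u v ws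
      unfolding H_def using B_sym by metis
  qed
  finally show ?thesis
    by (simp add: ext_d_osum osum_map[of "\<lambda>u. ldir a b u \<eta> (f z)"])
qed

subsection \<open>Conjugation of the exterior derivative by the exponential\<close>

lemma row_form_mdir:
  assumes "open S" "z \<in> S" "smooth_matrix S \<phi>"
  shows "ldir a b v (\<lambda>y. row_form j (\<phi> y)) z = row_form j (mdir a b v \<phi> z)"
proof
  fix us
  have "ldir a b v (\<lambda>y. row_form j (\<phi> y)) z us = (\<Sum>k\<in>UNIV. cdir a b v (\<lambda>y. dz_bar k us * \<phi> y $ j $ k) z)"
    unfolding ldir_def row_form_def
    by (subst cdir_sum[symmetric]) (simp_all add: mult.commute smooth_matrix_D[OF assms(1,3,2)])
  then show "ldir a b v (\<lambda>y. row_form j (\<phi> y)) z us = row_form j (mdir a b v \<phi> z) us"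
    by (simp add: row_form_def mdir_def cdir_cmult smooth_matrix_D[OF assms(1,3,2)] mult.commute)
qed

text \<open>This is d e^{i\<phi>} = e^{i\<phi>} d_\<phi> in a chart. Differentiating the exponential
  produces contractions with the derivatives of \<phi>, and \<open>contract_exp_dz\<close> replaces
  dz^i by dz^i - \<phi>^i inside it. The terms in which \<phi>^i multiplies the contraction with
  \<partial>_i \<phi> cancel by integrability against those in which dzbar^i multiplies the
  contraction with \<partial>bar_i \<phi>.\<close>

lemma ext_d_contract_exp:
  fixes \<phi> :: "complex^'n::finite \<Rightarrow> complex^'n^'n"
  assumes S: "open S" "z \<in> S" and \<phi>: "smooth_matrix S \<phi>"
    and \<omega>: "smooth_lform S \<omega>" "\<And>y. y \<in> S \<Longrightarrow> alternating (\<omega> y)"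
    and int: "\<And>j us. delbar_local (\<lambda>y. row_form j (\<phi> y)) z us = 1 / 2 * bracket_local \<phi> \<phi> j z us"
  shows "ext_d 1 0 (\<lambda>y. contract_exp (\<phi> y) (\<omega> y)) z us
    = contract_exp (\<phi> z) (\<lambda>ws. ext_d 1 0 \<omega> z ws - contract_rec (\<phi> z) (ext_d (1/2) (-\<i>/2) \<omega> z) ws
        + ext_d (1/2) (-\<i>/2) (\<lambda>y. contract_rec (\<phi> y) (\<omega> y)) z ws) us"
proof -
  define p where "p i = ldir (1/2) (-\<i>/2) (axis i 1) \<omega> z" for i
  define q where "q i = ldir (1/2) (\<i>/2) (axis i 1) \<omega> z" for i
  define P where "P i = mdir (1/2) (-\<i>/2) (axis i 1) \<phi> z" for i
  define Q where "Q i = mdir (1/2) (\<i>/2) (axis i 1) \<phi> z" for i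
  let ?N = "contract_rec (\<phi> z)" and ?E = "contract_exp (\<phi> z)" and ?\<omega> = "\<omega> z"
  let ?row = "\<lambda>i. row_form i (\<phi> z)"
  have del: "ext_d (1/2) (-\<i>/2) \<eta> z us = (\<Sum>i\<in>UNIV. wedge (dz i) (ldir (1/2) (-\<i>/2) (axis i 1) \<eta> z) us)"
    if "smooth_lform S \<eta>" for \<eta> us
    by (subst del_local_eq[symmetric, OF smooth_lform_D[OF S(1) that S(2)]]) (simp add: del_local_def lform_wirt_eq)
  have delbar: "ext_d (1/2) (\<i>/2) \<eta> z us = (\<Sum>i\<in>UNIV. wedge (dz_bar i) (ldir (1/2) (\<i>/2) (axis i 1) \<eta> z) us)"
    if "smooth_lform S \<eta>" for \<eta> us
    by (subst delbar_local_eq[symmetric, OF smooth_lform_D[OF S(1) that S(2)]]) (simp add: delbar_local_def lform_wirt_bar_eq)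
  have d: "ext_d 1 0 \<eta> z us = ext_d (1/2) (-\<i>/2) \<eta> z us + ext_d (1/2) (\<i>/2) \<eta> z us" for \<eta> us
    using ext_d_add_coeff[of "1/2" "1/2" "-\<i>/2" "\<i>/2"] by simp
  have smE: "smooth_lform S (\<lambda>y. contract_exp (\<phi> y) (\<omega> y))" by (rule smooth_lform_contract_exp[OF S(1) \<phi> \<omega>(1)])
  have smN: "smooth_lform S (\<lambda>y. contract_rec (\<phi> y) (\<omega> y))" by (rule smooth_lform_contract_rec[OF S(1) \<phi> \<omega>(1)])
  have pE: "ldir (1/2) (-\<i>/2) (axis i 1) (\<lambda>y. contract_exp (\<phi> y) (\<omega> y)) z = ?E (\<lambda>ws. p i ws + contract_rec (P i) ?\<omega> ws)" for i
    unfolding p_def P_def by (intro ext ldir_contract_exp[OF S \<phi> \<omega>(1)])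
  have qE: "ldir (1/2) (\<i>/2) (axis i 1) (\<lambda>y. contract_exp (\<phi> y) (\<omega> y)) z = ?E (\<lambda>ws. q i ws + contract_rec (Q i) ?\<omega> ws)" for i
    unfolding q_def Q_def by (intro ext ldir_contract_exp[OF S \<phi> \<omega>(1)])
  have pN: "ldir (1/2) (-\<i>/2) (axis i 1) (\<lambda>y. contract_rec (\<phi> y) (\<omega> y)) z = (\<lambda>ws. contract_rec (P i) ?\<omega> ws + ?N (p i) ws)" for i
    unfolding p_def P_def by (intro ext ldir_contract_rec[OF S \<phi> \<omega>(1)])
  have dz: "wedge (dz i) (?E \<alpha>) us = ?E (wedge (\<lambda>us. dz i us - ?row i us) \<alpha>) us" for i \<alpha> us
    by (simp add: contract_exp_wedge contract_exp_dz)
  have dz_bar: "wedge (dz_bar i) (?E \<alpha>) us = ?E (wedge (dz_bar i) \<alpha>) us" for i \<alpha> us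
    by (simp add: contract_exp_wedge contract_exp_dz_bar)
  have lhs: "ext_d 1 0 (\<lambda>y. contract_exp (\<phi> y) (\<omega> y)) z us
    = ?E (\<lambda>ws. \<Sum>i\<in>UNIV. wedge (\<lambda>us. dz i us - ?row i us) (\<lambda>ws. p i ws + contract_rec (P i) ?\<omega> ws) ws
        + wedge (dz_bar i) (\<lambda>ws. q i ws + contract_rec (Q i) ?\<omega> ws) ws) us"
    unfolding d del[OF smE] delbar[OF smE] pE qE dz dz_bar sum.distrib[symmetric]
      contract_exp_add[symmetric] contract_exp_sum[symmetric] ..
  have N: "contract_rec M ?\<omega> = (\<lambda>ws. \<Sum>j\<in>UNIV. wedge (row_form j M) (contract_dz j ?\<omega>) ws)" for M
    by (intro ext) (simp add: contract_matrix_eq_contract_rec[OF \<omega>(2)[OF S(2)], symmetric] contract_matrix_def)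
  have row: "ldir a b v (\<lambda>y. row_form j (\<phi> y)) z = row_form j (mdir a b v \<phi> z)" for a b v j
    by (rule row_form_mdir[OF S \<phi>])
  \<comment> \<open>For equal arguments the two summands of the bracket coincide, which absorbs the
    factor 1/2.\<close>
  have int': "(\<Sum>i\<in>UNIV. wedge (dz_bar i) (row_form j (Q i)) ws) = (\<Sum>i\<in>UNIV. wedge (?row i) (row_form j (P i)) ws)" for j ws
    using int[of j ws] unfolding delbar_local_def bracket_local_def lform_wirt_bar_eq lform_wirt_eq row P_def Q_def
    by (simp add: sum_distrib_left[symmetric] mult.commute[of _ 2])
  \<comment> \<open>Associativity collects the coefficient form in front of each
    \<open>contract_dz j\<close>; these coefficients agree by \<open>int'\<close>.\<close>
  have cancel: "(\<Sum>i\<in>UNIV. wedge (dz_bar i) (contract_rec (Q i) ?\<omega>) ws) = (\<Sum>i\<in>UNIV. wedge (?row i) (contract_rec (P i) ?\<omega>) ws)" for ws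
  proof -
    have *: "(\<Sum>i\<in>UNIV. wedge (\<alpha> i) (contract_rec (R i) ?\<omega>) ws)
      = (\<Sum>j\<in>UNIV. wedge (\<lambda>ws. \<Sum>i\<in>UNIV. wedge (\<alpha> i) (row_form j (R i)) ws) (contract_dz j ?\<omega>) ws)"
      for \<alpha> :: "'n \<Rightarrow> 'n cform" and R
      unfolding N wedge_sum_right wedge_sum_left wedge_assoc by (rule sum.swap)
    show ?thesis unfolding * int' ..
  qed
  have "ext_d 1 0 \<omega> z ws - ?N (ext_d (1/2) (-\<i>/2) \<omega> z) ws
        + ext_d (1/2) (-\<i>/2) (\<lambda>y. contract_rec (\<phi> y) (\<omega> y)) z ws
    = (\<Sum>i\<in>UNIV. wedge (\<lambda>us. dz i us - ?row i us) (\<lambda>ws. p i ws + contract_rec (P i) ?\<omega> ws) ws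
        + wedge (dz_bar i) (\<lambda>ws. q i ws + contract_rec (Q i) ?\<omega> ws) ws)" for ws
  proof -
    \<comment> \<open>The contraction is a derivation that maps dz^i to \<phi>^i. The terms with
      \<open>?N (p i)\<close> cancel against those of \<partial> applied to the contracted
      form.\<close>
    have "?N (ext_d (1/2) (-\<i>/2) \<omega> z) ws = (\<Sum>i\<in>UNIV. wedge (?row i) (p i) ws + wedge (dz i) (?N (p i)) ws)"
      unfolding p_def del[OF \<omega>(1), abs_def] contract_rec_sum contract_rec_wedge contract_rec_dz ..
    then show ?thesis
      unfolding d del[OF \<omega>(1)] delbar[OF \<omega>(1)] del[OF smN] pN wedge_add_right wedge_diff_left p_def[symmetric] q_def[symmetric]
      by (simp add: sum.distrib sum_subtractf cancel algebra_simps)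
  qed
  then show ?thesis using lhs by simp
qed

section \<open>Forms on a complex manifold\<close>

declare split_paired_All [simp del] split_paired_Ex [simp del]

lemma smooth_on_components:
  fixes f :: "'v::real_normed_vector \<Rightarrow> complex^'n::finite"
  assumes "open S" "\<And>j. smooth_on S (\<lambda>z. f z $ j)"
  shows "smooth_on S f"
proof -
  have "bounded_linear (\<lambda>c. axis j c :: complex^'n)" for j
    by (intro linear_conv_bounded_linear[THEN iffD1] linearI) (simp_all add: vec_eq_iff axis_def)
  then have "smooth_on S (\<lambda>z. \<Sum>j\<in>UNIV. axis j (f z $ j))"
    using assms by (intro smooth_on_sum smooth_on_bounded_linear[of S "\<lambda>c. axis _ c"]) auto
  moreover have "(\<Sum>j\<in>UNIV. axis j (f z $ j)) = f z" for z
    by (simp add: vec_eq_iff axis_nth' sum_component if_distrib cong: if_cong)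
  ultimately show ?thesis by simp
qed

lemma smooth_matrix_of_smooth_on:
  assumes "open S" "smooth_on S \<phi>"
  shows "smooth_matrix S \<phi>"
  unfolding smooth_matrix_def
proof (intro allI)
  fix i j
  have "bounded_linear (\<lambda>M::complex^'a^'a. M $ i $ j)"
    using bounded_linear_compose[OF bounded_linear_vec_nth bounded_linear_vec_nth] by blast
  then show "smooth_on S (\<lambda>z. \<phi> z $ i $ j)"
    by (rule smooth_on_bounded_linear[OF assms(1) _ assms(2)])
qed

definition homogeneous_part :: "nat \<Rightarrow> ('a, 'n) form \<Rightarrow> ('a, 'n) form" where
  "homogeneous_part k \<omega> c z us = (if length us = k then \<omega> c z us else 0)"

section \<open>Charts and transition maps\<close>

context
  fixes X :: "'a topology" and \<A> :: "('a, 'n::finite) chart set"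
  assumes M: "complex_manifold X \<A>"
begin

lemma chart_openin: "c \<in> \<A> \<Longrightarrow> openin X (fst c)"
  and chart_image_open: "c \<in> \<A> \<Longrightarrow> open (chart_image c)"
  and chart_homeomorphic: "c \<in> \<A> \<Longrightarrow> homeomorphic_map (subtopology X (fst c)) (top_of_set (chart_image c)) (snd c)"
  using M by (auto simp: complex_manifold_def is_chart_def)

lemma chart_inj: "c \<in> \<A> \<Longrightarrow> inj_on (snd c) (fst c)"
  using homeomorphic_imp_injective_map[OF chart_homeomorphic] openin_subset[OF chart_openin]
  by (simp add: Int_absorb1)

lemma overlap_open:
  assumes "c \<in> \<A>" "c' \<in> \<A>"
  shows "open (overlap c c')"
proof -
  have "openin (subtopology X (fst c)) (fst c \<inter> fst c')"
    using chart_openin[OF assms(2)] by (rule openin_subtopology_Int2)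
  then have "openin (top_of_set (chart_image c)) (overlap c c')"
    using homeomorphic_imp_open_map[OF chart_homeomorphic[OF assms(1)]] by (simp add: open_map_def overlap_def)
  then show ?thesis using chart_image_open[OF assms(1)] openin_open_trans by blast
qed

lemma overlap_subset: "overlap c c' \<subseteq> chart_image c"
  by (auto simp: overlap_def chart_image_def)

lemma transition_image:
  assumes "c \<in> \<A>"
  shows "transition c c' ` overlap c c' \<subseteq> chart_image c'"
  using chart_inj[OF assms]
  by (auto simp: overlap_def transition_def chart_inv_def chart_image_def)

lemma transition_smooth:
  assumes "c \<in> \<A>" "c' \<in> \<A>"
  shows "smooth_on (overlap c c') (transition c c')"
  using M assms by (intro smooth_on_components overlap_open) (auto simp: complex_manifold_def holo_on_def)

lemma transition_differentiable:
  "c \<in> \<A> \<Longrightarrow> c' \<in> \<A> \<Longrightarrow> z \<in> overlap c c' \<Longrightarrow> transition c c' differentiable (at z)"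
  using smooth_on_differentiable[OF transition_smooth] .

lemma transition_D_rot:
  assumes "c \<in> \<A>" "c' \<in> \<A>" "z \<in> overlap c c'"
  shows "D (transition c c') z (rot v) = rot (D (transition c c') z v)"
proof -
  have "D (transition c c') z (rot v) $ j = rot (D (transition c c') z v) $ j" for j
  proof -
    let ?f = "\<lambda>z. transition c c' z $ j"
    have f: "smooth_on (overlap c c') ?f" "wirt_bar i ?f z = 0" for i
      using M assms by (auto simp: complex_manifold_def holo_on_def)
    have c: "D (transition c c') z v $ j = D ?f z v" for v
      by (rule D_bounded_linear[OF bounded_linear_vec_nth transition_differentiable[OF assms], symmetric])
    have "(D ?f z v + \<i> * D ?f z (\<i> *s v)) / 2 = 0"
      unfolding linear_part_01[OF D_linear[OF smooth_on_differentiable[OF f(1) assms(3)]], symmetric]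
      using f(2) by (simp add: wirt_bar_def)
    then have "\<i> * (D ?f z v + \<i> * D ?f z (\<i> *s v)) = 0" by simp
    then have "D ?f z (\<i> *s v) = \<i> * D ?f z v" by (simp add: algebra_simps)
    then show ?thesis by (simp add: rot_def c)
  qed
  then show ?thesis by (simp add: vec_eq_iff)
qed

section \<open>Global forms\<close>

lemma form_alternating: "is_form \<A> \<omega> \<Longrightarrow> c \<in> \<A> \<Longrightarrow> z \<in> chart_image c \<Longrightarrow> alternating (\<omega> c z)"
  and form_smooth: "is_form \<A> \<omega> \<Longrightarrow> c \<in> \<A> \<Longrightarrow> smooth_lform (chart_image c) (\<omega> c)"
  and form_compat: "is_form \<A> \<omega> \<Longrightarrow> c \<in> \<A> \<Longrightarrow> c' \<in> \<A> \<Longrightarrow> z \<in> overlap c c' \<Longrightarrow>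
    \<omega> c z us = \<omega> c' (transition c c' z) (map (D (transition c c') z) us)"
  and form_zero: "is_form \<A> \<omega> \<Longrightarrow> c \<notin> \<A> \<or> z \<notin> chart_image c \<Longrightarrow> \<omega> c z us = 0"
  by (auto simp: is_form_def smooth_lform_def)

lemma form_eqI:
  assumes "is_form \<A> \<omega>" "is_form \<A> \<eta>"
    and "\<And>c z us. c \<in> \<A> \<Longrightarrow> z \<in> chart_image c \<Longrightarrow> \<omega> c z us = \<eta> c z us"
  shows "\<omega> = \<eta>"
proof (intro ext)
  fix c z us
  show "\<omega> c z us = \<eta> c z us"
    using assms(3)[of c z us] form_zero[OF assms(1), of c z us] form_zero[OF assms(2), of c z us]
    by (cases "c \<in> \<A> \<and> z \<in> chart_image c") auto
qed

lemma is_form_on_charts: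
  assumes "\<And>c z. c \<in> \<A> \<Longrightarrow> z \<in> chart_image c \<Longrightarrow> alternating (T c z)"
    and "\<And>c. c \<in> \<A> \<Longrightarrow> smooth_lform (chart_image c) (T c)"
    and "\<And>c c' z us. c \<in> \<A> \<Longrightarrow> c' \<in> \<A> \<Longrightarrow> z \<in> overlap c c' \<Longrightarrow>
      T c z us = T c' (transition c c' z) (map (D (transition c c') z) us)"
  shows "is_form \<A> (on_charts \<A> T)"
  unfolding is_form_def
proof (intro conjI ballI allI impI)
  show "alternating (on_charts \<A> T c z)" if "c \<in> \<A>" "z \<in> chart_image c" for c z
  proof -
    have "on_charts \<A> T c z = T c z" using that by (simp add: on_charts_def fun_eq_iff)
    then show ?thesis using assms(1)[OF that] by simp
  qed
  show "smooth_on (chart_image c) (\<lambda>z. on_charts \<A> T c z us)" if "c \<in> \<A>" for c us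
    by (rule smooth_on_cong[OF chart_image_open[OF that], of "\<lambda>z. T c z us"])
      (use that assms(2)[OF that] in \<open>auto simp: on_charts_def smooth_lform_def\<close>)
  show "on_charts \<A> T c z us = on_charts \<A> T c' (transition c c' z) (map (D (transition c c') z) us)"
    if "c \<in> \<A>" "c' \<in> \<A>" "z \<in> overlap c c'" for c c' z us
    using that overlap_subset[of c c'] transition_image[OF that(1), of c'] assms(3)[OF that]
    by (auto simp: on_charts_def)
qed (auto simp: on_charts_def)

lemma compat_lform:
  assumes "is_form \<A> \<omega>" "c \<in> \<A>" "c' \<in> \<A>" "z \<in> overlap c c'"
  shows "\<omega> c z = (\<lambda>us. \<omega> c' (transition c c' z) (map (D (transition c c') z) us))"
  using form_compat[OF assms] by (intro ext)

lemma transition_mem: "c \<in> \<A> \<Longrightarrow> z \<in> overlap c c' \<Longrightarrow> transition c c' z \<in> chart_image c'"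
  using transition_image by blast

lemma is_form_add: "is_form \<A> \<omega> \<Longrightarrow> is_form \<A> \<eta> \<Longrightarrow> is_form \<A> (\<lambda>c z us. \<omega> c z us + \<eta> c z us)"
  unfolding is_form_def by (auto intro: alternating_add smooth_on_add[OF chart_image_open])

lemma is_form_cmult: "is_form \<A> \<omega> \<Longrightarrow> is_form \<A> (\<lambda>c z us. r * \<omega> c z us)"
  unfolding is_form_def by (auto intro: alternating_cmult smooth_on_mult[OF chart_image_open])

lemma is_form_zero: "is_form \<A> (\<lambda>c z us. 0)"
  unfolding is_form_def by (auto intro: alternating_zero)

section \<open>Exterior derivatives and products of global forms\<close>

definition global_ext_d :: "complex \<Rightarrow> complex \<Rightarrow> ('a, 'n) form \<Rightarrow> ('a, 'n) form" where
  "global_ext_d a b \<omega> = on_charts \<A> (\<lambda>c. ext_d a b (\<omega> c))"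

lemma ext_deriv_eq: "ext_deriv \<A> \<omega> = global_ext_d 1 0 \<omega>"
  by (auto simp: ext_deriv_def global_ext_d_def on_charts_def fun_eq_iff ext_deriv_local_eq)

lemma del_eq: "is_form \<A> \<omega> \<Longrightarrow> del \<A> \<omega> = global_ext_d (1/2) (-\<i>/2) \<omega>"
  unfolding del_def global_ext_d_def on_charts_def fun_eq_iff
  using del_local_eq[OF smooth_lform_D[OF chart_image_open form_smooth]] by auto

lemma delbar_eq: "is_form \<A> \<omega> \<Longrightarrow> delbar \<A> \<omega> = global_ext_d (1/2) (\<i>/2) \<omega>"
  unfolding delbar_def global_ext_d_def on_charts_def fun_eq_iff
  using delbar_local_eq[OF smooth_lform_D[OF chart_image_open form_smooth]] by auto

text \<open>Independence of the chart is \<open>ext_d_pullback\<close> for the transition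
  map.\<close>

lemma is_form_global_ext_d:
  assumes "is_form \<A> \<omega>"
  shows "is_form \<A> (global_ext_d a b \<omega>)"
  unfolding global_ext_d_def
proof (rule is_form_on_charts)
  show "alternating (ext_d a b (\<omega> c) z)" if "c \<in> \<A>" "z \<in> chart_image c" for c z
    by (rule alternating_ext_d[OF chart_image_open[OF that(1)] form_smooth[OF assms that(1)] _ that(2)])
      (rule form_alternating[OF assms that(1)])
  show "smooth_lform (chart_image c) (ext_d a b (\<omega> c))" if "c \<in> \<A>" for c
    by (rule smooth_lform_ext_d[OF chart_image_open[OF that] form_smooth[OF assms that]])
  fix c c' z us assume c: "c \<in> \<A>" "c' \<in> \<A>" "z \<in> overlap c c'"
  have "ext_d a b (\<omega> c) z us
      = ext_d a b (\<lambda>y us. \<omega> c' (transition c c' y) (map (D (transition c c') y) us)) z us"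
    by (rule ext_d_cong[OF overlap_open[OF c(1,2)] c(3)]) (rule form_compat[OF assms c(1,2)])
  also have "\<dots> = ext_d a b (\<omega> c') (transition c c' z) (map (D (transition c c') z) us)"
    by (rule ext_d_pullback[OF overlap_open[OF c(1,2)] c(3) chart_image_open[OF c(2)] transition_image[OF c(1)]
        transition_smooth[OF c(1,2)] transition_D_rot[OF c(1,2)] form_smooth[OF assms c(2)] form_alternating[OF assms c(2)]])
  finally show "ext_d a b (\<omega> c) z us = ext_d a b (\<omega> c') (transition c c' z) (map (D (transition c c') z) us)" .
qed

lemma is_form_wedge:
  assumes "is_form \<A> \<omega>" "is_form \<A> \<eta>"
  shows "is_form \<A> (on_charts \<A> (\<lambda>c z. wedge (\<omega> c z) (\<eta> c z)))"
proof (rule is_form_on_charts)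
  show "wedge (\<omega> c z) (\<eta> c z) us
      = wedge (\<omega> c' (transition c c' z)) (\<eta> c' (transition c c' z)) (map (D (transition c c') z) us)"
    if "c \<in> \<A>" "c' \<in> \<A>" "z \<in> overlap c c'" for c c' z us
    unfolding compat_lform[OF assms(1) that] compat_lform[OF assms(2) that] by (rule wedge_map)
qed (use assms form_alternating form_smooth chart_image_open in \<open>auto intro!: alternating_wedge smooth_lform_wedge\<close>)

lemma is_form_one: "is_form \<A> (on_charts \<A> (\<lambda>c. fun_lform (\<lambda>_. 1)))"
  by (rule is_form_on_charts)
    (simp_all add: fun_lform_def[abs_def] alternating_scalar smooth_lform_const chart_image_open)

lemma is_form_homogeneous_part:
  assumes "is_form \<A> \<omega>"
  shows "is_form \<A> (homogeneous_part k \<omega>)"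
  unfolding is_form_def
proof (intro conjI ballI allI impI)
  show "alternating (homogeneous_part k \<omega> c z)" if "c \<in> \<A>" "z \<in> chart_image c" for c z
    unfolding alternating_def
  proof (intro conjI allI impI)
    show "linear (\<lambda>v. homogeneous_part k \<omega> c z (us @ v # ws))" for us ws
      using alternating_linear[OF form_alternating[OF assms that], of us ws]
      by (cases "length us + length ws + 1 = k") (auto simp: homogeneous_part_def linear_zero)
  qed (simp add: homogeneous_part_def alternating_not_distinct[OF form_alternating[OF assms that]])
  show "smooth_on (chart_image c) (\<lambda>z. homogeneous_part k \<omega> c z us)" if "c \<in> \<A>" for c us
    using form_smooth[OF assms that]
    by (cases "length us = k") (simp_all add: homogeneous_part_def smooth_lform_def)
qed (auto simp: homogeneous_part_def form_compat[OF assms] form_zero[OF assms])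

lemma form_degree_bound:
  assumes "is_form \<A> \<omega>" "length us > DIM(complex^'n)"
  shows "\<omega> c z us = 0"
  using form_zero[OF assms(1), of c z us] alternating_degree_bound[OF form_alternating[OF assms(1)] assms(2), of c z]
  by blast

lemma de_rham_simps [simp]:
  "carrier (de_rham \<A>) = {\<omega>. is_form \<A> \<omega>}"
  "x \<otimes>\<^bsub>de_rham \<A>\<^esub> y = on_charts \<A> (\<lambda>c z. wedge (x c z) (y c z))"
  "\<one>\<^bsub>de_rham \<A>\<^esub> = on_charts \<A> (\<lambda>c. fun_lform (\<lambda>_. 1))"
  "\<zero>\<^bsub>de_rham \<A>\<^esub> = (\<lambda>c z us. 0)"
  "x \<oplus>\<^bsub>de_rham \<A>\<^esub> y = (\<lambda>c z us. x c z us + y c z us)"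
  "r \<odot>\<^bsub>de_rham \<A>\<^esub> x = (\<lambda>c z us. r * x c z us)"
  "grade (de_rham \<A>) k = {\<omega>. is_form \<A> \<omega> \<and> (\<forall>c z us. \<omega> c z us \<noteq> 0 \<longrightarrow> length us = k)}"
  "diff (de_rham \<A>) = global_ext_d 1 0"
  by (simp_all add: de_rham_def ext_deriv_eq[abs_def])

lemma on_charts_apply: "c \<in> \<A> \<Longrightarrow> z \<in> chart_image c \<Longrightarrow> on_charts \<A> T c z = T c z"
  by (simp add: on_charts_def fun_eq_iff)

lemma global_ext_d_apply: "c \<in> \<A> \<Longrightarrow> z \<in> chart_image c \<Longrightarrow> global_ext_d a b \<omega> c z = ext_d a b (\<omega> c) z"
  by (simp add: global_ext_d_def on_charts_apply)

lemma global_ext_d_add: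
  "is_form \<A> \<omega> \<Longrightarrow> is_form \<A> \<eta> \<Longrightarrow> global_ext_d a b (\<lambda>c z us. \<omega> c z us + \<eta> c z us)
    = (\<lambda>c z us. global_ext_d a b \<omega> c z us + global_ext_d a b \<eta> c z us)"
  by (intro form_eqI is_form_global_ext_d is_form_add)
    (simp_all add: global_ext_d_apply ext_d_add[OF chart_image_open] form_smooth)

lemma global_ext_d_cmult:
  "is_form \<A> \<omega> \<Longrightarrow> global_ext_d a b (\<lambda>c z us. r * \<omega> c z us) = (\<lambda>c z us. r * global_ext_d a b \<omega> c z us)"
  by (intro form_eqI is_form_global_ext_d is_form_cmult)
    (simp_all add: global_ext_d_apply ext_d_cmult[OF chart_image_open] form_smooth)

lemma global_ext_d_global_ext_d:
  assumes "is_form \<A> \<omega>"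
  shows "global_ext_d a b (global_ext_d a b \<omega>) = (\<lambda>c z us. 0)"
proof (rule form_eqI)
  fix c z us assume c: "c \<in> \<A>" "z \<in> chart_image c"
  have "ext_d a b (global_ext_d a b \<omega> c) z us = ext_d a b (ext_d a b (\<omega> c)) z us"
    by (rule ext_d_cong[OF chart_image_open[OF c(1)] c(2)]) (simp add: global_ext_d_apply c(1))
  then show "global_ext_d a b (global_ext_d a b \<omega>) c z us = 0"
    using c ext_d_ext_d[OF chart_image_open[OF c(1)] form_smooth[OF assms c(1)] c(2)]
    by (simp add: global_ext_d_apply)
qed (intro is_form_global_ext_d is_form_zero assms)+

lemma ext_d_degree:
  assumes "\<And>y us. length us \<noteq> k \<Longrightarrow> \<omega> y us = 0" "length us \<noteq> Suc k"
  shows "ext_d a b \<omega> z us = 0"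
  using assms
proof (induction us arbitrary: \<omega> k)
  case (Cons v us)
  have "ldir a b v \<omega> z us = 0" using Cons.prems by (simp add: ldir_def cdir_const)
  moreover have "ext_d a b (\<lambda>y ws. \<omega> y (v # ws)) z us = 0"
  proof (cases k)
    case 0
    then have "(\<lambda>y ws. \<omega> y (v # ws)) = (\<lambda>_ _. 0)" using Cons.prems(1) by (intro ext) simp
    then show ?thesis using ext_d_zero[OF open_UNIV UNIV_I] by simp
  next
    case (Suc l)
    show ?thesis by (rule Cons.IH[of l]) (use Cons.prems Suc in auto)
  qed
  ultimately show ?case by simp
qed simp

lemma global_ext_d_grade:
  assumes "x \<in> grade (de_rham \<A>) k"
  shows "global_ext_d a b x \<in> grade (de_rham \<A>) (Suc k)"
proof -
  have "x c z us = 0" if "length us \<noteq> k" for c z us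
    using assms that by auto
  then have "global_ext_d a b x c z us = 0" if "length us \<noteq> Suc k" for c z us
    using ext_d_degree[of k "x c" us a b z] that by (simp add: global_ext_d_def on_charts_def)
  then show ?thesis using assms is_form_global_ext_d by auto
qed

text \<open>On degree k the involution \<open>sgn_form\<close> is the scalar (-1)^k. The general
  coefficients serve both the de Rham differential and, in the proof that P is a derivation, the
  operator \<partial>.\<close>

lemma global_ext_d_wedge:
  assumes x: "x \<in> grade (de_rham \<A>) k" and y: "is_form \<A> y"
  shows "global_ext_d a b (x \<otimes>\<^bsub>de_rham \<A>\<^esub> y)
    = (global_ext_d a b x \<otimes>\<^bsub>de_rham \<A>\<^esub> y) \<oplus>\<^bsub>de_rham \<A>\<^esub> ((- 1) ^ k \<odot>\<^bsub>de_rham \<A>\<^esub> (x \<otimes>\<^bsub>de_rham \<A>\<^esub> global_ext_d a b y))"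
proof -
  have xf: "is_form \<A> x" using x by simp
  have sgn: "sgn_form (x c z) = (\<lambda>us. (- 1) ^ k * x c z us)" for c z
    using x by (auto simp: sgn_form_def fun_eq_iff)
  show ?thesis
    unfolding de_rham_simps
  proof (rule form_eqI)
    fix c z us assume c: "c \<in> \<A>" "z \<in> chart_image c"
    have "ext_d a b (on_charts \<A> (\<lambda>c z. wedge (x c z) (y c z)) c) z us = ext_d a b (\<lambda>z. wedge (x c z) (y c z)) z us"
      by (rule ext_d_cong[OF chart_image_open[OF c(1)] c(2)]) (simp add: on_charts_apply c(1))
    then show "global_ext_d a b (on_charts \<A> (\<lambda>c z. wedge (x c z) (y c z))) c z us
      = on_charts \<A> (\<lambda>c z. wedge (global_ext_d a b x c z) (y c z)) c z us
        + (- 1) ^ k * on_charts \<A> (\<lambda>c z. wedge (x c z) (global_ext_d a b y c z)) c z us"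
      using ext_d_wedge[OF chart_image_open[OF c(1)] c(2) form_smooth[OF xf c(1)] form_smooth[OF y c(1)], of a b us]
      by (simp add: global_ext_d_apply on_charts_apply c sgn wedge_cmult_left)
  qed (intro is_form_global_ext_d is_form_wedge is_form_add is_form_cmult xf y)+
qed


end

section \<open>The de Rham algebra\<close>

context
  fixes X :: "'a topology" and \<A> :: "('a, 'n::finite) chart set"
  assumes M: "complex_manifold X \<A>"
begin

interpretation dr: abelian_group "de_rham \<A>"
proof (rule abelian_groupI)
  show "\<exists>y\<in>carrier (de_rham \<A>). y \<oplus>\<^bsub>de_rham \<A>\<^esub> x = \<zero>\<^bsub>de_rham \<A>\<^esub>" if "x \<in> carrier (de_rham \<A>)" for x
    using that is_form_cmult[OF M, of x "-1"]
    by (intro bexI[of _ "\<lambda>c z us. - 1 * x c z us"]) (simp_all add: de_rham_simps[OF M])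
qed (auto simp: de_rham_simps[OF M] is_form_add[OF M] is_form_zero[OF M] add_ac)

lemma de_rham_finsum:
  assumes "finite T" "\<And>k. k \<in> T \<Longrightarrow> is_form \<A> (f k)"
  shows "finsum (de_rham \<A>) f T = (\<lambda>c z us. \<Sum>k\<in>T. f k c z us)"
  using assms
proof (induction T rule: finite_induct)
  case empty
  then show ?case by (simp add: de_rham_simps[OF M])
next
  case (insert k T)
  then have "f \<in> T \<rightarrow> carrier (de_rham \<A>)" "f k \<in> carrier (de_rham \<A>)"
    by (auto simp: de_rham_simps[OF M])
  then show ?case
    using insert by (simp add: dr.finsum_insert) (simp add: de_rham_simps[OF M])
qed

lemma homogeneous_part_sum:
  assumes "is_form \<A> x"
  shows "x = (\<lambda>c z us. \<Sum>k\<le>DIM(complex^'n). homogeneous_part k x c z us)"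
proof (intro ext)
  fix c z us
  show "x c z us = (\<Sum>k\<le>DIM(complex^'n). homogeneous_part k x c z us)"
    using form_degree_bound[OF M assms, of us c z]
    by (cases "length us \<le> DIM(complex^'n)") (simp_all add: homogeneous_part_def)
qed

theorem dg_algebra_de_rham: "dg_algebra (de_rham \<A>)"
proof (rule dg_algebraI[OF dr.abelian_group_axioms, where p = homogeneous_part]; (unfold de_rham_simps[OF M])?)
  note [simp] = is_form_wedge[OF M] is_form_add[OF M] is_form_cmult[OF M] is_form_one[OF M]
    is_form_one[OF M, unfolded fun_lform_def[abs_def]]
    is_form_homogeneous_part[OF M] on_charts_apply[OF M] form_zero[OF M]
  fix x y w :: "('a, 'n) form"
  show "on_charts \<A> (\<lambda>c z. wedge (x c z) (y c z)) \<in> {\<omega>. is_form \<A> \<omega>}"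
    if "x \<in> {\<omega>. is_form \<A> \<omega>}" "y \<in> {\<omega>. is_form \<A> \<omega>}"
    using that by simp
  show "on_charts \<A> (\<lambda>c z. wedge (on_charts \<A> (\<lambda>c z. wedge (x c z) (y c z)) c z) (w c z))
    = on_charts \<A> (\<lambda>c z. wedge (x c z) (on_charts \<A> (\<lambda>c z. wedge (y c z) (w c z)) c z))"
    if "x \<in> {\<omega>. is_form \<A> \<omega>}" "y \<in> {\<omega>. is_form \<A> \<omega>}" "w \<in> {\<omega>. is_form \<A> \<omega>}"
    by (rule form_eqI[OF M]) (use that in \<open>simp_all add: wedge_assoc\<close>)
  show "on_charts \<A> (\<lambda>c z. wedge (on_charts \<A> (\<lambda>c. fun_lform (\<lambda>_. 1)) c z) (x c z)) = x"
    if "x \<in> {\<omega>. is_form \<A> \<omega>}"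
    by (rule form_eqI[OF M]) (use that in \<open>simp_all add: fun_lform_def[abs_def] wedge_scalar_left\<close>)
  show "on_charts \<A> (\<lambda>c z. wedge (x c z) (on_charts \<A> (\<lambda>c. fun_lform (\<lambda>_. 1)) c z)) = x"
    if "x \<in> {\<omega>. is_form \<A> \<omega>}"
    by (rule form_eqI[OF M]) (use that in \<open>simp_all add: fun_lform_def[abs_def] wedge_scalar_right\<close>)
  show "on_charts \<A> (\<lambda>c z. wedge (\<lambda>us. x c z us + y c z us) (w c z))
    = (\<lambda>c z us. on_charts \<A> (\<lambda>c z. wedge (x c z) (w c z)) c z us + on_charts \<A> (\<lambda>c z. wedge (y c z) (w c z)) c z us)"
    by (auto simp: on_charts_def fun_eq_iff wedge_add_left)
  show "on_charts \<A> (\<lambda>c z. wedge (w c z) (\<lambda>us. x c z us + y c z us))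
    = (\<lambda>c z us. on_charts \<A> (\<lambda>c z. wedge (w c z) (x c z)) c z us + on_charts \<A> (\<lambda>c z. wedge (w c z) (y c z)) c z us)"
    by (auto simp: on_charts_def fun_eq_iff wedge_add_right)
  show "on_charts \<A> (\<lambda>c z. wedge (\<lambda>us. r * x c z us) (y c z))
    = (\<lambda>c z us. r * on_charts \<A> (\<lambda>c z. wedge (x c z) (y c z)) c z us)" for r
    by (auto simp: on_charts_def fun_eq_iff wedge_cmult_left)
  show "on_charts \<A> (\<lambda>c z. wedge (x c z) (\<lambda>us. r * y c z us))
    = (\<lambda>c z us. r * on_charts \<A> (\<lambda>c z. wedge (x c z) (y c z)) c z us)" for r
    by (auto simp: on_charts_def fun_eq_iff wedge_cmult_right)
  show "\<exists>S. finite S \<and> (\<forall>k. k \<notin> S \<longrightarrow> homogeneous_part k x = (\<lambda>c z us. 0)) \<and> x = finsum (de_rham \<A>) (\<lambda>k. homogeneous_part k x) S"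
    if "x \<in> {\<omega>. is_form \<A> \<omega>}"
  \<comment> \<open>Forms vanish above the real dimension, so these degrees contain all nonzero
    components.\<close>
  proof (intro exI[of _ "{..DIM(complex^'n)}"] conjI allI impI)
    show "homogeneous_part k x = (\<lambda>c z us. 0)" if "k \<notin> {..DIM(complex^'n)}" for k
      using that form_degree_bound[OF M, of x] \<open>x \<in> {\<omega>. is_form \<A> \<omega>}\<close>
      by (auto simp: homogeneous_part_def fun_eq_iff)
    show "x = finsum (de_rham \<A>) (\<lambda>k. homogeneous_part k x) {..DIM(complex^'n)}"
      using that homogeneous_part_sum[of x] by (subst de_rham_finsum) simp_all
  qed simp
  show "on_charts \<A> (\<lambda>c. fun_lform (\<lambda>_. 1)) \<in> {\<omega>. is_form \<A> \<omega> \<and> (\<forall>c z us. \<omega> c z us \<noteq> 0 \<longrightarrow> length us = 0)}"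
    by (auto simp: on_charts_def fun_lform_def)
  show "on_charts \<A> (\<lambda>c z. wedge (x c z) (y c z)) \<in> {\<omega>. is_form \<A> \<omega> \<and> (\<forall>c z us. \<omega> c z us \<noteq> 0 \<longrightarrow> length us = k + l)}"
    if "x \<in> {\<omega>. is_form \<A> \<omega> \<and> (\<forall>c z us. \<omega> c z us \<noteq> 0 \<longrightarrow> length us = k)}"
      "y \<in> {\<omega>. is_form \<A> \<omega> \<and> (\<forall>c z us. \<omega> c z us \<noteq> 0 \<longrightarrow> length us = l)}" for k l
  proof -
    have "x c z us = 0" if "length us \<noteq> k" for c z us
      using that \<open>x \<in> _\<close> by blast
    moreover have "y c z us = 0" if "length us \<noteq> l" for c z us
      using that \<open>y \<in> _\<close> by blast
    ultimately have "on_charts \<A> (\<lambda>c z. wedge (x c z) (y c z)) c z us = 0" if "length us \<noteq> k + l" for c z us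
      using wedge_degree[of k "x c z" l "y c z" us] that by (simp add: on_charts_def)
    then show ?thesis using that by auto
  qed
  show "(\<lambda>c z us. x c z us + y c z us) \<in> {\<omega>. is_form \<A> \<omega> \<and> (\<forall>c z us. \<omega> c z us \<noteq> 0 \<longrightarrow> length us = k)}"
    if "x \<in> {\<omega>. is_form \<A> \<omega> \<and> (\<forall>c z us. \<omega> c z us \<noteq> 0 \<longrightarrow> length us = k)}"
      "y \<in> {\<omega>. is_form \<A> \<omega> \<and> (\<forall>c z us. \<omega> c z us \<noteq> 0 \<longrightarrow> length us = k)}" for k
  proof (intro CollectI conjI allI impI)
    show "length us = k" if "x c z us + y c z us \<noteq> 0" for c z us
      using that \<open>x \<in> _\<close> \<open>y \<in> _\<close> by (cases "x c z us = 0") auto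
  qed (use that in simp)
  show "global_ext_d \<A> 1 0 x \<in> {\<omega>. is_form \<A> \<omega> \<and> (\<forall>c z us. \<omega> c z us \<noteq> 0 \<longrightarrow> length us = Suc k)}"
    if "x \<in> {\<omega>. is_form \<A> \<omega> \<and> (\<forall>c z us. \<omega> c z us \<noteq> 0 \<longrightarrow> length us = k)}" for k
    using global_ext_d_grade[OF M, of x k 1 0] that unfolding de_rham_simps[OF M] .
  show "global_ext_d \<A> 1 0 (on_charts \<A> (\<lambda>c z. wedge (x c z) (y c z)))
    = (\<lambda>c z us. on_charts \<A> (\<lambda>c z. wedge (global_ext_d \<A> 1 0 x c z) (y c z)) c z us
        + (- 1) ^ k * on_charts \<A> (\<lambda>c z. wedge (x c z) (global_ext_d \<A> 1 0 y c z)) c z us)"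
    if "x \<in> {\<omega>. is_form \<A> \<omega> \<and> (\<forall>c z us. \<omega> c z us \<noteq> 0 \<longrightarrow> length us = k)}" "y \<in> {\<omega>. is_form \<A> \<omega>}" for k
    using global_ext_d_wedge[OF M, of x k y 1 0] that unfolding de_rham_simps[OF M] by simp
qed (auto simp: is_form_add[OF M] is_form_cmult[OF M] is_form_homogeneous_part[OF M] global_ext_d_add[OF M]
    global_ext_d_cmult[OF M] global_ext_d_global_ext_d[OF M] homogeneous_part_def fun_eq_iff algebra_simps)

end

section \<open>The exponential and the rotation on global forms\<close>

definition global_exp :: "('a, 'n::finite) chart set \<Rightarrow> ('a, 'n) beltrami \<Rightarrow> ('a, 'n) form \<Rightarrow> ('a, 'n) form" where
  "global_exp \<A> \<psi> \<omega> = on_charts \<A> (\<lambda>c z. contract_exp (\<psi> c z) (\<omega> c z))"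

text \<open>Pullback along multiplication by \<open>\<i>\<close> multiplies forms of type \<open>(p, q)\<close> by \<open>\<i>\<^sup>p\<^sup>-\<^sup>q\<close>; it replaces the
  bigrading in separating the types \<open>(1, 0)\<close> and \<open>(0, 1)\<close> of an operator.\<close>

definition rot_pullback :: "('a, 'n::finite) form \<Rightarrow> ('a, 'n) form" where
  "rot_pullback \<omega> = (\<lambda>c z us. \<omega> c z (map rot us))"

text \<open>Rotating v in a D f v + b D f (rot v) gives - b D f v + a D f (rot v), because
  \<open>rot\<close> squares to -1. The two conditions make this \<kappa> times the original:
  \<kappa> = \<i> for \<partial> and \<kappa> = -\<i> for \<partial>bar.\<close>

lemma ext_d_rot:
  assumes "open S" "z \<in> S" "smooth_lform S \<omega>" and \<kappa>: "\<kappa> * a = - b" "\<kappa> * b = a"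
  shows "ext_d a b \<omega> z (map rot us) = \<kappa> * ext_d a b (\<lambda>y us. \<omega> y (map rot us)) z us"
  using assms(3)
proof (induction us arbitrary: \<omega>)
  case (Cons v us)
  have lin: "linear (D (\<lambda>y. \<omega> y (map rot us)) z)"
    by (rule D_linear[OF smooth_lform_D[OF assms(1) Cons.prems assms(2)]])
  have "ldir a b (rot v) \<omega> z (map rot us) = \<kappa> * ldir a b v (\<lambda>y us. \<omega> y (map rot us)) z us"
    using linear_neg[OF lin] \<kappa> by (simp add: ldir_def cdir_def rot_rot distrib_left mult.assoc[symmetric])
  moreover have "ext_d a b (\<lambda>y ws. \<omega> y (rot v # ws)) z (map rot us)
      = \<kappa> * ext_d a b (\<lambda>y ws. \<omega> y (rot v # map rot ws)) z us"
    by (rule Cons.IH[OF smooth_lform_Cons[OF assms(1) Cons.prems]])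
  ultimately show ?case by (simp add: right_diff_distrib)
qed simp

lemma contract_exp_degree:
  assumes "\<And>us. length us \<noteq> k \<Longrightarrow> \<alpha> us = 0" "length us \<noteq> k"
  shows "contract_exp M \<alpha> us = 0"
  using assms
proof (induction us arbitrary: \<alpha> k)
  case (Cons v us)
  show ?case
  proof (cases k)
    case 0
    then have "(\<lambda>ws. \<alpha> (v # ws) + contract_bel M v \<alpha> ws) = (\<lambda>_. 0)"
      using Cons.prems(1) by (intro ext) (simp add: contract_bel_def contract_dz_def)
    then show ?thesis by (simp add: contract_exp_zero)
  next
    case (Suc l)
    show ?thesis
      unfolding contract_exp.simps
      by (rule Cons.IH[of l]) (use Cons.prems Suc in \<open>auto simp: contract_bel_def contract_dz_def\<close>)
  qed
qed simp

context
  fixes X :: "'a topology" and \<A> :: "('a, 'n::finite) chart set"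
  assumes M: "complex_manifold X \<A>"
begin

lemma beltrami_matrix: "is_beltrami \<A> \<psi> \<Longrightarrow> c \<in> \<A> \<Longrightarrow> smooth_matrix (chart_image c) (\<psi> c)"
  using smooth_matrix_of_smooth_on[OF chart_image_open[OF M]] by (auto simp: is_beltrami_def)

lemma is_beltrami_uminus:
  assumes "is_beltrami \<A> \<psi>"
  shows "is_beltrami \<A> (\<lambda>c z. - \<psi> c z)"
  unfolding is_beltrami_def
proof (intro conjI ballI allI)
  show "smooth_on (chart_image c) (\<lambda>z. - \<psi> c z)" if "c \<in> \<A>" for c
    using assms that smooth_on_bounded_linear[OF chart_image_open[OF M that] bounded_linear_minus[OF bounded_linear_ident]]
    by (auto simp: is_beltrami_def)
  fix c c' z v assume c: "c \<in> \<A>" "c' \<in> \<A>" "z \<in> overlap c c'"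
  show "D (transition c c') z (bel (- \<psi> c z) v) = bel (- \<psi> c' (transition c c' z)) (D (transition c c') z v)"
    using assms c linear_neg[OF D_linear[OF transition_differentiable[OF M c]]]
    by (simp add: is_beltrami_def bel_uminus)
qed

lemma transition_bel:
  assumes "is_beltrami \<A> \<psi>" "c \<in> \<A>" "c' \<in> \<A>" "z \<in> overlap c c'"
  shows "linear (D (transition c c') z)"
    "D (transition c c') z (\<i> *s v) = \<i> *s D (transition c c') z v"
    "D (transition c c') z (bel (\<psi> c z) v) = bel (\<psi> c' (transition c c' z)) (D (transition c c') z v)"
  using assms D_linear[OF transition_differentiable[OF M assms(2-)]] transition_D_rot[OF M assms(2-), of v]
  by (auto simp: is_beltrami_def rot_def)

lemma is_form_global_exp:
  assumes "is_beltrami \<A> \<psi>" "is_form \<A> \<omega>"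
  shows "is_form \<A> (global_exp \<A> \<psi> \<omega>)"
  unfolding global_exp_def
proof (rule is_form_on_charts[OF M])
  show "smooth_lform (chart_image c) (\<lambda>z. contract_exp (\<psi> c z) (\<omega> c z))" if "c \<in> \<A>" for c
    by (rule smooth_lform_contract_exp[OF chart_image_open[OF M that] beltrami_matrix[OF assms(1) that] form_smooth[OF M assms(2) that]])
  fix c c' z us assume c: "c \<in> \<A>" "c' \<in> \<A>" "z \<in> overlap c c'"
  show "contract_exp (\<psi> c z) (\<omega> c z) us
    = contract_exp (\<psi> c' (transition c c' z)) (\<omega> c' (transition c c' z)) (map (D (transition c c') z) us)"
    unfolding compat_lform[OF M assms(2) c]
    by (rule contract_exp_map[OF transition_bel[OF assms(1) c] form_alternating[OF M assms(2) c(2) transition_mem[OF M c(1,3)]]])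
qed (intro alternating_contract_exp form_alternating[OF M assms(2)])

lemma contract_beltrami_eq:
  assumes "is_form \<A> \<omega>"
  shows "contract_beltrami \<A> \<psi> \<omega> = on_charts \<A> (\<lambda>c z. contract_rec (\<psi> c z) (\<omega> c z))"
  using contract_matrix_eq_contract_rec[OF form_alternating[OF M assms]]
  by (auto simp: contract_beltrami_def on_charts_def fun_eq_iff)

lemma is_form_contract_beltrami:
  assumes "is_beltrami \<A> \<psi>" "is_form \<A> \<omega>"
  shows "is_form \<A> (contract_beltrami \<A> \<psi> \<omega>)"
  unfolding contract_beltrami_eq[OF assms(2)]
proof (rule is_form_on_charts[OF M])
  fix c z assume "c \<in> \<A>" "z \<in> chart_image c"
  \<comment> \<open>Alternation is read off from the wedge description, smoothness and compatibility
    from the recursive one.\<close>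
  then have "alternating (contract_matrix (\<psi> c z) (\<omega> c z))"
    unfolding contract_matrix_def[abs_def] row_form_covector
    by (intro alternating_sum alternating_wedge alternating_contract_dz form_alternating[OF M assms(2)]
        alternating_covector linearI)
      (simp_all add: bel_add bel_scaleR)
  moreover have "contract_matrix (\<psi> c z) (\<omega> c z) = contract_rec (\<psi> c z) (\<omega> c z)"
    using contract_matrix_eq_contract_rec[OF form_alternating[OF M assms(2) \<open>c \<in> \<A>\<close> \<open>z \<in> chart_image c\<close>]] by (intro ext)
  ultimately show "alternating (contract_rec (\<psi> c z) (\<omega> c z))" by simp
next
  show "smooth_lform (chart_image c) (\<lambda>z. contract_rec (\<psi> c z) (\<omega> c z))" if "c \<in> \<A>" for c
    by (rule smooth_lform_contract_rec[OF chart_image_open[OF M that] beltrami_matrix[OF assms(1) that] form_smooth[OF M assms(2) that]])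
  fix c c' z us assume c: "c \<in> \<A>" "c' \<in> \<A>" "z \<in> overlap c c'"
  show "contract_rec (\<psi> c z) (\<omega> c z) us
    = contract_rec (\<psi> c' (transition c c' z)) (\<omega> c' (transition c c' z)) (map (D (transition c c') z) us)"
    unfolding compat_lform[OF M assms(2) c]
    by (rule contract_rec_map[OF transition_bel[OF assms(1) c] form_alternating[OF M assms(2) c(2) transition_mem[OF M c(1,3)]]])
qed

lemma is_form_rot_pullback:
  assumes "is_form \<A> \<omega>"
  shows "is_form \<A> (rot_pullback \<omega>)"
  unfolding is_form_def
proof (intro conjI ballI allI impI)
  show "alternating (rot_pullback \<omega> c z)" if "c \<in> \<A>" "z \<in> chart_image c" for c z
    unfolding rot_pullback_def by (rule alternating_map[OF form_alternating[OF M assms that] linear_rot])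
  show "smooth_on (chart_image c) (\<lambda>z. rot_pullback \<omega> c z us)" if "c \<in> \<A>" for c us
    using form_smooth[OF M assms that] by (simp add: rot_pullback_def smooth_lform_def)
  show "rot_pullback \<omega> c z us = rot_pullback \<omega> c' (transition c c' z) (map (D (transition c c') z) us)"
    if "c \<in> \<A>" "c' \<in> \<A>" "z \<in> overlap c c'" for c c' z us
  proof -
    have "D (transition c c') z \<circ> rot = rot \<circ> D (transition c c') z"
      using transition_D_rot[OF M that] by (simp add: fun_eq_iff)
    then show ?thesis
      by (simp add: rot_pullback_def form_compat[OF M assms that])
  qed
qed (simp add: rot_pullback_def form_zero[OF M assms])

text \<open>The cube is therefore the inverse, which later gives injectivity and preimages.\<close>

lemma rot_pullback_4: "is_form \<A> \<omega> \<Longrightarrow> rot_pullback (rot_pullback (rot_pullback (rot_pullback \<omega>))) = \<omega>"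
  by (simp add: rot_pullback_def o_def rot_rot)

lemma global_ext_d_rot:
  assumes "is_form \<A> \<omega>" "\<kappa> * a = - b" "\<kappa> * b = a"
  shows "rot_pullback (global_ext_d \<A> a b \<omega>) = (\<lambda>c z us. \<kappa> * global_ext_d \<A> a b (rot_pullback \<omega>) c z us)"
proof (rule form_eqI[OF M])
  fix c z us assume c: "c \<in> \<A>" "z \<in> chart_image c"
  have "rot_pullback \<omega> c = (\<lambda>y us. \<omega> c y (map rot us))" by (simp add: rot_pullback_def)
  then show "rot_pullback (global_ext_d \<A> a b \<omega>) c z us = \<kappa> * global_ext_d \<A> a b (rot_pullback \<omega>) c z us"
    using ext_d_rot[OF chart_image_open[OF M c(1)] c(2) form_smooth[OF M assms(1) c(1)] assms(2,3), of us] c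
    by (simp add: rot_pullback_def[of "global_ext_d \<A> a b \<omega>"] global_ext_d_apply[OF M])
qed (intro is_form_rot_pullback is_form_global_ext_d[OF M] is_form_cmult[OF M] assms)+

lemma contract_beltrami_rot:
  assumes "is_beltrami \<A> \<psi>" "is_form \<A> \<omega>"
  shows "contract_beltrami \<A> \<psi> (rot_pullback \<omega>) = (\<lambda>c z us. - 1 * rot_pullback (contract_beltrami \<A> \<psi> \<omega>) c z us)"
proof (rule form_eqI[OF M])
  fix c z us assume c: "c \<in> \<A>" "z \<in> chart_image c"
  have "rot_pullback \<omega> c z = (\<lambda>us. \<omega> c z (map rot us))" by (simp add: rot_pullback_def)
  then show "contract_beltrami \<A> \<psi> (rot_pullback \<omega>) c z us = - 1 * rot_pullback (contract_beltrami \<A> \<psi> \<omega>) c z us"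
    using contract_rec_rot[OF form_alternating[OF M assms(2) c], of "\<psi> c z" us] c
    by (simp add: contract_beltrami_eq assms is_form_rot_pullback on_charts_apply[OF M] rot_pullback_def[of "on_charts _ _"])
qed (intro is_form_rot_pullback is_form_contract_beltrami is_form_cmult[OF M] assms)+

lemma contract_beltrami_add:
  "is_beltrami \<A> \<psi> \<Longrightarrow> is_form \<A> \<omega> \<Longrightarrow> is_form \<A> \<eta> \<Longrightarrow> contract_beltrami \<A> \<psi> (\<lambda>c z us. \<omega> c z us + \<eta> c z us)
    = (\<lambda>c z us. contract_beltrami \<A> \<psi> \<omega> c z us + contract_beltrami \<A> \<psi> \<eta> c z us)"
  by (auto simp: contract_beltrami_eq is_form_add[OF M] on_charts_def fun_eq_iff contract_rec_add)

lemma contract_beltrami_cmult: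
  "is_form \<A> \<omega> \<Longrightarrow> contract_beltrami \<A> \<psi> (\<lambda>c z us. r * \<omega> c z us) = (\<lambda>c z us. r * contract_beltrami \<A> \<psi> \<omega> c z us)"
  by (auto simp: contract_beltrami_eq is_form_cmult[OF M] on_charts_def fun_eq_iff contract_rec_cmult)

lemma global_exp_add:
  "global_exp \<A> \<psi> (\<lambda>c z us. \<omega> c z us + \<eta> c z us) = (\<lambda>c z us. global_exp \<A> \<psi> \<omega> c z us + global_exp \<A> \<psi> \<eta> c z us)"
  by (auto simp: global_exp_def on_charts_def fun_eq_iff contract_exp_add)

lemma global_exp_cmult:
  "global_exp \<A> \<psi> (\<lambda>c z us. r * \<omega> c z us) = (\<lambda>c z us. r * global_exp \<A> \<psi> \<omega> c z us)"
  by (auto simp: global_exp_def on_charts_def fun_eq_iff contract_exp_cmult)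

lemma global_exp_zero: "global_exp \<A> \<psi> (\<lambda>c z us. 0) = (\<lambda>c z us. 0)"
  by (auto simp: global_exp_def on_charts_def fun_eq_iff contract_exp_zero)

lemma global_exp_inverse:
  assumes "is_beltrami \<A> \<psi>" "is_form \<A> \<omega>"
  shows "global_exp \<A> (\<lambda>c z. - \<psi> c z) (global_exp \<A> \<psi> \<omega>) = \<omega>"
proof (rule form_eqI[OF M])
  show "global_exp \<A> (\<lambda>c z. - \<psi> c z) (global_exp \<A> \<psi> \<omega>) c z us = \<omega> c z us"
    if "c \<in> \<A>" "z \<in> chart_image c" for c z us
    using that by (simp add: global_exp_def on_charts_apply[OF M] contract_exp_inverse)
qed (intro is_form_global_exp is_beltrami_uminus assms)+

lemma global_exp_inverse':
  "is_beltrami \<A> \<psi> \<Longrightarrow> is_form \<A> \<omega> \<Longrightarrow> global_exp \<A> \<psi> (global_exp \<A> (\<lambda>c z. - \<psi> c z) \<omega>) = \<omega>"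
  using global_exp_inverse[OF is_beltrami_uminus, of \<psi> \<omega>] by simp

lemma global_exp_grade:
  assumes "is_beltrami \<A> \<psi>" "x \<in> grade (de_rham \<A>) k"
  shows "global_exp \<A> \<psi> x \<in> grade (de_rham \<A>) k"
proof -
  have x: "is_form \<A> x" "x c z us = 0" if "length us \<noteq> k" for c z us
    using assms(2) that by (auto simp: de_rham_simps[OF M])
  have "global_exp \<A> \<psi> x c z us = 0" if "length us \<noteq> k" for c z us
    using contract_exp_degree[of k "x c z" us] x(2) that by (auto simp: global_exp_def on_charts_def)
  moreover have "is_form \<A> (global_exp \<A> \<psi> x)"
    using is_form_global_exp[OF assms(1)] assms(2) by (simp add: de_rham_simps[OF M])
  ultimately show ?thesis by (auto simp: de_rham_simps[OF M])
qed

lemma global_exp_mult: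
  assumes "is_beltrami \<A> \<psi>" "is_form \<A> x" "is_form \<A> y"
  shows "global_exp \<A> \<psi> (x \<otimes>\<^bsub>de_rham \<A>\<^esub> y) = global_exp \<A> \<psi> x \<otimes>\<^bsub>de_rham \<A>\<^esub> global_exp \<A> \<psi> y"
  unfolding de_rham_simps[OF M]
proof (rule form_eqI[OF M])
  fix c z us assume c: "c \<in> \<A>" "z \<in> chart_image c"
  have "contract_exp (\<psi> c z) (x c z) = global_exp \<A> \<psi> x c z" for x
    using c by (simp add: global_exp_def on_charts_apply[OF M])
  then show "global_exp \<A> \<psi> (on_charts \<A> (\<lambda>c z. wedge (x c z) (y c z))) c z us
    = on_charts \<A> (\<lambda>c z. wedge (global_exp \<A> \<psi> x c z) (global_exp \<A> \<psi> y c z)) c z us"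
    using c contract_exp_wedge[of "\<psi> c z" "x c z" "y c z" us]
    by (simp add: on_charts_apply[OF M] global_exp_def[of _ _ "on_charts _ _"])
qed (intro is_form_wedge[OF M] is_form_global_exp assms)+

section \<open>The operators \<partial>, \<partial>bar and \<partial>bar_\<phi>\<close>

context
  fixes \<phi> :: "('a, 'n) beltrami"
  assumes \<phi>: "is_beltrami \<A> \<phi>"
begin

lemma is_form_del: "is_form \<A> \<omega> \<Longrightarrow> is_form \<A> (del \<A> \<omega>)"
  by (simp add: del_eq[OF M] is_form_global_ext_d[OF M])

lemma del_add: "is_form \<A> \<omega> \<Longrightarrow> is_form \<A> \<eta> \<Longrightarrow>
    del \<A> (\<lambda>c z us. \<omega> c z us + \<eta> c z us) = (\<lambda>c z us. del \<A> \<omega> c z us + del \<A> \<eta> c z us)"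
  by (simp add: del_eq[OF M] is_form_add[OF M] global_ext_d_add[OF M])

lemma del_cmult: "is_form \<A> \<omega> \<Longrightarrow> del \<A> (\<lambda>c z us. r * \<omega> c z us) = (\<lambda>c z us. r * del \<A> \<omega> c z us)"
  by (simp add: del_eq[OF M] is_form_cmult[OF M] global_ext_d_cmult[OF M])

lemma del_diff: "is_form \<A> \<omega> \<Longrightarrow> is_form \<A> \<eta> \<Longrightarrow>
    del \<A> (\<lambda>c z us. \<omega> c z us - \<eta> c z us) = (\<lambda>c z us. del \<A> \<omega> c z us - del \<A> \<eta> c z us)"
  using del_add[of \<omega> "\<lambda>c z us. - 1 * \<eta> c z us"] del_cmult[of \<eta> "-1"] is_form_cmult[OF M, of \<eta> "-1"]
  by simp

lemma is_form_diff: "is_form \<A> \<omega> \<Longrightarrow> is_form \<A> \<eta> \<Longrightarrow> is_form \<A> (\<lambda>c z us. \<omega> c z us - \<eta> c z us)"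
  using is_form_add[OF M, of \<omega> "\<lambda>c z us. - 1 * \<eta> c z us"] is_form_cmult[OF M, of \<eta> "-1"] by simp

lemma del_del: "is_form \<A> \<omega> \<Longrightarrow> del \<A> (del \<A> \<omega>) = (\<lambda>c z us. 0)"
  using is_form_del[of \<omega>] by (simp add: del_eq[OF M] global_ext_d_global_ext_d[OF M])

lemma ext_deriv_split:
  assumes "is_form \<A> \<omega>"
  shows "global_ext_d \<A> 1 0 \<omega> c z us = del \<A> \<omega> c z us + delbar \<A> \<omega> c z us"
  using ext_d_add_coeff[of "1/2" "1/2" "-\<i>/2" "\<i>/2" "\<omega> c" z us]
  by (simp add: del_eq[OF M assms] delbar_eq[OF M assms] global_ext_d_def[OF M] on_charts_def)

text \<open>With subtraction written as adding a multiple by -1, closure and linearity follow from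
  the lemmas on sums and scalar multiples.\<close>

lemma delbar_beltrami_eq:
  "delbar_beltrami \<A> \<phi> \<omega> = (\<lambda>c z us. (delbar \<A> \<omega> c z us + - 1 * contract_beltrami \<A> \<phi> (del \<A> \<omega>) c z us)
      + del \<A> (contract_beltrami \<A> \<phi> \<omega>) c z us)"
  by (simp add: delbar_beltrami_def lie_beltrami_def fun_eq_iff)

lemma is_form_delbar: "is_form \<A> \<omega> \<Longrightarrow> is_form \<A> (delbar \<A> \<omega>)"
  by (simp add: delbar_eq[OF M] is_form_global_ext_d[OF M])

lemma is_form_delbar_beltrami: "is_form \<A> \<omega> \<Longrightarrow> is_form \<A> (delbar_beltrami \<A> \<phi> \<omega>)"
  unfolding delbar_beltrami_eq
  by (intro is_form_add[OF M] is_form_cmult[OF M] is_form_delbar is_form_del is_form_contract_beltrami \<phi>)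

lemma is_form_d_beltrami: "is_form \<A> \<omega> \<Longrightarrow> is_form \<A> (d_beltrami \<A> \<phi> \<omega>)"
  unfolding d_beltrami_def by (intro is_form_add[OF M] is_form_del is_form_delbar_beltrami)

lemma delbar_add: "is_form \<A> \<omega> \<Longrightarrow> is_form \<A> \<eta> \<Longrightarrow>
    delbar \<A> (\<lambda>c z us. \<omega> c z us + \<eta> c z us) = (\<lambda>c z us. delbar \<A> \<omega> c z us + delbar \<A> \<eta> c z us)"
  by (simp add: delbar_eq[OF M] is_form_add[OF M] global_ext_d_add[OF M])

lemma delbar_cmult: "is_form \<A> \<omega> \<Longrightarrow> delbar \<A> (\<lambda>c z us. r * \<omega> c z us) = (\<lambda>c z us. r * delbar \<A> \<omega> c z us)"
  by (simp add: delbar_eq[OF M] is_form_cmult[OF M] global_ext_d_cmult[OF M])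

lemma delbar_beltrami_add:
  "is_form \<A> \<omega> \<Longrightarrow> is_form \<A> \<eta> \<Longrightarrow> delbar_beltrami \<A> \<phi> (\<lambda>c z us. \<omega> c z us + \<eta> c z us)
    = (\<lambda>c z us. delbar_beltrami \<A> \<phi> \<omega> c z us + delbar_beltrami \<A> \<phi> \<eta> c z us)"
  unfolding delbar_beltrami_eq
  by (simp add: delbar_add del_add contract_beltrami_add[OF \<phi>] is_form_del is_form_contract_beltrami[OF \<phi>] algebra_simps)

lemma delbar_beltrami_cmult:
  "is_form \<A> \<omega> \<Longrightarrow> delbar_beltrami \<A> \<phi> (\<lambda>c z us. r * \<omega> c z us) = (\<lambda>c z us. r * delbar_beltrami \<A> \<phi> \<omega> c z us)"
  unfolding delbar_beltrami_eq
  by (simp add: delbar_cmult del_cmult contract_beltrami_cmult is_form_del is_form_contract_beltrami[OF \<phi>] algebra_simps)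

text \<open>Expand d d = 0: the squares of \<partial> and \<partial>bar vanish separately.\<close>

lemma del_delbar:
  assumes "is_form \<A> \<omega>"
  shows "del \<A> (delbar \<A> \<omega>) c z us = - delbar \<A> (del \<A> \<omega>) c z us"
proof -
  note f = assms is_form_del[OF assms] is_form_delbar[OF assms]
  have split: "global_ext_d \<A> 1 0 \<eta> = (\<lambda>c z us. del \<A> \<eta> c z us + delbar \<A> \<eta> c z us)" if "is_form \<A> \<eta>" for \<eta>
    using ext_deriv_split[OF that] by (intro ext)
  have "delbar \<A> (delbar \<A> \<omega>) = (\<lambda>c z us. 0)"
    using global_ext_d_global_ext_d[OF M assms, of "1/2" "\<i>/2"] f by (simp add: delbar_eq[OF M])
  moreover have "global_ext_d \<A> 1 0 (global_ext_d \<A> 1 0 \<omega>) c z us = 0"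
    using global_ext_d_global_ext_d[OF M assms, of 1 0] by simp
  ultimately show ?thesis
    by (simp add: split f is_form_add[OF M] del_add delbar_add del_del add_eq_0_iff2 algebra_simps)
qed

text \<open>\<partial> anticommutes with \<partial>bar, and also with the Lie derivative L =
  i_\<phi> \<partial> - \<partial> i_\<phi>, since \<partial> L = \<partial> i_\<phi> \<partial> = -
  L \<partial>.\<close>

lemma del_delbar_beltrami:
  assumes "is_form \<A> \<omega>"
  shows "del \<A> (delbar_beltrami \<A> \<phi> \<omega>) c z us = - delbar_beltrami \<A> \<phi> (del \<A> \<omega>) c z us"
proof -
  note f = assms is_form_del is_form_delbar is_form_contract_beltrami[OF \<phi>] is_form_add[OF M] is_form_cmult[OF M]
  have "contract_beltrami \<A> \<phi> (\<lambda>c z us. 0) = (\<lambda>c z us. 0)"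
    using contract_beltrami_cmult[OF is_form_zero[OF M], of \<phi> 0] by simp
  then show ?thesis
    unfolding delbar_beltrami_eq
    by (simp add: f is_form_diff del_add del_diff del_del del_delbar)
qed

end

end

section \<open>Consequences of integrability and of the \<partial>\<partial>bar_\<phi>-lemma\<close>

context
  fixes X :: "'a topology" and \<A> :: "('a, 'n::finite) chart set" and \<phi> :: "('a, 'n) beltrami"
  assumes M: "complex_manifold X \<A>" and \<phi>: "is_beltrami \<A> \<phi>"
begin

lemma rot_pullback_add: "rot_pullback (\<lambda>c z us. \<omega> c z us + \<eta> c z us)
    = (\<lambda>c z us. rot_pullback \<omega> c z us + rot_pullback \<eta> c z us)"
  by (simp add: rot_pullback_def)

lemma rot_pullback_cmult: "rot_pullback (\<lambda>c z us. r * \<omega> c z us) = (\<lambda>c z us. r * rot_pullback \<omega> c z us)"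
  by (simp add: rot_pullback_def)

lemma rot_pullback_del:
  "is_form \<A> \<omega> \<Longrightarrow> rot_pullback (del \<A> \<omega>) = (\<lambda>c z us. \<i> * del \<A> (rot_pullback \<omega>) c z us)"
  using global_ext_d_rot[OF M, of \<omega> \<i> "1/2" "-\<i>/2"] is_form_rot_pullback[OF M, of \<omega>]
  by (simp add: del_eq[OF M])

lemma rot_pullback_delbar:
  "is_form \<A> \<omega> \<Longrightarrow> rot_pullback (delbar \<A> \<omega>) = (\<lambda>c z us. - \<i> * delbar \<A> (rot_pullback \<omega>) c z us)"
  using global_ext_d_rot[OF M, of \<omega> "-\<i>" "1/2" "\<i>/2"] is_form_rot_pullback[OF M, of \<omega>]
  by (simp add: delbar_eq[OF M])

lemma rot_pullback_contract_beltrami: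
  "is_form \<A> \<omega> \<Longrightarrow> rot_pullback (contract_beltrami \<A> \<phi> \<omega>) = (\<lambda>c z us. - 1 * contract_beltrami \<A> \<phi> (rot_pullback \<omega>) c z us)"
  by (simp add: contract_beltrami_rot[OF M \<phi>])

text \<open>In the Lie derivative the factor -1 of the contraction and the factor \<i> of \<partial>
  combine to -\<i>, the factor of \<partial>bar; all of \<partial>bar_\<phi> has type (0,1).\<close>

lemma rot_pullback_delbar_beltrami:
  assumes "is_form \<A> \<omega>"
  shows "rot_pullback (delbar_beltrami \<A> \<phi> \<omega>) = (\<lambda>c z us. - \<i> * delbar_beltrami \<A> \<phi> (rot_pullback \<omega>) c z us)"
proof -
  note f = assms is_form_rot_pullback[OF M] is_form_del[OF M \<phi>] is_form_contract_beltrami[OF M \<phi>]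
  have 1: "rot_pullback (contract_beltrami \<A> \<phi> (del \<A> \<omega>))
    = (\<lambda>c z us. - \<i> * contract_beltrami \<A> \<phi> (del \<A> (rot_pullback \<omega>)) c z us)"
    unfolding rot_pullback_contract_beltrami[OF f(3)[OF f(1)]] rot_pullback_del[OF f(1)]
    by (subst contract_beltrami_cmult[OF M]) (simp_all add: f)
  have 2: "rot_pullback (del \<A> (contract_beltrami \<A> \<phi> \<omega>))
    = (\<lambda>c z us. - \<i> * del \<A> (contract_beltrami \<A> \<phi> (rot_pullback \<omega>)) c z us)"
    unfolding rot_pullback_del[OF f(4)[OF f(1)]] rot_pullback_contract_beltrami[OF f(1)]
    by (subst del_cmult[OF M \<phi>]) (simp_all add: f)
  show ?thesis
    unfolding delbar_beltrami_eq[OF M \<phi>] rot_pullback_add rot_pullback_cmult rot_pullback_delbar[OF f(1)] 1 2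
    by (simp add: algebra_simps)
qed

lemma d_beltrami_eq: "d_beltrami \<A> \<phi> \<omega> = (\<lambda>c z us. del \<A> \<omega> c z us + delbar_beltrami \<A> \<phi> \<omega> c z us)"
  by (simp add: d_beltrami_def)

lemma del_d_beltrami:
  assumes "is_form \<A> \<omega>"
  shows "del \<A> (d_beltrami \<A> \<phi> \<omega>) = del \<A> (delbar_beltrami \<A> \<phi> \<omega>)"
  using assms is_form_del[OF M \<phi>] is_form_delbar_beltrami[OF M \<phi>]
  by (simp add: d_beltrami_eq del_add[OF M \<phi>] del_del[OF M \<phi>])

lemma ext_d_global_exp:
  assumes "integrable_beltrami \<A> \<phi>" "is_form \<A> \<omega>"
  shows "global_ext_d \<A> 1 0 (global_exp \<A> \<phi> \<omega>) = global_exp \<A> \<phi> (d_beltrami \<A> \<phi> \<omega>)"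
proof (rule form_eqI[OF M])
  fix c z us assume c: "c \<in> \<A>" "z \<in> chart_image c"
  note f = assms(2) is_form_del[OF M \<phi>] is_form_contract_beltrami[OF M \<phi>]
  have eq: "d_beltrami \<A> \<phi> \<omega> c z = (\<lambda>ws. ext_d 1 0 (\<omega> c) z ws - contract_rec (\<phi> c z) (ext_d (1/2) (-\<i>/2) (\<omega> c) z) ws
        + ext_d (1/2) (-\<i>/2) (\<lambda>y. contract_rec (\<phi> c y) (\<omega> c y)) z ws)"
  proof
    fix ws
    have "del \<A> (contract_beltrami \<A> \<phi> \<omega>) c z ws = ext_d (1/2) (-\<i>/2) (contract_beltrami \<A> \<phi> \<omega> c) z ws"
      using c f by (simp add: del_eq[OF M] global_ext_d_apply[OF M])
    also have "\<dots> = ext_d (1/2) (-\<i>/2) (\<lambda>y. contract_rec (\<phi> c y) (\<omega> c y)) z ws"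
      by (rule ext_d_cong[OF chart_image_open[OF M c(1)] c(2)])
        (simp add: contract_beltrami_eq[OF M f(1)] on_charts_apply[OF M] c(1))
    finally have 1: "del \<A> (contract_beltrami \<A> \<phi> \<omega>) c z ws = ext_d (1/2) (-\<i>/2) (\<lambda>y. contract_rec (\<phi> c y) (\<omega> c y)) z ws" .
    have 2: "contract_beltrami \<A> \<phi> (del \<A> \<omega>) c z ws = contract_rec (\<phi> c z) (ext_d (1/2) (-\<i>/2) (\<omega> c) z) ws"
      using c f contract_beltrami_eq[OF M f(2)[OF f(1)], of \<phi>]
      by (simp add: on_charts_apply[OF M] del_eq[OF M f(1)] global_ext_d_apply[OF M])
    show "d_beltrami \<A> \<phi> \<omega> c z ws = ext_d 1 0 (\<omega> c) z ws - contract_rec (\<phi> c z) (ext_d (1/2) (-\<i>/2) (\<omega> c) z) ws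
        + ext_d (1/2) (-\<i>/2) (\<lambda>y. contract_rec (\<phi> c y) (\<omega> c y)) z ws"
      using ext_deriv_split[OF M \<phi> f(1), of c z ws] c
      by (simp add: d_beltrami_eq delbar_beltrami_eq[OF M \<phi>] 1 2 global_ext_d_apply[OF M])
  qed
  have "ext_d 1 0 (global_exp \<A> \<phi> \<omega> c) z us = ext_d 1 0 (\<lambda>y. contract_exp (\<phi> c y) (\<omega> c y)) z us"
    by (rule ext_d_cong[OF chart_image_open[OF M c(1)] c(2)]) (simp add: global_exp_def on_charts_apply[OF M] c(1))
  also have "\<dots> = contract_exp (\<phi> c z) (d_beltrami \<A> \<phi> \<omega> c z) us"
    unfolding eq
    by (rule ext_d_contract_exp[OF chart_image_open[OF M c(1)] c(2) beltrami_matrix[OF M \<phi> c(1)]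
          form_smooth[OF M f(1) c(1)] form_alternating[OF M f(1) c(1)]])
      (use assms(1) c in \<open>auto simp: integrable_beltrami_def\<close>)
  finally show "global_ext_d \<A> 1 0 (global_exp \<A> \<phi> \<omega>) c z us = global_exp \<A> \<phi> (d_beltrami \<A> \<phi> \<omega>) c z us"
    using c by (simp add: global_ext_d_apply[OF M] global_exp_def on_charts_apply[OF M])
qed (intro is_form_global_ext_d[OF M] is_form_global_exp[OF M] is_form_d_beltrami[OF M \<phi>] \<phi> assms)+

context
  assumes int: "integrable_beltrami \<A> \<phi>" and lem: "del_delbar_lemma \<A> \<phi>"
begin

text \<open>Transported from d d = 0 through the invertible exponential.\<close>

lemma d_beltrami_d_beltrami:
  assumes "is_form \<A> \<omega>"
  shows "d_beltrami \<A> \<phi> (d_beltrami \<A> \<phi> \<omega>) = (\<lambda>c z us. 0)"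
proof -
  note f = assms is_form_d_beltrami[OF M \<phi>]
  have "global_exp \<A> \<phi> (d_beltrami \<A> \<phi> (d_beltrami \<A> \<phi> \<omega>)) = (\<lambda>c z us. 0)"
    using f ext_d_global_exp[OF int] global_ext_d_global_ext_d[OF M is_form_global_exp[OF M \<phi> f(1)], of 1 0] by simp
  then show ?thesis
    using global_exp_inverse[OF M \<phi> f(2)[OF f(2)[OF f(1)]]] global_exp_zero[OF M] by simp
qed

text \<open>From \<partial> \<partial>bar_\<phi> \<omega> = 0 follows \<partial> d_\<phi> \<omega> =
  0, and then d_\<phi> d_\<phi> = 0 leaves \<partial>bar_\<phi> d_\<phi> \<omega> = 0, so d_\<phi>
  \<omega> lies in the intersection of \<open>del_delbar_lemma\<close>.\<close>

lemma del_delbar_exact: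
  assumes "is_form \<A> \<omega>" "del \<A> (delbar_beltrami \<A> \<phi> \<omega>) = (\<lambda>c z us. 0)"
  shows "\<exists>w. is_form \<A> w \<and> d_beltrami \<A> \<phi> \<omega> = del \<A> (delbar_beltrami \<A> \<phi> w)"
proof -
  note f = assms(1) is_form_d_beltrami[OF M \<phi>]
  have 1: "del \<A> (d_beltrami \<A> \<phi> \<omega>) = (\<lambda>c z us. 0)"
    using del_d_beltrami[OF f(1)] assms(2) by simp
  have 2: "delbar_beltrami \<A> \<phi> (d_beltrami \<A> \<phi> \<omega>) = (\<lambda>c z us. 0)"
    using d_beltrami_d_beltrami[OF f(1)] d_beltrami_eq[of "d_beltrami \<A> \<phi> \<omega>"] 1 by simp
  have "d_beltrami \<A> \<phi> \<omega> \<in> (\<lambda>\<omega>. del \<A> (delbar_beltrami \<A> \<phi> \<omega>)) ` {\<omega>. is_form \<A> \<omega>}"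
    using lem f 1 2 unfolding del_delbar_lemma_def by blast
  then show ?thesis by blast
qed

text \<open>\<open>T = rot_pullback\<close> maps \<open>d\<^sub>\<phi> (T \<omega>)\<close> to a combination of the two parts of \<open>d\<^sub>\<phi> \<omega>\<close> with other
  coefficients, so both parts are separately \<open>\<partial>\<partial>bar\<^sub>\<phi>\<close>-exact.\<close>

lemma del_delbar_exact_parts:
  assumes \<omega>: "is_form \<A> \<omega>" and zero: "del \<A> (delbar_beltrami \<A> \<phi> \<omega>) = (\<lambda>c z us. 0)"
  shows "\<exists>w. is_form \<A> w \<and> del \<A> \<omega> = del \<A> (delbar_beltrami \<A> \<phi> w)"
    and "\<exists>w. is_form \<A> w \<and> delbar_beltrami \<A> \<phi> \<omega> = del \<A> (delbar_beltrami \<A> \<phi> w)"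
proof -
  let ?T = rot_pullback and ?Q = "delbar_beltrami \<A> \<phi>"
  note f = \<omega> is_form_rot_pullback[OF M] is_form_del[OF M \<phi>] is_form_delbar_beltrami[OF M \<phi>] is_form_cmult[OF M] is_form_add[OF M]
  have T_inj: "\<eta> = \<eta>'" if "?T \<eta> = ?T \<eta>'" "is_form \<A> \<eta>" "is_form \<A> \<eta>'" for \<eta> \<eta>' :: "('a, 'n) form"
    using arg_cong[OF that(1), of "\<lambda>x. ?T (?T (?T x))"]
    unfolding rot_pullback_4[OF M that(2)] rot_pullback_4[OF M that(3)] .
  \<comment> \<open>Moving T past \<partial> and past \<partial>bar_\<phi> costs the factors \<i>
    and -\<i>; their product is 1, so T commutes with the composition.\<close>
  have del_Q_T: "del \<A> (?Q (?T \<eta>)) = ?T (del \<A> (?Q \<eta>))" if "is_form \<A> \<eta>" for \<eta>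
  proof -
    have "(\<lambda>c z us. - \<i> * del \<A> (?Q (?T \<eta>)) c z us) = del \<A> (?T (?Q \<eta>))"
      unfolding rot_pullback_delbar_beltrami[OF that]
      by (rule del_cmult[OF M \<phi> f(4)[OF f(2)[OF that]], symmetric])
    then have 1: "- \<i> * del \<A> (?Q (?T \<eta>)) c z us = del \<A> (?T (?Q \<eta>)) c z us" for c z us
      by (rule fun_cong[THEN fun_cong, THEN fun_cong])
    have "?T (del \<A> (?Q \<eta>)) c z us = \<i> * del \<A> (?T (?Q \<eta>)) c z us" for c z us
      using rot_pullback_del[OF f(4)[OF that]] by simp
    then have "?T (del \<A> (?Q \<eta>)) c z us = del \<A> (?Q (?T \<eta>)) c z us" for c z us
      unfolding 1[symmetric] by simp
    then show ?thesis by (intro ext) (rule sym)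
  qed
  obtain w where w: "is_form \<A> w" "d_beltrami \<A> \<phi> \<omega> = del \<A> (?Q w)"
    using del_delbar_exact[OF \<omega> zero] by blast
  have "del \<A> (?Q (?T \<omega>)) = (\<lambda>c z us. 0)"
    unfolding del_Q_T[OF \<omega>] zero by (simp add: rot_pullback_def)
  then obtain u where u: "is_form \<A> u" "d_beltrami \<A> \<phi> (?T \<omega>) = del \<A> (?Q u)"
    using del_delbar_exact[OF f(2)[OF \<omega>]] by blast
  \<comment> \<open>T has order four, so its cube gives the preimage of u.\<close>
  define u' where "u' = ?T (?T (?T u))"
  have u': "is_form \<A> u'" "?T u' = u"
    unfolding u'_def using f(2) u(1) rot_pullback_4[OF M u(1)] by auto
  \<comment> \<open>Pulling T out of d_\<phi> (T \<omega>) multiplies the two parts by -\<i> and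
    \<i>, the inverses of the factors in \<open>rot_pullback_del\<close> and
    \<open>rot_pullback_delbar_beltrami\<close>.\<close>
  have "?T (\<lambda>c z us. - \<i> * del \<A> \<omega> c z us + \<i> * ?Q \<omega> c z us) = d_beltrami \<A> \<phi> (?T \<omega>)"
    unfolding rot_pullback_add rot_pullback_cmult rot_pullback_del[OF \<omega>] rot_pullback_delbar_beltrami[OF \<omega>] d_beltrami_eq
    by simp
  also have "\<dots> = ?T (del \<A> (?Q u'))"
    using u(2) del_Q_T[OF u'(1)] u'(2) by simp
  finally have eq2: "(\<lambda>c z us. - \<i> * del \<A> \<omega> c z us + \<i> * ?Q \<omega> c z us) = del \<A> (?Q u')"
    by (rule T_inj) (intro f u')+
  have eq1: "(\<lambda>c z us. del \<A> \<omega> c z us + ?Q \<omega> c z us) = del \<A> (?Q w)"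
    using w(2) by (simp add: d_beltrami_eq)
  have comb: "is_form \<A> (\<lambda>c z us. r * w c z us + s * u' c z us)"
    "del \<A> (?Q (\<lambda>c z us. r * w c z us + s * u' c z us)) = (\<lambda>c z us. r * del \<A> (?Q w) c z us + s * del \<A> (?Q u') c z us)" for r s
    using w(1) u'(1) by (simp_all add: f delbar_beltrami_add[OF M \<phi>] delbar_beltrami_cmult[OF M \<phi>] del_add[OF M \<phi>] del_cmult[OF M \<phi>])
  \<comment> \<open>The coefficients solve a linear system: with S = \<partial> \<omega> + Q
    \<omega> and S' = -\<i> \<partial> \<omega> + \<i> Q \<omega> one has \<partial> \<omega> = S/2
    + \<i> S'/2 and Q \<omega> = S/2 - \<i> S'/2.\<close>
  have "del \<A> \<omega> = del \<A> (?Q (\<lambda>c z us. (1/2) * w c z us + (\<i>/2) * u' c z us))"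
    unfolding comb(2) eq1[symmetric] eq2[symmetric] by (simp add: algebra_simps)
  then show "\<exists>w. is_form \<A> w \<and> del \<A> \<omega> = del \<A> (?Q w)" using comb(1) by blast
  have "?Q \<omega> = del \<A> (?Q (\<lambda>c z us. (1/2) * w c z us + (-\<i>/2) * u' c z us))"
    unfolding comb(2) eq1[symmetric] eq2[symmetric] by (simp add: algebra_simps)
  then show "\<exists>w. is_form \<A> w \<and> ?Q \<omega> = del \<A> (?Q w)" using comb(1) by blast
qed

theorem formal_de_rham: "formal (de_rham \<A>)"
proof -
  interpret dg_algebra "de_rham \<A>" by (rule dg_algebra_de_rham[OF M])
  let ?E = "global_exp \<A> \<phi>" and ?E' = "global_exp \<A> (\<lambda>c z. - \<phi> c z)"
  let ?Q = "delbar_beltrami \<A> \<phi>" and ?d = "d_beltrami \<A> \<phi>" and ?ext = "global_ext_d \<A> 1 0"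
  define P where "P x = ?E (del \<A> (?E' x))" for x
  note E = is_form_global_exp[OF M \<phi>] and E' = is_form_global_exp[OF M is_beltrami_uminus[OF M \<phi>]]
  note del = is_form_del[OF M \<phi>] and Q = is_form_delbar_beltrami[OF M \<phi>] and d = is_form_d_beltrami[OF M \<phi>]
  have E'E: "?E' (?E \<omega>) = \<omega>" if "is_form \<A> \<omega>" for \<omega>
    by (rule global_exp_inverse[OF M \<phi> that])
  have P_E: "P (?E \<omega>) = ?E (del \<A> \<omega>)" if "is_form \<A> \<omega>" for \<omega>
    by (simp add: P_def E'E that)
  have d_E: "?ext (?E \<omega>) = ?E (?d \<omega>)" if "is_form \<A> \<omega>" for \<omega>
    by (rule ext_d_global_exp[OF int that])
  have E_zero: "\<omega> = (\<lambda>c z us. 0)" if "is_form \<A> \<omega>" "?E \<omega> = (\<lambda>c z us. 0)" for \<omega>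
    using E'E[OF that(1)] that(2) global_exp_zero[OF M] by simp
  \<comment> \<open>Every form is the exponential of some \<omega>, so the conditions of
    \<open>formalI\<close> are checked on \<omega>, with \<partial> and d_\<phi> in place of P and
    d.\<close>
  have surj: "\<exists>\<omega>. is_form \<A> \<omega> \<and> x = ?E \<omega>" if "is_form \<A> x" for x
    using global_exp_inverse'[OF M \<phi> that] E'[OF that] by metis
  \<comment> \<open>The image of P d thus corresponds to the right side of the
    \<partial>\<partial>bar_\<phi>-lemma.\<close>
  have PdE: "P (?ext (?E \<omega>)) = ?E (del \<A> (?Q \<omega>))" if "is_form \<A> \<omega>" for \<omega>
    using that by (simp add: d_E P_E d del_d_beltrami)
  have del_Q: "del \<A> (?Q \<omega>) = (\<lambda>c z us. - 1 * ?Q (del \<A> \<omega>) c z us)" if "is_form \<A> \<omega>" for \<omega>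
    using del_delbar_beltrami[OF M \<phi> that] by (intro ext) simp
  \<comment> \<open>On \<partial>-exact forms d_\<phi> reduces to \<partial>bar_\<phi>, so d P
    corresponds to \<partial>bar_\<phi> \<partial>; with \<open>del_Q\<close> this gives the
    anticommutation of P and d.\<close>
  have Q_del: "?d (del \<A> \<omega>) = ?Q (del \<A> \<omega>)" if "is_form \<A> \<omega>" for \<omega>
    by (simp add: d_beltrami_eq del_del[OF M \<phi> that])
  have zero: "del \<A> (?Q \<omega>) = (\<lambda>c z us. 0)" if "is_form \<A> \<omega>" "?E (del \<A> (?Q \<omega>)) = (\<lambda>c z us. 0)" for \<omega>
    by (rule E_zero[OF del[OF Q[OF that(1)]] that(2)])
  show ?thesis
  proof (rule formalI[of P]; (unfold de_rham_simps(1,4,5,6,8)[OF M] mem_Collect_eq)?)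
    show "derivation P"
      unfolding derivation_def
    proof (intro conjI ballI allI)
      fix x y assume "x \<in> carrier (de_rham \<A>)" "y \<in> carrier (de_rham \<A>)"
      then have "is_form \<A> x" "is_form \<A> y" by (simp_all add: de_rham_simps[OF M])
      then show "P (x \<oplus>\<^bsub>de_rham \<A>\<^esub> y) = P x \<oplus>\<^bsub>de_rham \<A>\<^esub> P y"
        by (simp add: P_def de_rham_simps[OF M] global_exp_add[OF M] del_add[OF M \<phi>] E')
    next
      fix r x assume "x \<in> carrier (de_rham \<A>)"
      then have "is_form \<A> x" by (simp add: de_rham_simps[OF M])
      then show "P (r \<odot>\<^bsub>de_rham \<A>\<^esub> x) = r \<odot>\<^bsub>de_rham \<A>\<^esub> P x"
        by (simp add: P_def de_rham_simps[OF M] global_exp_cmult[OF M] del_cmult[OF M \<phi>] E')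
    next
      fix k x assume x: "x \<in> grade (de_rham \<A>) k"
      have x': "?E' x \<in> grade (de_rham \<A>) k" by (rule global_exp_grade[OF M is_beltrami_uminus[OF M \<phi>] x])
      then have f: "is_form \<A> (?E' x)" "is_form \<A> x" using x by (simp_all add: de_rham_simps[OF M])
      show "P x \<in> grade (de_rham \<A>) (Suc k)"
        unfolding P_def del_eq[OF M f(1)] by (intro global_exp_grade[OF M \<phi>] global_ext_d_grade[OF M] x')
      fix y assume "y \<in> carrier (de_rham \<A>)"
      then have y: "is_form \<A> y" by (simp add: de_rham_simps[OF M])
      have m: "is_form \<A> (?E' x \<otimes>\<^bsub>de_rham \<A>\<^esub> ?E' y)"
        using is_form_wedge[OF M f(1) E'[OF y]] by (simp add: de_rham_simps[OF M])
      \<comment> \<open>A derivation conjugated by an algebra automorphism: the inverse exponential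
        splits the product, \<partial> obeys the Leibniz rule, and the exponential restores the
        factors.\<close>
      have "P (x \<otimes>\<^bsub>de_rham \<A>\<^esub> y) = ?E (del \<A> (?E' x \<otimes>\<^bsub>de_rham \<A>\<^esub> ?E' y))"
        by (simp only: P_def global_exp_mult[OF M is_beltrami_uminus[OF M \<phi>] f(2) y])
      also have "\<dots> = ?E ((del \<A> (?E' x) \<otimes>\<^bsub>de_rham \<A>\<^esub> ?E' y) \<oplus>\<^bsub>de_rham \<A>\<^esub>
          ((- 1) ^ k \<odot>\<^bsub>de_rham \<A>\<^esub> (?E' x \<otimes>\<^bsub>de_rham \<A>\<^esub> del \<A> (?E' y))))"
        by (simp only: del_eq[OF M m] del_eq[OF M f(1)] del_eq[OF M E'[OF y]] global_ext_d_wedge[OF M x' E'[OF y]])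
      also have "\<dots> = ?E (del \<A> (?E' x) \<otimes>\<^bsub>de_rham \<A>\<^esub> ?E' y) \<oplus>\<^bsub>de_rham \<A>\<^esub>
          ((- 1) ^ k \<odot>\<^bsub>de_rham \<A>\<^esub> ?E (?E' x \<otimes>\<^bsub>de_rham \<A>\<^esub> del \<A> (?E' y)))"
        by (simp only: de_rham_simps(5,6)[OF M] global_exp_add[OF M] global_exp_cmult[OF M])
      also have "\<dots> = (P x \<otimes>\<^bsub>de_rham \<A>\<^esub> y) \<oplus>\<^bsub>de_rham \<A>\<^esub> ((- 1) ^ k \<odot>\<^bsub>de_rham \<A>\<^esub> (x \<otimes>\<^bsub>de_rham \<A>\<^esub> P y))"
        by (simp only: P_def global_exp_mult[OF M \<phi> del[OF f(1)] E'[OF y]] global_exp_mult[OF M \<phi> f(1) del[OF E'[OF y]]]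
            global_exp_inverse'[OF M \<phi> f(2)] global_exp_inverse'[OF M \<phi> y])
      finally show "P (x \<otimes>\<^bsub>de_rham \<A>\<^esub> y)
          = (P x \<otimes>\<^bsub>de_rham \<A>\<^esub> y) \<oplus>\<^bsub>de_rham \<A>\<^esub> ((- 1) ^ k \<odot>\<^bsub>de_rham \<A>\<^esub> (x \<otimes>\<^bsub>de_rham \<A>\<^esub> P y))" .
    qed
  next
    fix x assume "is_form \<A> x"
    then obtain \<omega> where \<omega>: "is_form \<A> \<omega>" "x = ?E \<omega>" using surj by blast
    show "P (P x) = (\<lambda>c z us. 0)"
      using \<omega> by (simp add: P_E del del_del[OF M \<phi>] global_exp_zero[OF M])
    show "P (?ext x) = (\<lambda>c z us. - 1 * ?ext (P x) c z us)"
      unfolding \<omega>(2) PdE[OF \<omega>(1)] P_E[OF \<omega>(1)] d_E[OF del[OF \<omega>(1)]] Q_del[OF \<omega>(1)] del_Q[OF \<omega>(1)]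
      by (rule global_exp_cmult[OF M])
    show "\<exists>w\<in>{\<omega>. is_form \<A> \<omega>}. ?ext x = P (?ext w)" if "P (?ext x) = (\<lambda>c z us. 0)"
    proof -
      have "del \<A> (?Q \<omega>) = (\<lambda>c z us. 0)"
        by (rule zero[OF \<omega>(1)]) (use that \<omega> PdE in simp)
      from del_delbar_exact[OF \<omega>(1) this] obtain w where w: "is_form \<A> w" "?d \<omega> = del \<A> (?Q w)" by blast
      have "?ext x = P (?ext (?E w))" unfolding \<omega>(2) PdE[OF w(1)] d_E[OF \<omega>(1)] w(2) ..
      then show ?thesis using E[OF w(1)] by blast
    qed
    show "\<exists>w\<in>{\<omega>. is_form \<A> \<omega>}. P x = P (?ext w)" if "?ext (P x) = (\<lambda>c z us. 0)"
    proof -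
      have "?Q (del \<A> \<omega>) = (\<lambda>c z us. 0)"
        by (rule E_zero[OF Q[OF del[OF \<omega>(1)]]])
          (use that in \<open>simp only: \<omega>(2) P_E[OF \<omega>(1)] d_E[OF del[OF \<omega>(1)]] Q_del[OF \<omega>(1)]\<close>)
      then have "del \<A> (?Q \<omega>) = (\<lambda>c z us. 0)" by (simp add: del_Q[OF \<omega>(1)])
      from del_delbar_exact_parts(1)[OF \<omega>(1) this] obtain w where w: "is_form \<A> w" "del \<A> \<omega> = del \<A> (?Q w)" by blast
      have "P x = P (?ext (?E w))" unfolding \<omega>(2) PdE[OF w(1)] P_E[OF \<omega>(1)] w(2) ..
      then show ?thesis using E[OF w(1)] by blast
    qed
    \<comment> \<open>Under the exponential d - P corresponds to \<partial>bar_\<phi>.\<close>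
    have diff: "(\<lambda>c z us. ?ext x c z us + - 1 * P x c z us) = ?E (?Q \<omega>)"
      using \<omega> by (simp add: d_E P_E d_beltrami_eq global_exp_add[OF M])
    show "\<exists>w\<in>{\<omega>. is_form \<A> \<omega>}. (\<lambda>c z us. ?ext x c z us + - 1 * P x c z us) = P (?ext w)"
      if "P (\<lambda>c z us. ?ext x c z us + - 1 * P x c z us) = (\<lambda>c z us. 0)"
    proof -
      have "del \<A> (?Q \<omega>) = (\<lambda>c z us. 0)"
        by (rule zero[OF \<omega>(1) that[unfolded diff P_E[OF Q[OF \<omega>(1)]]]])
      from del_delbar_exact_parts(2)[OF \<omega>(1) this] obtain w where w: "is_form \<A> w" "?Q \<omega> = del \<A> (?Q w)" by blast
      have "?E (?Q \<omega>) = P (?ext (?E w))" unfolding PdE[OF w(1)] w(2) ..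
      then show ?thesis unfolding diff using E[OF w(1)] by blast
    qed
  qed
qed

end

end

theorem theorem1p4:
  fixes X :: "'a topology"
    and \<A> \<A>\<^sub>t :: "('a, 'n::finite) chart set"
    and \<phi> :: "('a, 'n) beltrami"
  assumes "complex_manifold X \<A>"
    and "compact_space X"
    and "complex_manifold X \<A>\<^sub>t"
    and "same_smooth_structure \<A> \<A>\<^sub>t"
    and "is_beltrami \<A> \<phi>"
    and "represents_structure X \<A> \<phi> \<A>\<^sub>t"
    and "del_delbar_lemma \<A> \<phi>"
  shows "formal (de_rham \<A>)"
proof (rule formal_de_rham)
  show "integrable_beltrami \<A> \<phi>"
    using assms(6) by (simp add: represents_structure_def)
qed (rule assms)+

end
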